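(* Let $0<\gamma\ll1$ (sufficiently small) and $\tau>1$. For $\theta\in\mathrm{DC}_{\gamma,\tau}$ and $\varepsilon>0$ consider on $\ell^2(\mathbb{Z}^2)$ the operator $$(\mathcal{H}_{\theta,\varepsilon}u)(n)=\sum_{m\in\mathbb{Z}^2,\ |m-n|=1}u(m)+(n_1\cos\theta+n_2\sin\theta)\,u(n)+\varepsilon\,v(n)u(n).$$ Fix constants $0<\mu<1$ and $\rho,a>0$. Assume that $v:\mathbb{Z}^2\to\mathbb{R}$ satisfies $$|v(n)|\le(\ln\langle n\rangle)^{-\sigma},\qquad\forall n\in\mathbb{Z}^2,$$ where $\sigma>\tau/\mu$. Then there exists a sufficiently small constant $\varepsilon_0=\varepsilon_0(\mu,\tau,\sigma,\gamma,\rho,a)>0$ such that for every $0<\varepsilon<\varepsilon_0$ there exists a Cantor-like set $\mathcal{O}_\varepsilon\subset\mathrm{DC}_{\gamma,\tau}$ satisfying $$\mathrm{meas}(\mathrm{DC}_{\gamma,\tau}\setminus\mathcal{O}_\varepsilon)\le C_0\,\varepsilon^{1/10},$$ where $C_0=C_0(\mu,\tau,\sigma,\gamma,\rho,a)>0$ is a constant, with the following property. For every $\theta\in\mathcal{O}_\varepsilon$, the operator $\mathcal{H}_{\theta,\varepsilon}$ has purely point spectrum and every eigenvalue is simple. Moreover, there exists a complete orthonormal basis $\{\psi_n\}_{n\in\mathbb{Z}^2}$ of eigenfunctions of $\mathcal{H}_{\theta,\varepsilon}$ such that for all $m,n\in\mathbb{Z}^2$, $$|\psi_n(m)|\le C_1\,e^{-\frac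 a4|m-n|},$$ with $C_1=C_1(\mu,\tau,\sigma,\gamma,\rho,a,\varepsilon)>0$.
   Context: For $n=(n_1,n_2)\in\mathbb{Z}^2$, $|n|=|n_1|+|n_2|$ and $\langle n\rangle=\max\{e,|n|\}$. The set of Diophantine angles is $$\mathrm{DC}_{\gamma,\tau}=\Big\{\theta\in[0,2\pi]:\ |n_1\cos\theta+n_2\sin\theta|\ge\frac{\gamma}{|n|^\tau}\ \ \forall n\in\mathbb{Z}^2\setminus\{0\}\Big\}.$$ $\mathcal{H}_{\theta,\varepsilon}$ is viewed as the self-adjoint operator with domain $\{u\in\ell^2(\mathbb{Z}^2):\ ((n_1\cos\theta+n_2\sin\theta)u(n))_{n}\in\ell^2(\mathbb{Z}^2)\}$. "Purely point spectrum" means that $\ell^2(\mathbb{Z}^2)$ has an orthonormal basis of eigenvectors. "meas" is Lebesgue measure. "Cantor-like" is a descriptive term which the paper does not define. *)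

theory Defs
  imports "HOL-Analysis.Analysis"
begin

section \<open>The lattice and the Diophantine angles\<close>

type_synonym site = "int \<times> int"

definition l1norm :: "site \<Rightarrow> real" where
  "l1norm n = \<bar>real_of_int (fst n)\<bar> + \<bar>real_of_int (snd n)\<bar>"

definition bracket :: "site \<Rightarrow> real" where
  "bracket n = max (exp 1) (l1norm n)"

definition slope :: "real \<Rightarrow> site \<Rightarrow> real" where
  "slope \<theta> n = real_of_int (fst n) * cos \<theta> + real_of_int (snd n) * sin \<theta>"

definition DC :: "real \<Rightarrow> real \<Rightarrow> real set" where
  "DC \<gamma> \<tau> = {\<theta> \<in> {0..2 * pi}. \<forall>n. n \<noteq> 0 \<longrightarrow> \<bar>slope \<theta> n\<bar> \<ge> \<gamma> / l1norm n powr \<tau>}"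

text \<open>The usual topological description of a Cantor set in the line: nonempty, compact,
  nowhere dense (for a closed set: empty interior) and without isolated points.\<close>

definition cantor_like :: "real set \<Rightarrow> bool" where
  "cantor_like S \<longleftrightarrow> S \<noteq> {} \<and> compact S \<and> interior S = {} \<and> (\<forall>x\<in>S. x islimpt S)"


section \<open>The Hilbert space of square-summable functions on the lattice\<close>

definition ell2 :: "(site \<Rightarrow> complex) set" where
  "ell2 = {u. (\<lambda>n. (cmod (u n))\<^sup>2) summable_on UNIV}"

text \<open>The next two are meaningful only on \<^const>\<open>ell2\<close>, where the sums converge.\<close>

definition ell2_inner :: "(site \<Rightarrow> complex) \<Rightarrow> (site \<Rightarrow> complex) \<Rightarrow> complex" where
  "ell2_inner u w = (\<Sum>\<^sub>\<infinity>n. u n * cnj (w n))"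

definition ell2_norm :: "(site \<Rightarrow> complex) \<Rightarrow> real" where
  "ell2_norm u = sqrt (\<Sum>\<^sub>\<infinity>n. (cmod (u n))\<^sup>2)"

text \<open>An orthonormal family indexed by \<open>I\<close> whose linear span is dense.\<close>

definition orthonormal_basis :: "'i set \<Rightarrow> ('i \<Rightarrow> site \<Rightarrow> complex) \<Rightarrow> bool" where
  "orthonormal_basis I \<psi> \<longleftrightarrow>
     (\<forall>i\<in>I. \<psi> i \<in> ell2) \<and>
     (\<forall>i\<in>I. \<forall>j\<in>I. ell2_inner (\<psi> i) (\<psi> j) = (if i = j then 1 else 0)) \<and>
     (\<forall>u\<in>ell2. \<forall>e>0. \<exists>F c. finite F \<and> F \<subseteq> I \<and>
        ell2_norm (\<lambda>m. u m - (\<Sum>i\<in>F. c i * \<psi> i m)) < e)"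


section \<open>The operator\<close>

definition hamiltonian ::
  "(site \<Rightarrow> real) \<Rightarrow> real \<Rightarrow> real \<Rightarrow> (site \<Rightarrow> complex) \<Rightarrow> site \<Rightarrow> complex" where
  "hamiltonian v \<theta> \<epsilon> u n =
     (\<Sum>m\<in>{m. l1norm (m - n) = 1}. u m) + of_real (slope \<theta> n) * u n + of_real (\<epsilon> * v n) * u n"

lemma neighbours_eq:
  "{m. l1norm (m - n) = 1} = {n + (1, 0), n - (1, 0), n + (0, 1), n - (0, 1)}"
proof -
  have "l1norm k = 1 \<longleftrightarrow> k \<in> {(1, 0), (-1, 0), (0, 1), (0, -1)}" for k
  proof -
    have "l1norm k = of_int (\<bar>fst k\<bar> + \<bar>snd k\<bar>)"
      by (simp add: l1norm_def)
    then have "l1norm k = 1 \<longleftrightarrow> \<bar>fst k\<bar> + \<bar>snd k\<bar> = 1"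
      by (simp only: of_int_eq_1_iff)
    also have "\<dots> \<longleftrightarrow> k \<in> {(1, 0), (-1, 0), (0, 1), (0, -1)}"
      by (cases k) (simp, arith)
    finally show ?thesis .
  qed
  then have "{m. l1norm (m - n) = 1} = {m. m - n \<in> {(1, 0), (-1, 0), (0, 1), (0, -1)}}"
    by simp
  also have "\<dots> = {n + (1, 0), n - (1, 0), n + (0, 1), n - (0, 1)}"
    by (cases n) (auto simp: algebra_simps)
  finally show ?thesis .
qed

text \<open>As \<open>v\<close> is bounded and each site has four neighbours, \<open>hamiltonian v \<theta> \<epsilon>\<close>
  maps this domain into \<^const>\<open>ell2\<close>.\<close>

definition hamiltonian_domain :: "real \<Rightarrow> (site \<Rightarrow> complex) set" where
  "hamiltonian_domain \<theta> = {u \<in> ell2. (\<lambda>n. of_real (slope \<theta> n) * u n) \<in> ell2}"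

definition eigenspace ::
  "(site \<Rightarrow> real) \<Rightarrow> real \<Rightarrow> real \<Rightarrow> complex \<Rightarrow> (site \<Rightarrow> complex) set" where
  "eigenspace v \<theta> \<epsilon> E =
     {u \<in> hamiltonian_domain \<theta>. \<forall>n. hamiltonian v \<theta> \<epsilon> u n = E * u n}"

definition eigenvector ::
  "(site \<Rightarrow> real) \<Rightarrow> real \<Rightarrow> real \<Rightarrow> (site \<Rightarrow> complex) \<Rightarrow> bool" where
  "eigenvector v \<theta> \<epsilon> u \<longleftrightarrow> u \<noteq> (\<lambda>n. 0) \<and> (\<exists>E. u \<in> eigenspace v \<theta> \<epsilon> E)"

definition eigenvalue :: "(site \<Rightarrow> real) \<Rightarrow> real \<Rightarrow> real \<Rightarrow> complex \<Rightarrow> bool" where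
  "eigenvalue v \<theta> \<epsilon> E \<longleftrightarrow> (\<exists>u \<in> eigenspace v \<theta> \<epsilon> E. u \<noteq> (\<lambda>n. 0))"

text \<open>The eigenspace is one-dimensional. The operator is self-adjoint, so algebraic and geometric
  multiplicity coincide.\<close>

definition simple_eigenvalue :: "(site \<Rightarrow> real) \<Rightarrow> real \<Rightarrow> real \<Rightarrow> complex \<Rightarrow> bool" where
  "simple_eigenvalue v \<theta> \<epsilon> E \<longleftrightarrow>
     (\<exists>u \<in> eigenspace v \<theta> \<epsilon> E. u \<noteq> (\<lambda>n. 0) \<and>
        (\<forall>w \<in> eigenspace v \<theta> \<epsilon> E. \<exists>c. w = (\<lambda>n. c * u n)))"

definition pure_point_spectrum :: "(site \<Rightarrow> real) \<Rightarrow> real \<Rightarrow> real \<Rightarrow> bool" where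
  "pure_point_spectrum v \<theta> \<epsilon> \<longleftrightarrow>
     (\<exists>B. orthonormal_basis B (\<lambda>u. u) \<and> (\<forall>u\<in>B. eigenvector v \<theta> \<epsilon> u))"

end

theory Submission
  imports Defs "HOL-Real_Asymp.Real_Asymp"
begin

text \<open>Write \<open>H = \<Delta> + D + \<epsilon> v\<close>, where \<open>D\<close> multiplies by the slope \<open>n \<cdot> \<omega>\<close>, \<open>\<omega> = (cos \<theta>, sin \<theta>)\<close>.

The part \<open>\<Delta> + D\<close> is diagonalised explicitly. A shift \<open>S\<close> by a unit vector \<open>e\<close> satisfies
\<open>[D, S] = (e \<cdot> \<omega>) S\<close>, so conjugation by \<open>exp (- S / (e \<cdot> \<omega>))\<close> turns \<open>D + S\<close> into \<open>D\<close>; the product \<open>U\<close> of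
these exponentials over the four unit vectors gives \<open>(\<Delta> + D) U = U D\<close> (its entries are products of
Bessel functions). Both \<open>U\<close> and its inverse decay off the diagonal faster than any exponential,
which is why every rate \<open>a\<close> is allowed. What remains is to diagonalise \<open>D + P\<close> with
\<open>P = \<epsilon> U\<^sup>-\<^sup>1 v U\<close>, whose row \<open>m\<close> has size \<open>\<epsilon> / (ln \<langle>m\<rangle>) powr \<sigma>\<close>.

This is done by a quadratically convergent (KAM) iteration. If \<open>P\<close> has size \<open>exp (- \<Lambda>)\<close>, one
solves \<open>[D, X] = - P\<close> off the diagonal for pairs at distance at most \<open>N = \<Lambda> powr (1 + \<eta>)\<close> and conjugates
by \<open>1 + X\<close>; the diagonal of \<open>P\<close> is added to \<open>D\<close> and the new perturbation has size \<open>exp (- 3/2 \<Lambda>)\<close>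
(\<open>homological_step\<close>, \<open>kam_step\<close>). The transformations are only invertible, not unitary. That
suffices: the columns of the limit are eigenvectors with pairwise distinct eigenvalues, so they are
orthogonal because the operator is symmetric, and they span because the limit has a right inverse
with decaying entries (\<open>localized_eigenbasis\<close>).

The divisors \<open>d\<^sub>m - d\<^sub>n\<close>, \<open>\<bar>m - n\<bar> \<le> N\<close>, have to be at least \<open>exp (- \<Lambda>/8)\<close>. Here
\<open>d\<^sub>m = m \<cdot> \<omega> + O(1 / (ln \<langle>m\<rangle>) powr \<sigma>)\<close>. If \<open>(ln \<langle>m\<rangle>) powr \<sigma>\<close> and \<open>(ln \<langle>n\<rangle>) powr \<sigma>\<close> exceed a multiple of
\<open>N powr \<tau>\<close>, the Diophantine condition alone suffices. Otherwise one of the sites lies in a ball of radius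
\<open>exp (C N powr (\<tau>/\<sigma>))\<close>, and since \<open>(1 + \<eta>) \<tau> < \<sigma>\<close> the number of such pairs is only \<open>exp (o(\<Lambda>))\<close>. For each
of them one discards the angles at which the divisor is too small. A small value of \<open>(m - n) \<cdot> \<omega>\<close>
is transversal in \<open>\<theta>\<close>, and the corrections to it have a small Lipschitz constant, so each pair costs
measure \<open>O(exp (- \<Lambda>/8))\<close>, and one step costs at most \<open>exp (- \<Lambda>/9)\<close> (\<open>sublevel_cover\<close>,
\<open>kam_separation\<close>). With \<open>exp (- \<Lambda>) \<approx> \<epsilon>\<close> at the start the total is \<open>O(\<epsilon> powr (1/9))\<close>.

The discarded angles are covered by an open set \<open>B\<close>, so that \<open>DC - B\<close> is compact. Its points of
positive local measure form the required Cantor set (\<open>perfect_core\<close>, \<open>cantor_part_of_DC\<close>).\<close>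

section \<open>Matrices with exponentially decaying rows\<close>

type_synonym mat = "site \<Rightarrow> site \<Rightarrow> complex"

lemma l1norm_triangle: "l1norm (m - n) \<le> l1norm (m - k) + l1norm (k - n)"
  by (simp add: l1norm_def)

lemma l1norm_nonneg [simp]: "0 \<le> l1norm n"
  by (simp add: l1norm_def)

lemma l1norm_zero [simp]: "l1norm 0 = 0"
  by (simp add: l1norm_def)

lemma l1norm_minus [simp]: "l1norm (- n) = l1norm n"
  by (simp add: l1norm_def)

lemma l1norm_commute: "l1norm (m - n) = l1norm (n - m)"
  by (simp add: l1norm_def)

lemma l1norm_ge_1:
  assumes "n \<noteq> 0"
  shows "1 \<le> l1norm n"
proof -
  have "l1norm n = of_int (\<bar>fst n\<bar> + \<bar>snd n\<bar>)"
    by (simp add: l1norm_def)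
  moreover have "1 \<le> \<bar>fst n\<bar> + \<bar>snd n\<bar>"
    using assms by (cases n) (auto simp: zero_prod_def)
  ultimately show ?thesis
    by linarith
qed

text \<open>The bound is on row sums only, weighted by \<open>w\<close> at the row index. This makes the estimate
submultiplicative with the weight needed on the left factor alone, so that the logarithmic decay of
the potential is inherited by every product that starts with it. Bounding finite partial sums
includes summability in the statement and makes the bound stable under pointwise limits.\<close>

definition row_bounded :: "(site \<Rightarrow> real) \<Rightarrow> real \<Rightarrow> mat \<Rightarrow> real \<Rightarrow> bool" where
  "row_bounded w r A M \<longleftrightarrow>
     (\<forall>m F. finite F \<longrightarrow> w m * (\<Sum>n\<in>F. cmod (A m n) * exp (r * l1norm (m - n))) \<le> M)"

abbreviation unit_weight :: "site \<Rightarrow> real" where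
  "unit_weight \<equiv> \<lambda>_. 1"

lemma row_boundedD:
  "row_bounded w r A M \<Longrightarrow> finite F \<Longrightarrow>
     w m * (\<Sum>n\<in>F. cmod (A m n) * exp (r * l1norm (m - n))) \<le> M"
  unfolding row_bounded_def by blast

lemma row_bounded_nonneg: "row_bounded w r A M \<Longrightarrow> 0 \<le> M"
  using row_boundedD[of w r A M "{}"] by simp

lemma row_bounded_entry:
  "row_bounded w r A M \<Longrightarrow> w m * (cmod (A m n) * exp (r * l1norm (m - n))) \<le> M"
  using row_boundedD[of w r A M "{n}" m] by simp

lemma row_bounded_entry_exp:
  assumes "row_bounded unit_weight r A M"
  shows "cmod (A m n) \<le> M * exp (- r * l1norm (m - n))"
  using row_bounded_entry[OF assms, of m n]
  by (simp add: exp_minus field_simps)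

lemma row_bounded_entry_weight:
  assumes "row_bounded w r A M" "0 \<le> r" "0 \<le> w m"
  shows "w m * cmod (A m n) \<le> M"
proof -
  have "w m * (cmod (A m n) * 1) \<le> w m * (cmod (A m n) * exp (r * l1norm (m - n)))"
    using assms by (intro mult_left_mono) auto
  then show ?thesis
    using row_bounded_entry[OF assms(1), of m n] by simp
qed

lemma row_bounded_entry_le:
  "row_bounded unit_weight r A M \<Longrightarrow> 0 \<le> r \<Longrightarrow> cmod (A m n) \<le> M"
  using row_bounded_entry_weight[of unit_weight r A M m n] by simp

lemma row_bounded_comparison:
  assumes "row_bounded w r A M"
    and "\<And>m n. w' m * (cmod (B m n) * exp (r' * l1norm (m - n)))
               \<le> c * (w m * (cmod (A m n) * exp (r * l1norm (m - n))))"
    and "0 \<le> c"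
  shows "row_bounded w' r' B (c * M)"
  unfolding row_bounded_def
proof (intro allI impI)
  fix m and F :: "site set" assume F: "finite F"
  have "w' m * (\<Sum>n\<in>F. cmod (B m n) * exp (r' * l1norm (m - n)))
      \<le> c * (w m * (\<Sum>n\<in>F. cmod (A m n) * exp (r * l1norm (m - n))))"
    unfolding sum_distrib_left by (intro sum_mono assms(2))
  also have "\<dots> \<le> c * M"
    by (intro mult_left_mono row_boundedD[OF assms(1) F] assms(3))
  finally show "w' m * (\<Sum>n\<in>F. cmod (B m n) * exp (r' * l1norm (m - n))) \<le> c * M" .
qed

lemma row_bounded_mono:
  assumes "row_bounded w r A M" "M \<le> M'"
  shows "row_bounded w r A M'"
  using assms unfolding row_bounded_def by (meson order_trans)

lemma row_bounded_smaller:
  assumes "row_bounded w r A M" and "\<And>m n. cmod (B m n) \<le> c * cmod (A m n)"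
    and "0 \<le> c" "\<And>m. 0 \<le> w m"
  shows "row_bounded w r B (c * M)"
proof (rule row_bounded_comparison[OF assms(1) _ assms(3)])
  fix m n
  have "w m * (cmod (B m n) * exp (r * l1norm (m - n)))
      \<le> w m * (c * cmod (A m n) * exp (r * l1norm (m - n)))"
    using assms by (intro mult_left_mono mult_right_mono) auto
  then show "w m * (cmod (B m n) * exp (r * l1norm (m - n)))
      \<le> c * (w m * (cmod (A m n) * exp (r * l1norm (m - n))))"
    by (simp add: algebra_simps)
qed

lemma row_bounded_weaken:
  assumes "row_bounded w r A M" "r' \<le> r" "\<And>m. w' m \<le> w m" "\<And>m. 0 \<le> w m"
  shows "row_bounded w' r' A M"
proof -
  have "row_bounded w' r' A (1 * M)"
  proof (rule row_bounded_comparison[OF assms(1)])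
    fix m n
    show "w' m * (cmod (A m n) * exp (r' * l1norm (m - n)))
        \<le> 1 * (w m * (cmod (A m n) * exp (r * l1norm (m - n))))"
      using assms by (simp, intro mult_mono) (auto intro!: mult_left_mono mult_right_mono)
  qed simp
  then show ?thesis by simp
qed

lemma row_bounded_add:
  assumes "row_bounded w r A M" "row_bounded w r B M'" "\<And>m. 0 \<le> w m"
  shows "row_bounded w r (\<lambda>m n. A m n + B m n) (M + M')"
  unfolding row_bounded_def
proof (intro allI impI)
  fix m and F :: "site set" assume F: "finite F"
  have "w m * (\<Sum>n\<in>F. cmod (A m n + B m n) * exp (r * l1norm (m - n)))
      \<le> w m * (\<Sum>n\<in>F. cmod (A m n) * exp (r * l1norm (m - n)) + cmod (B m n) * exp (r * l1norm (m - n)))"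
    using assms(3)
    by (intro mult_left_mono sum_mono)
       (simp_all flip: distrib_right add: norm_triangle_ineq mult_right_mono)
  also have "\<dots> \<le> M + M'"
    using row_boundedD[OF assms(1) F, of m] row_boundedD[OF assms(2) F, of m]
    by (simp add: sum.distrib distrib_left)
  finally show "w m * (\<Sum>n\<in>F. cmod (A m n + B m n) * exp (r * l1norm (m - n))) \<le> M + M'" .
qed

lemma row_bounded_cong:
  "row_bounded w r A M \<Longrightarrow> (\<And>m n. cmod (B m n) = cmod (A m n)) \<Longrightarrow> row_bounded w r B M"
  unfolding row_bounded_def by simp

lemma row_bounded_limit:
  assumes "\<And>s. row_bounded w r (A s) M" "\<And>m n. (\<lambda>s. A s m n) \<longlonglongrightarrow> B m n"
  shows "row_bounded w r B M"
  unfolding row_bounded_def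
proof (intro allI impI)
  fix m and F :: "site set" assume F: "finite F"
  have "(\<lambda>s. w m * (\<Sum>n\<in>F. cmod (A s m n) * exp (r * l1norm (m - n))))
      \<longlonglongrightarrow> w m * (\<Sum>n\<in>F. cmod (B m n) * exp (r * l1norm (m - n)))"
    by (intro tendsto_intros assms(2))
  then show "w m * (\<Sum>n\<in>F. cmod (B m n) * exp (r * l1norm (m - n))) \<le> M"
    by (rule LIMSEQ_le_const2) (use row_boundedD[OF assms(1) F] in blast)
qed

lemma row_summable:
  assumes "row_bounded unit_weight r A M"
  shows "(\<lambda>n. cmod (A m n) * exp (r * l1norm (m - n))) summable_on UNIV"
    and "(\<Sum>\<^sub>\<infinity>n. cmod (A m n) * exp (r * l1norm (m - n))) \<le> M"
proof -
  show s: "(\<lambda>n. cmod (A m n) * exp (r * l1norm (m - n))) summable_on UNIV"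
    using row_boundedD[OF assms, of _ m]
    by (intro nonneg_bdd_above_summable_on bdd_aboveI[of _ M]) auto
  show "(\<Sum>\<^sub>\<infinity>n. cmod (A m n) * exp (r * l1norm (m - n))) \<le> M"
    using row_boundedD[OF assms, of _ m] by (intro infsum_le_finite_sums[OF s]) auto
qed

lemma row_abs_summable:
  assumes "row_bounded unit_weight r A M" "0 \<le> r"
  shows "(\<lambda>n. cmod (A m n)) summable_on UNIV"
proof (rule summable_on_comparison_test[OF row_summable(1)[OF assms(1), of m]])
  fix n
  have "cmod (A m n) * 1 \<le> cmod (A m n) * exp (r * l1norm (m - n))"
    using assms by (intro mult_left_mono) auto
  then show "cmod (A m n) \<le> cmod (A m n) * exp (r * l1norm (m - n))" by simp
qed auto

definition mat_mult :: "mat \<Rightarrow> mat \<Rightarrow> mat" (infixl "\<odot>" 70) where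
  "(A \<odot> B) m n = (\<Sum>\<^sub>\<infinity>k. A m k * B k n)"

definition mat_id :: mat where
  "mat_id m n = (if m = n then 1 else 0)"

lemma mat_mult_id_right [simp]: "A \<odot> mat_id = A"
proof (intro ext)
  fix m n
  have "(\<Sum>\<^sub>\<infinity>k. A m k * mat_id k n) = (\<Sum>\<^sub>\<infinity>k\<in>{n}. A m k * mat_id k n)"
    by (rule infsum_cong_neutral) (auto simp: mat_id_def)
  then show "(A \<odot> mat_id) m n = A m n"
    by (simp add: mat_mult_def mat_id_def)
qed

lemma mat_mult_id_left [simp]: "mat_id \<odot> A = A"
proof (intro ext)
  fix m n
  have "(\<Sum>\<^sub>\<infinity>k. mat_id m k * A k n) = (\<Sum>\<^sub>\<infinity>k\<in>{m}. mat_id m k * A k n)"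
    by (rule infsum_cong_neutral) (auto simp: mat_id_def)
  then show "(mat_id \<odot> A) m n = A m n"
    by (simp add: mat_mult_def mat_id_def)
qed

lemma row_bounded_id: "row_bounded unit_weight r mat_id 1"
  unfolding row_bounded_def
proof (intro allI impI)
  fix m and F :: "site set" assume F: "finite F"
  have "(\<Sum>n\<in>F. cmod (mat_id m n) * exp (r * l1norm (m - n)))
      = (\<Sum>n\<in>F. if m = n then 1 else 0)"
    by (intro sum.cong) (auto simp: mat_id_def)
  also have "\<dots> \<le> 1"
    using F by (simp add: sum.delta)
  finally show "1 * (\<Sum>n\<in>F. cmod (mat_id m n) * exp (r * l1norm (m - n))) \<le> 1" by simp
qed

lemma row_times_bounded_summable:
  fixes f g :: "site \<Rightarrow> complex"
  assumes "(\<lambda>k. cmod (f k)) summable_on UNIV" "\<And>k. cmod (g k) \<le> M"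
  shows "(\<lambda>k. cmod (f k * g k)) summable_on UNIV"
proof (rule summable_on_comparison_test[OF summable_on_cmult_left[OF assms(1), of M]])
  show "cmod (f k * g k) \<le> cmod (f k) * M" for k
    using assms(2)[of k] by (simp add: norm_mult mult_left_mono)
qed auto

lemma mat_mult_abs_summable:
  assumes "row_bounded unit_weight r A M" "row_bounded unit_weight r' B M'" "0 \<le> r" "0 \<le> r'"
  shows "(\<lambda>k. cmod (A m k * B k n)) summable_on UNIV"
  by (rule row_times_bounded_summable[OF row_abs_summable[OF assms(1,3)]
        row_bounded_entry_le[OF assms(2,4)]])

lemmas mat_mult_summable = abs_summable_summable[OF mat_mult_abs_summable]

lemma row_bounded_unit:
  assumes "row_bounded w r A M" "\<And>m. 1 \<le> w m"
  shows "row_bounded unit_weight r A M"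
  by (rule row_bounded_weaken[OF assms(1)]) (auto intro: assms(2) order_trans[OF zero_le_one])

lemma infsum_finite_sum:
  fixes f :: "'a \<Rightarrow> 'b \<Rightarrow> 'c :: {topological_comm_monoid_add, t2_space}"
  assumes "finite F" "\<And>n. n \<in> F \<Longrightarrow> f n summable_on A"
  shows "(\<lambda>k. \<Sum>n\<in>F. f n k) summable_on A"
    and "(\<Sum>\<^sub>\<infinity>k\<in>A. \<Sum>n\<in>F. f n k) = (\<Sum>n\<in>F. infsum (f n) A)"
  using assms by (induction F rule: finite_induct) (auto simp: infsum_add summable_on_add)

text \<open>The exponential weight is submultiplicative along a path from \<open>m\<close> over \<open>k\<close> to \<open>n\<close> by the triangle
inequality; summing over \<open>n\<close> first and then over \<open>k\<close> gives the product of the two bounds.\<close>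

lemma row_bounded_mult:
  assumes A: "row_bounded w r A M" and B: "row_bounded unit_weight r B M'"
    and r: "0 \<le> r" and w: "\<And>m. 1 \<le> w m"
  shows "row_bounded w r (A \<odot> B) (M * M')"
  unfolding row_bounded_def
proof (intro allI impI)
  fix m and F :: "site set" assume F: "finite F"
  let ?e = "\<lambda>m n. exp (r * l1norm (m - n))"
  have A1: "row_bounded unit_weight r A M"
    by (rule row_bounded_unit[OF A w])
  have w0: "0 \<le> w m"
    using w[of m] by linarith
  note M' = row_bounded_nonneg[OF B]
  note sA = row_summable(1)[OF A1, of m]
  have sAB: "(\<lambda>k. cmod (A m k) * cmod (B k n)) summable_on UNIV" for n
    using mat_mult_abs_summable[OF A1 B r r, of m n] by (simp add: norm_mult)
  have "(\<Sum>n\<in>F. cmod ((A \<odot> B) m n) * ?e m n)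
      \<le> (\<Sum>n\<in>F. (\<Sum>\<^sub>\<infinity>k. cmod (A m k) * cmod (B k n)) * ?e m n)"
    unfolding mat_mult_def
    using norm_infsum_bound[OF mat_mult_abs_summable[OF A1 B r r, of m]]
    by (intro sum_mono mult_right_mono) (auto simp: norm_mult)
  also have "\<dots> = (\<Sum>n\<in>F. (\<Sum>\<^sub>\<infinity>k. cmod (A m k) * cmod (B k n) * ?e m n))"
    by (simp add: infsum_cmult_left')
  also have "\<dots> = (\<Sum>\<^sub>\<infinity>k. (\<Sum>n\<in>F. cmod (A m k) * cmod (B k n) * ?e m n))"
    by (rule infsum_finite_sum(2)[OF F, symmetric]) (intro summable_on_cmult_left sAB)
  also have "\<dots> \<le> (\<Sum>\<^sub>\<infinity>k. cmod (A m k) * ?e m k * M')"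
  proof (rule infsum_mono)
    show "(\<lambda>k. \<Sum>n\<in>F. cmod (A m k) * cmod (B k n) * ?e m n) summable_on UNIV"
      by (intro infsum_finite_sum(1)[OF F] summable_on_cmult_left sAB)
    show "(\<lambda>k. cmod (A m k) * ?e m k * M') summable_on UNIV"
      by (intro summable_on_cmult_left sA)
    fix k
    have e: "?e m n \<le> ?e m k * ?e k n" for n
      using mult_left_mono[OF l1norm_triangle[of m n k] r]
      by (simp add: algebra_simps flip: exp_add)
    have "(\<Sum>n\<in>F. cmod (A m k) * cmod (B k n) * ?e m n)
        \<le> (\<Sum>n\<in>F. cmod (A m k) * cmod (B k n) * (?e m k * ?e k n))"
      by (intro sum_mono mult_left_mono e) auto
    also have "\<dots> = cmod (A m k) * ?e m k * (\<Sum>n\<in>F. cmod (B k n) * ?e k n)"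
      by (simp add: sum_distrib_left mult_ac)
    also have "\<dots> \<le> cmod (A m k) * ?e m k * M'"
      using row_boundedD[OF B F, of k] by (intro mult_left_mono) auto
    finally show "(\<Sum>n\<in>F. cmod (A m k) * cmod (B k n) * ?e m n) \<le> cmod (A m k) * ?e m k * M'" .
  qed
  also have "\<dots> = (\<Sum>\<^sub>\<infinity>k. cmod (A m k) * ?e m k) * M'"
    by (simp add: infsum_cmult_left')
  finally have 1: "(\<Sum>n\<in>F. cmod ((A \<odot> B) m n) * ?e m n) \<le> (\<Sum>\<^sub>\<infinity>k. cmod (A m k) * ?e m k) * M'" .
  have 2: "w m * (\<Sum>\<^sub>\<infinity>k. cmod (A m k) * ?e m k) \<le> M"
  proof -
    have "(\<Sum>\<^sub>\<infinity>k. w m * (cmod (A m k) * ?e m k)) \<le> M"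
      using row_boundedD[OF A, of _ m]
      by (intro infsum_le_finite_sums summable_on_cmult_right sA) (auto simp: sum_distrib_left)
    then show ?thesis by (simp add: infsum_cmult_right')
  qed
  have "w m * (\<Sum>n\<in>F. cmod ((A \<odot> B) m n) * ?e m n) \<le> w m * ((\<Sum>\<^sub>\<infinity>k. cmod (A m k) * ?e m k) * M')"
    by (rule mult_left_mono[OF 1 w0])
  also have "\<dots> \<le> M * M'"
    using mult_right_mono[OF 2 M'] by (simp add: mult_ac)
  finally show "w m * (\<Sum>n\<in>F. cmod ((A \<odot> B) m n) * ?e m n) \<le> M * M'" .
qed

text \<open>Absolute summability of the double series, which permits the exchange of sums: the inner row sums
are bounded uniformly, and the outer row is summable.\<close>

lemma mat_mult_assoc:
  assumes A: "row_bounded unit_weight r A a" and B: "row_bounded unit_weight r B b"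
    and C: "row_bounded unit_weight r C c" and r: "0 \<le> r"
  shows "(A \<odot> B) \<odot> C = A \<odot> (B \<odot> C)"
proof (intro ext)
  fix m n
  let ?f = "\<lambda>k l. A m k * B k l * C l n"
  have BC: "(\<lambda>l. cmod (B k l * C l n)) summable_on UNIV" for k
    by (rule mat_mult_abs_summable[OF B C r r])
  have "(\<lambda>p. cmod (case p of (k, l) \<Rightarrow> ?f k l)) summable_on UNIV \<times> UNIV"
    unfolding Infinite_Sum.abs_summable_on_Sigma_iff
  proof (intro conjI ballI)
    fix k
    show "(\<lambda>l. cmod (case (k, l) of (k, l) \<Rightarrow> ?f k l)) summable_on UNIV"
      using summable_on_cmult_right[OF BC[of k], of "cmod (A m k)"]
      by (simp add: norm_mult mult.assoc)
    have eq: "(\<Sum>\<^sub>\<infinity>l. cmod (case (k, l) of (k, l) \<Rightarrow> ?f k l))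
        = cmod (A m k) * (\<Sum>\<^sub>\<infinity>l. cmod (B k l * C l n))" for k
      by (simp add: norm_mult mult.assoc infsum_cmult_right')
    have "(\<Sum>\<^sub>\<infinity>l. cmod (B k l * C l n)) \<le> b * c" for k
    proof (rule infsum_le_finite_sums[OF BC])
      fix F :: "site set" assume F: "finite F"
      have "(\<Sum>l\<in>F. cmod (B k l * C l n)) \<le> (\<Sum>l\<in>F. (cmod (B k l) * exp (r * l1norm (k - l))) * c)"
      proof (intro sum_mono)
        fix l
        have "cmod (B k l) * 1 \<le> cmod (B k l) * exp (r * l1norm (k - l))"
          using r by (intro mult_left_mono) auto
        then show "cmod (B k l * C l n) \<le> (cmod (B k l) * exp (r * l1norm (k - l))) * c"
          unfolding norm_mult using row_bounded_entry_le[OF C r, of l n]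
          by (intro mult_mono) auto
      qed
      also have "\<dots> \<le> b * c"
        using row_boundedD[OF B F, of k] row_bounded_nonneg[OF C]
        by (simp add: mult_right_mono flip: sum_distrib_right)
      finally show "(\<Sum>l\<in>F. cmod (B k l * C l n)) \<le> b * c" .
    qed
    moreover have "(\<lambda>k. cmod (A m k) * (b * c)) summable_on UNIV"
      by (intro summable_on_cmult_left row_abs_summable[OF A r])
    ultimately have "(\<lambda>k. cmod (A m k) * (\<Sum>\<^sub>\<infinity>l. cmod (B k l * C l n))) summable_on UNIV"
      by (elim summable_on_comparison_test)
         (auto intro!: mult_nonneg_nonneg infsum_nonneg mult_left_mono)
    then show "(\<lambda>k. norm (\<Sum>\<^sub>\<infinity>l. cmod (case (k, l) of (k, l) \<Rightarrow> ?f k l))) summable_on UNIV"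
      unfolding eq by (simp add: abs_mult infsum_nonneg)
  qed
  then have S: "(\<lambda>(k, l). ?f k l) summable_on UNIV \<times> UNIV"
    by (rule abs_summable_summable)
  have "((A \<odot> B) \<odot> C) m n = (\<Sum>\<^sub>\<infinity>l. \<Sum>\<^sub>\<infinity>k. ?f k l)"
    by (simp add: mat_mult_def infsum_cmult_left')
  also have "\<dots> = (\<Sum>\<^sub>\<infinity>k. \<Sum>\<^sub>\<infinity>l. ?f k l)"
    by (rule infsum_swap_banach[OF S, symmetric])
  also have "\<dots> = (A \<odot> (B \<odot> C)) m n"
    by (simp add: mat_mult_def infsum_cmult_right' mult.assoc)
  finally show "((A \<odot> B) \<odot> C) m n = (A \<odot> (B \<odot> C)) m n" .
qed

lemma mat_mult_add_left:
  assumes "row_bounded unit_weight r A a" "row_bounded unit_weight r B b"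
    "row_bounded unit_weight r C c" "0 \<le> r"
  shows "((\<lambda>m n. A m n + B m n) \<odot> C) m n = (A \<odot> C) m n + (B \<odot> C) m n"
  unfolding mat_mult_def distrib_right
  by (rule infsum_add) (rule mat_mult_summable[OF assms(1,3,4,4)] mat_mult_summable[OF assms(2,3,4,4)])+

lemma mat_mult_add_right:
  assumes "row_bounded unit_weight r A a" "row_bounded unit_weight r B b"
    "row_bounded unit_weight r C c" "0 \<le> r"
  shows "(A \<odot> (\<lambda>m n. B m n + C m n)) m n = (A \<odot> B) m n + (A \<odot> C) m n"
  unfolding mat_mult_def distrib_left
  by (rule infsum_add) (rule mat_mult_summable[OF assms(1,2,4,4)] mat_mult_summable[OF assms(1,3,4,4)])+

lemma mat_mult_uminus_right: "(A \<odot> (\<lambda>m n. - B m n)) m n = - (A \<odot> B) m n"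
  by (simp add: mat_mult_def infsum_uminus)

lemma mat_mult_uminus_left: "((\<lambda>m n. - A m n) \<odot> B) m n = - (A \<odot> B) m n"
  by (simp add: mat_mult_def infsum_uminus)

lemma mat_mult_diff_left:
  assumes "row_bounded unit_weight r A a" "row_bounded unit_weight r B b"
    "row_bounded unit_weight r C c" "0 \<le> r"
  shows "((\<lambda>m n. A m n - B m n) \<odot> C) m n = (A \<odot> C) m n - (B \<odot> C) m n"
  using mat_mult_add_left[OF assms(1) row_bounded_cong[OF assms(2), of "\<lambda>m n. - B m n"] assms(3,4)]
  by (simp add: mat_mult_uminus_left)

lemma mat_mult_diff_right:
  assumes "row_bounded unit_weight r A a" "row_bounded unit_weight r B b"
    "row_bounded unit_weight r C c" "0 \<le> r"
  shows "(A \<odot> (\<lambda>m n. B m n - C m n)) m n = (A \<odot> B) m n - (A \<odot> C) m n"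
  using mat_mult_add_right[OF assms(1,2) row_bounded_cong[OF assms(3), of "\<lambda>m n. - C m n"] assms(4)]
  by (simp add: mat_mult_uminus_right)

section \<open>Lipschitz families of matrices\<close>

lemma row_bounded_smaller2:
  assumes "row_bounded w r A M" "row_bounded w r A' M'"
    and "\<And>m n. cmod (B m n) \<le> c * cmod (A m n) + c' * cmod (A' m n)"
    and "0 \<le> c" "0 \<le> c'" "\<And>m. 0 \<le> w m"
  shows "row_bounded w r B (c * M + c' * M')"
proof -
  have 1: "row_bounded w r (\<lambda>m n. of_real (c * cmod (A m n))) (c * M)"
    by (rule row_bounded_smaller[OF assms(1)]) (use assms in \<open>auto simp: norm_mult\<close>)
  have 2: "row_bounded w r (\<lambda>m n. of_real (c' * cmod (A' m n))) (c' * M')"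
    by (rule row_bounded_smaller[OF assms(2)]) (use assms in \<open>auto simp: norm_mult\<close>)
  have "row_bounded w r B (1 * (c * M + c' * M'))"
    by (rule row_bounded_smaller[OF row_bounded_add[OF 1 2 assms(6)]])
       (use assms in \<open>auto simp flip: of_real_add of_real_mult\<close>)
  then show ?thesis by simp
qed

text \<open>One constant for the sup norm and the Lipschitz norm in the angle. The parameter set is an arbitrary
set of reals, since the good angles form a set without interior on which no derivative is available.\<close>

definition lip_bounded ::
  "(site \<Rightarrow> real) \<Rightarrow> real \<Rightarrow> real set \<Rightarrow> (real \<Rightarrow> mat) \<Rightarrow> real \<Rightarrow> bool" where
  "lip_bounded w r S A M \<longleftrightarrow>
     (\<forall>\<theta>\<in>S. row_bounded w r (A \<theta>) M) \<and>
     (\<forall>\<theta>\<in>S. \<forall>\<theta>'\<in>S. row_bounded w r (\<lambda>m n. A \<theta> m n - A \<theta>' m n) (M * \<bar>\<theta> - \<theta>'\<bar>))"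

lemma lip_boundedD:
  assumes "lip_bounded w r S A M" "\<theta> \<in> S"
  shows "row_bounded w r (A \<theta>) M"
    and "\<theta>' \<in> S \<Longrightarrow> row_bounded w r (\<lambda>m n. A \<theta> m n - A \<theta>' m n) (M * \<bar>\<theta> - \<theta>'\<bar>)"
  using assms unfolding lip_bounded_def by auto

lemma lip_boundedI:
  assumes "\<And>\<theta>. \<theta> \<in> S \<Longrightarrow> row_bounded w r (A \<theta>) M"
    and "\<And>\<theta> \<theta>'. \<theta> \<in> S \<Longrightarrow> \<theta>' \<in> S \<Longrightarrow> row_bounded w r (\<lambda>m n. A \<theta> m n - A \<theta>' m n) (M * \<bar>\<theta> - \<theta>'\<bar>)"
  shows "lip_bounded w r S A M"
  using assms unfolding lip_bounded_def by auto

lemma lip_bounded_mono: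
  assumes "lip_bounded w r S A M" "M \<le> M'"
  shows "lip_bounded w r S A M'"
proof (rule lip_boundedI)
  fix \<theta> \<theta>' assume th: "\<theta> \<in> S" "\<theta>' \<in> S"
  show "row_bounded w r (A \<theta>) M'"
    by (rule row_bounded_mono[OF lip_boundedD(1)[OF assms(1) th(1)] assms(2)])
  show "row_bounded w r (\<lambda>m n. A \<theta> m n - A \<theta>' m n) (M' * \<bar>\<theta> - \<theta>'\<bar>)"
    by (rule row_bounded_mono[OF lip_boundedD(2)[OF assms(1) th]]) (simp add: mult_right_mono assms(2))
qed

lemma lip_bounded_weaken:
  assumes "lip_bounded w r S A M" "r' \<le> r" "S' \<subseteq> S" "\<And>m. w' m \<le> w m" "\<And>m. 0 \<le> w m"
  shows "lip_bounded w' r' S' A M"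
proof (rule lip_boundedI)
  fix \<theta> \<theta>' assume "\<theta> \<in> S'" "\<theta>' \<in> S'"
  then have th: "\<theta> \<in> S" "\<theta>' \<in> S"
    using assms(3) by auto
  show "row_bounded w' r' (A \<theta>) M"
    by (rule row_bounded_weaken[OF lip_boundedD(1)[OF assms(1) th(1)] assms(2,4,5)])
  show "row_bounded w' r' (\<lambda>m n. A \<theta> m n - A \<theta>' m n) (M * \<bar>\<theta> - \<theta>'\<bar>)"
    by (rule row_bounded_weaken[OF lip_boundedD(2)[OF assms(1) th] assms(2,4,5)])
qed

lemma lip_bounded_add:
  assumes "lip_bounded w r S A M" "lip_bounded w r S B M'" "\<And>m. 0 \<le> w m"
  shows "lip_bounded w r S (\<lambda>\<theta> m n. A \<theta> m n + B \<theta> m n) (M + M')"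
proof (rule lip_boundedI)
  fix \<theta> \<theta>' assume th: "\<theta> \<in> S" "\<theta>' \<in> S"
  show "row_bounded w r (\<lambda>m n. A \<theta> m n + B \<theta> m n) (M + M')"
    by (intro row_bounded_add lip_boundedD[OF assms(1)] lip_boundedD[OF assms(2)] th assms(3))
  show "row_bounded w r (\<lambda>m n. A \<theta> m n + B \<theta> m n - (A \<theta>' m n + B \<theta>' m n)) ((M + M') * \<bar>\<theta> - \<theta>'\<bar>)"
    using row_bounded_add[OF lip_boundedD(2)[OF assms(1) th] lip_boundedD(2)[OF assms(2) th] assms(3)]
    by (simp add: algebra_simps)
qed

lemma lip_bounded_uminus:
  assumes "lip_bounded w r S A M"
  shows "lip_bounded w r S (\<lambda>\<theta> m n. - A \<theta> m n) M"
proof (rule lip_boundedI)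
  fix \<theta> \<theta>' assume th: "\<theta> \<in> S" "\<theta>' \<in> S"
  show "row_bounded w r (\<lambda>m n. - A \<theta> m n) M"
    by (rule row_bounded_cong[OF lip_boundedD(1)[OF assms th(1)]]) simp
  show "row_bounded w r (\<lambda>m n. - A \<theta> m n - - A \<theta>' m n) (M * \<bar>\<theta> - \<theta>'\<bar>)"
    by (rule row_bounded_cong[OF lip_boundedD(2)[OF assms th]]) (simp add: norm_minus_commute)
qed

lemma lip_bounded_diff:
  assumes "lip_bounded w r S A M" "lip_bounded w r S B M'" "\<And>m. 0 \<le> w m"
  shows "lip_bounded w r S (\<lambda>\<theta> m n. A \<theta> m n - B \<theta> m n) (M + M')"
  using lip_bounded_add[OF assms(1) lip_bounded_uminus[OF assms(2)] assms(3)] by simp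

lemma lip_bounded_const:
  assumes "row_bounded w r A M"
  shows "lip_bounded w r {\<theta>} (\<lambda>_. A) M"
  using assms by (auto simp: lip_bounded_def row_bounded_def)

lemma lip_bounded_limit:
  assumes "\<And>s. lip_bounded w r S (A s) M"
    and "\<And>\<theta> m n. \<theta> \<in> S \<Longrightarrow> (\<lambda>s. A s \<theta> m n) \<longlonglongrightarrow> B \<theta> m n"
  shows "lip_bounded w r S B M"
proof (rule lip_boundedI)
  fix \<theta> \<theta>' assume th: "\<theta> \<in> S" "\<theta>' \<in> S"
  show "row_bounded w r (B \<theta>) M"
    by (rule row_bounded_limit[where A="\<lambda>s. A s \<theta>"])
       (intro lip_boundedD(1)[OF assms(1)] th assms(2))+
  show "row_bounded w r (\<lambda>m n. B \<theta> m n - B \<theta>' m n) (M * \<bar>\<theta> - \<theta>'\<bar>)"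
    by (rule row_bounded_limit[where A="\<lambda>s m n. A s \<theta> m n - A s \<theta>' m n"])
       (intro lip_boundedD(2)[OF assms(1)] th tendsto_diff assms(2))+
qed

text \<open>The factor 2 is the cost of the Leibniz rule \<open>AB - A'B' = (A - A') B + A' (B - B')\<close> for the
Lipschitz part.\<close>

lemma lip_bounded_mult:
  assumes A: "lip_bounded w r S A M" and B: "lip_bounded unit_weight r S B M'"
    and r: "0 \<le> r" and w: "\<And>m. 1 \<le> w m"
  shows "lip_bounded w r S (\<lambda>\<theta>. A \<theta> \<odot> B \<theta>) (2 * M * M')"
proof (rule lip_boundedI)
  fix \<theta> \<theta>' assume th: "\<theta> \<in> S" "\<theta>' \<in> S"
  have w0: "0 \<le> w m" for m
    using w[of m] by linarith
  note A1 = lip_boundedD[OF A th(1)] lip_boundedD(1)[OF A th(2)]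
  note B1 = lip_boundedD[OF B th(1)] lip_boundedD(1)[OF B th(2)]
  have "M * M' \<le> 2 * M * M'"
    using row_bounded_nonneg[OF A1(1)] row_bounded_nonneg[OF B1(1)] by simp
  then show "row_bounded w r (A \<theta> \<odot> B \<theta>) (2 * M * M')"
    by (rule row_bounded_mono[OF row_bounded_mult[OF A1(1) B1(1) r w]])
  have "row_bounded w r (\<lambda>m n. ((\<lambda>m n. A \<theta> m n - A \<theta>' m n) \<odot> B \<theta>) m n
      + (A \<theta>' \<odot> (\<lambda>m n. B \<theta> m n - B \<theta>' m n)) m n) (M * \<bar>\<theta> - \<theta>'\<bar> * M' + M * (M' * \<bar>\<theta> - \<theta>'\<bar>))"
    using th by (intro row_bounded_add row_bounded_mult A1 B1 r w w0)
  moreover have "((\<lambda>m n. A \<theta> m n - A \<theta>' m n) \<odot> B \<theta>) m n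
      + (A \<theta>' \<odot> (\<lambda>m n. B \<theta> m n - B \<theta>' m n)) m n = (A \<theta> \<odot> B \<theta>) m n - (A \<theta>' \<odot> B \<theta>') m n" for m n
    using mat_mult_diff_left[OF row_bounded_unit[OF A1(1) w] row_bounded_unit[OF A1(3) w] B1(1) r, of m n]
      mat_mult_diff_right[OF row_bounded_unit[OF A1(3) w] B1(1) B1(3) r, of m n]
    by simp
  moreover have "M * \<bar>\<theta> - \<theta>'\<bar> * M' + M * (M' * \<bar>\<theta> - \<theta>'\<bar>) = 2 * M * M' * \<bar>\<theta> - \<theta>'\<bar>"
    by (simp add: mult_ac)
  ultimately show "row_bounded w r (\<lambda>m n. (A \<theta> \<odot> B \<theta>) m n - (A \<theta>' \<odot> B \<theta>') m n)
      (2 * M * M' * \<bar>\<theta> - \<theta>'\<bar>)"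
    by simp
qed

lemma lip_bounded_unit:
  assumes "lip_bounded w r S A M" "\<And>m. 1 \<le> w m"
  shows "lip_bounded unit_weight r S A M"
  by (rule lip_bounded_weaken[OF assms(1)]) (auto intro: assms(2) order_trans[OF zero_le_one])

text \<open>Convergence of the right factor is assumed uniform along its column, so that the error is
controlled by one row sum of \<open>A\<close>.\<close>

lemma mat_mult_tendsto:
  assumes A: "row_bounded unit_weight r A a" "0 \<le> r"
    and B: "\<And>s k. cmod (B s k n - C k n) \<le> e s" "e \<longlonglongrightarrow> 0"
    and C: "\<And>k. cmod (C k n) \<le> c"
  shows "(\<lambda>s. (A \<odot> B s) m n) \<longlonglongrightarrow> (A \<odot> C) m n"
proof -
  have sA: "(\<lambda>k. cmod (A m k)) summable_on UNIV"
    by (rule row_abs_summable[OF A])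
  have sC: "(\<lambda>k. A m k * C k n) summable_on UNIV"
    by (rule abs_summable_summable[OF row_times_bounded_summable[OF sA C]])
  have sD: "(\<lambda>k. cmod (A m k * (B s k n - C k n))) summable_on UNIV" for s
    by (rule row_times_bounded_summable[OF sA B(1)])
  have "cmod ((A \<odot> B s) m n - (A \<odot> C) m n) \<le> (\<Sum>\<^sub>\<infinity>k. cmod (A m k)) * e s" for s
  proof -
    have "(A \<odot> B s) m n = (\<Sum>\<^sub>\<infinity>k. A m k * (B s k n - C k n) + A m k * C k n)"
      by (simp add: mat_mult_def algebra_simps)
    also have "\<dots> = (\<Sum>\<^sub>\<infinity>k. A m k * (B s k n - C k n)) + (A \<odot> C) m n"
      unfolding mat_mult_def by (rule infsum_add[OF abs_summable_summable[OF sD] sC])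
    finally have "cmod ((A \<odot> B s) m n - (A \<odot> C) m n) \<le> (\<Sum>\<^sub>\<infinity>k. cmod (A m k * (B s k n - C k n)))"
      by (simp add: norm_infsum_bound[OF sD])
    also have "\<dots> \<le> (\<Sum>\<^sub>\<infinity>k. cmod (A m k) * e s)"
      by (rule infsum_mono[OF sD summable_on_cmult_left[OF sA]])
         (simp add: norm_mult mult_left_mono B)
    finally show ?thesis by (simp add: infsum_cmult_left')
  qed
  moreover have "(\<lambda>s. (\<Sum>\<^sub>\<infinity>k. cmod (A m k)) * e s) \<longlonglongrightarrow> 0"
    by (rule tendsto_mult_right_zero[OF B(2)])
  ultimately have "(\<lambda>s. (A \<odot> B s) m n - (A \<odot> C) m n) \<longlonglongrightarrow> 0"
    by (rule Lim_null_comparison[OF always_eventually[OF allI]])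
  then show ?thesis
    by (rule LIM_zero_cancel)
qed

text \<open>The Neumann series for \<open>(1 + X) Y = C\<close>. Solving this equation directly replaces inverses: it
produces both the new perturbation in a Newton step and the right inverse of the limiting
transformation.\<close>

lemma neumann_solution:
  assumes X: "lip_bounded w r S X x" and C: "lip_bounded w r S C c"
    and x: "x \<le> 1/4" and r: "0 \<le> r" and w: "\<And>m. 1 \<le> w m" and c: "0 \<le> c"
  obtains Y where "lip_bounded w r S Y (2 * c)"
    and "\<And>\<theta> m n. \<theta> \<in> S \<Longrightarrow> Y \<theta> m n = C \<theta> m n - (X \<theta> \<odot> Y \<theta>) m n"
proof -
  have w0: "0 \<le> w m" for m
    using w[of m] by linarith
  \<comment> \<open>\<open>T K\<close> is the term \<open>(- X) ^ K C\<close> of the series and \<open>P J\<close> its \<open>J\<close>-th partial sum.\<close>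
  define T where "T = rec_nat C (\<lambda>K t \<theta> m n. - (X \<theta> \<odot> t \<theta>) m n)"
  have T_simps: "T 0 = C" "T (Suc K) = (\<lambda>\<theta> m n. - (X \<theta> \<odot> T K \<theta>) m n)" for K
    by (simp_all add: T_def)
  define P where "P J \<theta> m n = (\<Sum>K<J. T K \<theta> m n)" for J \<theta> m n
  have T: "lip_bounded w r S (T K) (c * (1/2)^K)" for K
  proof (induction K)
    case (Suc K)
    have "lip_bounded w r S (T (Suc K)) (2 * x * (c * (1/2)^K))"
      unfolding T_simps
      by (rule lip_bounded_uminus[OF lip_bounded_mult[OF X lip_bounded_unit[OF Suc w] r w]])
    moreover have "2 * x * (c * (1/2)^K) \<le> (1/2) * (c * (1/2)^K)"
      using x c by (intro mult_right_mono) auto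
    ultimately show ?case
      by (elim lip_bounded_mono) simp
  qed (simp add: T_simps C)
  have P_lip: "lip_bounded w r S (P J) (2 * c - 2 * c * (1/2)^J)" for J
  proof (induction J)
    case 0
    show ?case
      by (auto simp: P_def lip_bounded_def row_bounded_def)
  next
    case (Suc J)
    show ?case
      using lip_bounded_add[OF Suc T[of J] w0] by (simp add: P_def)
  qed
  then have P_lip': "lip_bounded w r S (P J) (2 * c)" for J
    by (rule lip_bounded_mono) (use c in auto)
  define Y where "Y \<theta> m n = (\<Sum>K. T K \<theta> m n)" for \<theta> m n
  have T_entry: "cmod (T K \<theta> m n) \<le> c * (1/2)^K" if "\<theta> \<in> S" for K \<theta> m n
    by (rule row_bounded_entry_le[OF row_bounded_unit[OF lip_boundedD(1)[OF T that] w] r])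
  have geo: "summable (\<lambda>K. c * (1/2)^K :: real)"
    by (intro summable_mult summable_geometric) simp
  have T_summable: "summable (\<lambda>K. T K \<theta> m n)" if "\<theta> \<in> S" for \<theta> m n
    by (rule summable_comparison_test'[OF geo, of 0]) (use T_entry[OF that] in simp)
  have lim: "(\<lambda>J. P J \<theta> m n) \<longlonglongrightarrow> Y \<theta> m n" if "\<theta> \<in> S" for \<theta> m n
    using summable_LIMSEQ[OF T_summable[OF that]] by (simp add: P_def Y_def)
  have Y: "lip_bounded w r S Y (2 * c)"
    by (rule lip_bounded_limit[OF P_lip' lim])
  have tail: "cmod (P J \<theta> m n - Y \<theta> m n) \<le> 2 * c * (1/2)^J" if "\<theta> \<in> S" for J \<theta> m n
  proof -
    have geo': "summable (\<lambda>K. c * (1/2)^J * (1/2)^K :: real)"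
      by (intro summable_mult summable_geometric) simp
    have "P J \<theta> m n - Y \<theta> m n = - (\<Sum>K. T (K + J) \<theta> m n)"
      using suminf_minus_initial_segment[OF T_summable[OF that, of m n], of J] by (simp add: P_def Y_def)
    then have "cmod (P J \<theta> m n - Y \<theta> m n) = cmod (\<Sum>K. T (K + J) \<theta> m n)" by simp
    also have "\<dots> \<le> (\<Sum>K. c * (1/2)^J * (1/2)^K)"
      using T_entry[OF that, of "_ + J"]
      by (intro norm_suminf_le geo') (simp add: power_add mult_ac)
    also have "\<dots> = 2 * c * (1/2)^J"
      by (subst suminf_mult) (auto simp: suminf_geometric)
    finally show ?thesis .
  qed
  have P_Suc: "P (Suc J) \<theta> m n = C \<theta> m n - (X \<theta> \<odot> P J \<theta>) m n" if "\<theta> \<in> S" for J \<theta> m n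
  proof (induction J)
    case 0
    show ?case by (simp add: P_def T_simps mat_mult_def)
  next
    case (Suc J)
    have "P (Suc J) \<theta> = (\<lambda>m n. P J \<theta> m n + T J \<theta> m n)"
      by (simp add: P_def fun_eq_iff)
    then have "(X \<theta> \<odot> P (Suc J) \<theta>) m n = (X \<theta> \<odot> P J \<theta>) m n + (X \<theta> \<odot> T J \<theta>) m n"
      using mat_mult_add_right[OF row_bounded_unit[OF lip_boundedD(1)[OF X that] w]
          row_bounded_unit[OF lip_boundedD(1)[OF P_lip that] w]
          row_bounded_unit[OF lip_boundedD(1)[OF T that] w] r] by simp
    moreover have "P (Suc (Suc J)) \<theta> m n = P (Suc J) \<theta> m n - (X \<theta> \<odot> T J \<theta>) m n"
      by (simp add: P_def T_simps)
    ultimately show ?case using Suc by simp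
  qed
  have "Y \<theta> m n = C \<theta> m n - (X \<theta> \<odot> Y \<theta>) m n" if "\<theta> \<in> S" for \<theta> m n
  proof (rule LIMSEQ_unique)
    show "(\<lambda>J. P (Suc J) \<theta> m n) \<longlonglongrightarrow> Y \<theta> m n"
      by (rule LIMSEQ_Suc[OF lim[OF that]])
    have "(\<lambda>J. 2 * c * (1/2)^J :: real) \<longlonglongrightarrow> 0"
      by real_asymp
    then have "(\<lambda>J. (X \<theta> \<odot> P J \<theta>) m n) \<longlonglongrightarrow> (X \<theta> \<odot> Y \<theta>) m n"
      by (rule mat_mult_tendsto[OF row_bounded_unit[OF lip_boundedD(1)[OF X that] w] r tail[OF that]])
         (rule row_bounded_entry_le[OF row_bounded_unit[OF lip_boundedD(1)[OF Y that] w] r])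
    then show "(\<lambda>J. P (Suc J) \<theta> m n) \<longlonglongrightarrow> C \<theta> m n - (X \<theta> \<odot> Y \<theta>) m n"
      unfolding P_Suc[OF that] by (intro tendsto_intros)
  qed
  with Y show thesis by (rule that)
qed

lemma right_inverse_near_id:
  assumes Z: "row_bounded unit_weight r Z z" and z: "z \<le> 1/4" and r: "0 \<le> r"
  obtains S where "row_bounded unit_weight r S 2"
    and "(\<lambda>m n. mat_id m n + Z m n) \<odot> S = mat_id"
proof -
  have z0: "0 \<le> z" by (rule row_bounded_nonneg[OF Z])
  have C: "row_bounded unit_weight r (\<lambda>m n. - Z m n) z"
    by (rule row_bounded_cong[OF Z]) simp
  obtain Y where Y: "lip_bounded unit_weight r {0} Y (2 * z)"
    and eq: "\<And>\<theta> m n. \<theta> \<in> {0} \<Longrightarrow> Y \<theta> m n = - Z m n - (Z \<odot> Y \<theta>) m n"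
    using neumann_solution[OF lip_bounded_const[OF Z] lip_bounded_const[OF C] z r _ z0] by auto
  have Y0: "row_bounded unit_weight r (Y 0) (2 * z)"
    using lip_boundedD(1)[OF Y] by simp
  have S: "row_bounded unit_weight r (\<lambda>m n. mat_id m n + Y 0 m n) 2"
    by (rule row_bounded_mono[OF row_bounded_add[OF row_bounded_id Y0]]) (use z in auto)
  moreover have "(\<lambda>m n. mat_id m n + Z m n) \<odot> (\<lambda>m n. mat_id m n + Y 0 m n) = mat_id"
  proof (intro ext)
    fix m n
    show "((\<lambda>m n. mat_id m n + Z m n) \<odot> (\<lambda>m n. mat_id m n + Y 0 m n)) m n = mat_id m n"
      using eq[of 0 m n] mat_mult_add_left[OF row_bounded_id Z S r]
        mat_mult_add_right[OF Z row_bounded_id Y0 r]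
      by simp
  qed
  ultimately show thesis by (rule that)
qed

section \<open>The homological equation\<close>

text \<open>Entrywise form of \<open>(D + P) (1 + X) = (1 + X) (D' + P')\<close>, where \<open>D = diag d\<close> and \<open>D'\<close> is \<open>D\<close> plus the
diagonal of \<open>P\<close>, with \<open>D\<close> cancelled on both sides. As \<open>D\<close> is unbounded, it enters only by
multiplication of rows and columns.\<close>

definition kam_intertwined :: "(site \<Rightarrow> complex) \<Rightarrow> mat \<Rightarrow> mat \<Rightarrow> mat \<Rightarrow> bool" where
  "kam_intertwined d P X P' \<longleftrightarrow>
     (\<forall>m n. d m * X m n + P m n + (P \<odot> X) m n
          = (if m = n then P n n else 0) + X m n * (d n + P n n) + P' m n + (X \<odot> P') m n)"

text \<open>A Newton step. Dividing by the divisors gives \<open>X\<close>; what is left over consists of the tail of \<open>P\<close>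
beyond distance \<open>N\<close>, which gains \<open>exp (- h N)\<close> when the radius shrinks by \<open>h\<close>, and of the quadratic
terms \<open>P X - X diag P\<close>. The Lipschitz norm of \<open>X\<close> costs the square of the divisor.\<close>

lemma homological_step:
  assumes P: "lip_bounded w r S P \<epsilon>" and w: "\<And>m. 1 \<le> w m"
    and N: "0 \<le> N"
    and r: "0 \<le> r'" "r = r' + h" "0 \<le> h" and \<epsilon>: "0 \<le> \<epsilon>" and \<delta>: "0 < \<delta>" and L: "0 \<le> L"
    and sep: "\<And>\<theta> m n. \<theta> \<in> S \<Longrightarrow> m \<noteq> n \<Longrightarrow> l1norm (m - n) \<le> N \<Longrightarrow> \<delta> \<le> cmod (d \<theta> m - d \<theta> n)"
    and lip: "\<And>\<theta> \<theta>' m n. \<theta> \<in> S \<Longrightarrow> \<theta>' \<in> S \<Longrightarrow> l1norm (m - n) \<le> N \<Longrightarrow>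
        cmod ((d \<theta> m - d \<theta> n) - (d \<theta>' m - d \<theta>' n)) \<le> L * \<bar>\<theta> - \<theta>'\<bar>"
    and x_def: "x = \<epsilon> * (1 / \<delta> + L / \<delta>\<^sup>2)" and x: "x \<le> 1/4"
  obtains X P' where "lip_bounded w r S X x"
    and "lip_bounded w r' S P' (2 * (exp (- h * N) * \<epsilon> + 4 * \<epsilon> * x))"
    and "\<And>\<theta>. \<theta> \<in> S \<Longrightarrow> kam_intertwined (d \<theta>) (P \<theta>) (X \<theta>) (P' \<theta>)"
proof -
  have w0: "0 \<le> w m" for m
    using w[of m] by linarith
  have r0: "0 \<le> r" "r' \<le> r"
    using r by auto
  have x0: "0 \<le> x"
    unfolding x_def using \<epsilon> \<delta> L by simp
  \<comment> \<open>\<open>X\<close> solves the equation within distance \<open>N\<close>, \<open>T\<close> is the tail of \<open>P\<close> and \<open>G\<close> its diagonal.\<close>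
  define near where "near m n \<longleftrightarrow> m \<noteq> n \<and> l1norm (m - n) \<le> N" for m n :: site
  define X where "X \<theta> m n = (if near m n then - P \<theta> m n / (d \<theta> m - d \<theta> n) else 0)" for \<theta> m n
  define T where "T \<theta> m n = (if l1norm (m - n) \<le> N then 0 else P \<theta> m n)" for \<theta> m n
  define G where "G \<theta> m n = (if m = n then P \<theta> n n else 0)" for \<theta> and m n :: site
  have X: "lip_bounded w r S X x"
  proof (rule lip_boundedI)
    fix \<theta> \<theta>' assume th: "\<theta> \<in> S" "\<theta>' \<in> S"
    have "row_bounded w r (X \<theta>) ((1/\<delta>) * \<epsilon>)"
    proof (rule row_bounded_smaller[OF lip_boundedD(1)[OF P th(1)]])
      show "cmod (X \<theta> m n) \<le> (1/\<delta>) * cmod (P \<theta> m n)" for m n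
        using sep[OF th(1), of m n] \<delta>
        by (auto simp: X_def near_def norm_divide intro!: divide_left_mono mult_pos_pos)
    qed (use \<delta> w0 in auto)
    then show "row_bounded w r (X \<theta>) x"
      by (rule row_bounded_mono) (use \<delta> L \<epsilon> in \<open>auto simp: x_def algebra_simps\<close>)
    have "row_bounded w r (\<lambda>m n. X \<theta> m n - X \<theta>' m n)
        ((1/\<delta>) * (\<epsilon> * \<bar>\<theta> - \<theta>'\<bar>) + (L * \<bar>\<theta> - \<theta>'\<bar> / \<delta>\<^sup>2) * \<epsilon>)"
    proof (rule row_bounded_smaller2[OF lip_boundedD(2)[OF P th] lip_boundedD(1)[OF P th(2)]])
      fix m n
      show "cmod (X \<theta> m n - X \<theta>' m n)
          \<le> (1/\<delta>) * cmod (P \<theta> m n - P \<theta>' m n) + (L * \<bar>\<theta> - \<theta>'\<bar> / \<delta>\<^sup>2) * cmod (P \<theta>' m n)"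
      proof (cases "near m n")
        case True
        then have mn: "m \<noteq> n" "l1norm (m - n) \<le> N"
          by (auto simp: near_def)
        let ?f = "d \<theta> m - d \<theta> n" and ?f' = "d \<theta>' m - d \<theta>' n"
        note s = sep[OF th(1) mn] and s' = sep[OF th(2) mn]
        have nz: "?f \<noteq> 0" "?f' \<noteq> 0"
          using s s' \<delta> by auto
        have eq: "X \<theta> m n - X \<theta>' m n = - (P \<theta> m n - P \<theta>' m n) / ?f + P \<theta>' m n * (?f - ?f') / (?f * ?f')"
          using True nz unfolding X_def by (simp add: divide_simps) (simp add: algebra_simps)
        have "cmod (X \<theta> m n - X \<theta>' m n) \<le> cmod (P \<theta> m n - P \<theta>' m n) / cmod ?f
            + cmod (P \<theta>' m n) * cmod (?f - ?f') / (cmod ?f * cmod ?f')"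
          unfolding eq by (rule order_trans[OF norm_triangle_ineq]) (simp add: norm_divide norm_mult norm_minus_commute)
        also have "\<dots> \<le> cmod (P \<theta> m n - P \<theta>' m n) / \<delta>
            + cmod (P \<theta>' m n) * (L * \<bar>\<theta> - \<theta>'\<bar>) / (\<delta> * \<delta>)"
          using s s' \<delta> L lip[OF th mn(2)]
          by (intro add_mono frac_le mult_left_mono mult_mono) auto
        finally show ?thesis
          by (simp add: power2_eq_square mult_ac)
      next
        case False
        then show ?thesis using \<delta> L by (simp add: X_def)
      qed
    qed (use \<delta> L w0 in auto)
    then show "row_bounded w r (\<lambda>m n. X \<theta> m n - X \<theta>' m n) (x * \<bar>\<theta> - \<theta>'\<bar>)"
      by (simp add: x_def algebra_simps)
  qed
  have T: "lip_bounded w r' S T (exp (- h * N) * \<epsilon>)"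
  proof (rule lip_boundedI)
    fix \<theta> \<theta>' assume th: "\<theta> \<in> S" "\<theta>' \<in> S"
    have e: "exp (r' * l1norm k) \<le> exp (- h * N) * exp (r * l1norm k)" if "\<not> l1norm k \<le> N" for k
    proof -
      have "h * N \<le> h * l1norm k"
        using that r(3) by (intro mult_left_mono) auto
      then show ?thesis
        unfolding exp_add[symmetric] r(2) by (simp add: algebra_simps)
    qed
    have cmp: "row_bounded w r' B (exp (- h * N) * M)"
      if A: "row_bounded w r A M"
        and B: "\<And>m n. B m n = (if l1norm (m - n) \<le> N then 0 else A m n)" for A B M
    proof (rule row_bounded_comparison[OF A])
      fix m n
      have "w m * (cmod (A m n) * exp (r' * l1norm (m - n)))
          \<le> w m * (cmod (A m n) * (exp (- h * N) * exp (r * l1norm (m - n))))"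
        if "\<not> l1norm (m - n) \<le> N"
        by (intro mult_left_mono e that w0) auto
      then show "w m * (cmod (B m n) * exp (r' * l1norm (m - n)))
          \<le> exp (- h * N) * (w m * (cmod (A m n) * exp (r * l1norm (m - n))))"
        unfolding B using w0[of m] by (auto simp: mult_ac)
    qed simp
    show "row_bounded w r' (T \<theta>) (exp (- h * N) * \<epsilon>)"
      by (rule cmp[OF lip_boundedD(1)[OF P th(1)]]) (simp add: T_def)
    show "row_bounded w r' (\<lambda>m n. T \<theta> m n - T \<theta>' m n) (exp (- h * N) * \<epsilon> * \<bar>\<theta> - \<theta>'\<bar>)"
      unfolding mult.assoc by (rule cmp[OF lip_boundedD(2)[OF P th]]) (simp add: T_def)
  qed
  have G: "lip_bounded w r S G \<epsilon>"
  proof (rule lip_boundedI)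
    fix \<theta> \<theta>' assume th: "\<theta> \<in> S" "\<theta>' \<in> S"
    show "row_bounded w r (G \<theta>) \<epsilon>"
      using row_bounded_smaller[OF lip_boundedD(1)[OF P th(1)], of "G \<theta>" 1] w0 by (simp add: G_def)
    show "row_bounded w r (\<lambda>m n. G \<theta> m n - G \<theta>' m n) (\<epsilon> * \<bar>\<theta> - \<theta>'\<bar>)"
      using row_bounded_smaller[OF lip_boundedD(2)[OF P th], of "\<lambda>m n. G \<theta> m n - G \<theta>' m n" 1] w0
      by (simp add: G_def)
  qed
  define R where "R \<theta> m n = T \<theta> m n + ((P \<theta> \<odot> X \<theta>) m n - (X \<theta> \<odot> G \<theta>) m n)" for \<theta> m n
  have PX: "lip_bounded w r' S (\<lambda>\<theta>. P \<theta> \<odot> X \<theta>) (2 * \<epsilon> * x)"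
    by (rule lip_bounded_weaken[OF lip_bounded_mult[OF P lip_bounded_unit[OF X w] r0(1) w]])
       (use r0 w0 in auto)
  have XG: "lip_bounded w r' S (\<lambda>\<theta>. X \<theta> \<odot> G \<theta>) (2 * x * \<epsilon>)"
    by (rule lip_bounded_weaken[OF lip_bounded_mult[OF X lip_bounded_unit[OF G w] r0(1) w]])
       (use r0 w0 in auto)
  have R: "lip_bounded w r' S R (exp (- h * N) * \<epsilon> + 4 * \<epsilon> * x)"
    using lip_bounded_add[OF T lip_bounded_diff[OF PX XG w0] w0]
    unfolding R_def by (simp add: mult_ac)
  \<comment> \<open>The new perturbation is \<open>(1 + X)\<^sup>-\<^sup>1 R\<close>.\<close>
  obtain P' where P': "lip_bounded w r' S P' (2 * (exp (- h * N) * \<epsilon> + 4 * \<epsilon> * x))"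
    and P'_eq: "\<And>\<theta> m n. \<theta> \<in> S \<Longrightarrow> P' \<theta> m n = R \<theta> m n - (X \<theta> \<odot> P' \<theta>) m n"
  proof (rule neumann_solution[OF _ R x r(1) w])
    show "lip_bounded w r' S X x"
      by (rule lip_bounded_weaken[OF X]) (use r0 w0 in auto)
    show "0 \<le> exp (- h * N) * \<epsilon> + 4 * \<epsilon> * x"
      using \<epsilon> x0 by simp
  qed auto
  have XG_eq: "(X \<theta> \<odot> G \<theta>) m n = X \<theta> m n * P \<theta> n n" for \<theta> m n
  proof -
    have "(\<Sum>\<^sub>\<infinity>k. X \<theta> m k * G \<theta> k n) = (\<Sum>\<^sub>\<infinity>k\<in>{n}. X \<theta> m k * G \<theta> k n)"
      by (rule infsum_cong_neutral) (auto simp: G_def)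
    then show ?thesis
      by (simp add: mat_mult_def G_def)
  qed
  have "kam_intertwined (d \<theta>) (P \<theta>) (X \<theta>) (P' \<theta>)" if "\<theta> \<in> S" for \<theta>
    unfolding kam_intertwined_def
  proof (intro allI)
    fix m n
    have nz: "l1norm (m - n) \<le> N \<Longrightarrow> m \<noteq> n \<Longrightarrow> d \<theta> m - d \<theta> n \<noteq> 0"
      using sep[OF that, of m n] \<delta> by auto
    have "(d \<theta> m - d \<theta> n) * X \<theta> m n + P \<theta> m n = G \<theta> m n + T \<theta> m n"
      using nz N by (auto simp: X_def G_def T_def near_def)
    then show "d \<theta> m * X \<theta> m n + P \<theta> m n + (P \<theta> \<odot> X \<theta>) m n
        = (if m = n then P \<theta> n n else 0) + X \<theta> m n * (d \<theta> n + P \<theta> n n) + P' \<theta> m n + (X \<theta> \<odot> P' \<theta>) m n"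
      using P'_eq[OF that, of m n] by (simp add: R_def XG_eq G_def algebra_simps)
  qed
  with X P' show thesis by (rule that)
qed

section \<open>Resonant angles\<close>

lemma slope_diff: "slope \<theta> (m - n) = slope \<theta> m - slope \<theta> n"
  by (simp add: slope_def algebra_simps)

lemma slope_lipschitz: "\<bar>slope \<theta> k - slope \<theta>' k\<bar> \<le> l1norm k * \<bar>\<theta> - \<theta>'\<bar>"
proof -
  have c: "\<bar>cos \<theta> - cos \<theta>'\<bar> \<le> \<bar>\<theta> - \<theta>'\<bar>"
    using cos_diff_cos[of \<theta> \<theta>'] abs_sin_x_le_abs_x[of "(\<theta>' - \<theta>) / 2"] abs_sin_le_one[of "(\<theta> + \<theta>') / 2"]
      mult_mono[of "\<bar>sin ((\<theta> + \<theta>') / 2)\<bar>" 1 "\<bar>sin ((\<theta>' - \<theta>) / 2)\<bar>" "\<bar>(\<theta>' - \<theta>) / 2\<bar>"]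
    by (simp add: abs_mult abs_minus_commute)
  have s: "\<bar>sin \<theta> - sin \<theta>'\<bar> \<le> \<bar>\<theta> - \<theta>'\<bar>"
    using sin_diff_sin[of \<theta> \<theta>'] abs_sin_x_le_abs_x[of "(\<theta> - \<theta>') / 2"] abs_cos_le_one[of "(\<theta> + \<theta>') / 2"]
      mult_mono[of "\<bar>sin ((\<theta> - \<theta>') / 2)\<bar>" "\<bar>(\<theta> - \<theta>') / 2\<bar>" "\<bar>cos ((\<theta> + \<theta>') / 2)\<bar>" 1]
    by (simp add: abs_mult)
  have "slope \<theta> k - slope \<theta>' k = real_of_int (fst k) * (cos \<theta> - cos \<theta>') + real_of_int (snd k) * (sin \<theta> - sin \<theta>')"
    by (simp add: slope_def algebra_simps)
  then have "\<bar>slope \<theta> k - slope \<theta>' k\<bar> \<le> \<bar>real_of_int (fst k)\<bar> * \<bar>cos \<theta> - cos \<theta>'\<bar> + \<bar>real_of_int (snd k)\<bar> * \<bar>sin \<theta> - sin \<theta>'\<bar>"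
    by (simp only: abs_mult[symmetric] abs_triangle_ineq)
  also have "\<dots> \<le> \<bar>real_of_int (fst k)\<bar> * \<bar>\<theta> - \<theta>'\<bar> + \<bar>real_of_int (snd k)\<bar> * \<bar>\<theta> - \<theta>'\<bar>"
    by (intro add_mono mult_left_mono c s) auto
  finally show ?thesis
    by (simp add: l1norm_def algebra_simps)
qed

lemma slope_polar:
  assumes "k \<noteq> 0"
  obtains R \<phi> where "1 \<le> R" "l1norm k / 2 \<le> R" "\<And>\<theta>. slope \<theta> k = R * cos (\<theta> - \<phi>)"
proof -
  obtain p q where k: "k = (p, q)"
    by (cases k)
  define x y where "x = real_of_int p" and "y = real_of_int q"
  define R where "R = sqrt (x\<^sup>2 + y\<^sup>2)"
  have "1 \<le> \<bar>x\<bar> + \<bar>y\<bar>"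
    using l1norm_ge_1[OF assms] by (simp add: k l1norm_def x_def y_def)
  moreover have "1 \<le> \<bar>x\<bar> \<or> x = 0" "1 \<le> \<bar>y\<bar> \<or> y = 0"
    unfolding x_def y_def by (cases "p = 0"; cases "q = 0"; simp; linarith)+
  ultimately have "1 \<le> x\<^sup>2 \<or> 1 \<le> y\<^sup>2"
    by (auto simp: abs_le_square_iff[of 1, simplified])
  then have R2: "1 \<le> x\<^sup>2 + y\<^sup>2"
    using zero_le_power2[of x] zero_le_power2[of y] by linarith
  then have R1: "1 \<le> R"
    by (simp add: R_def)
  have "(\<bar>x\<bar> + \<bar>y\<bar>)\<^sup>2 \<le> (2 * R)\<^sup>2"
  proof -
    have "(\<bar>x\<bar> + \<bar>y\<bar>)\<^sup>2 + (\<bar>x\<bar> - \<bar>y\<bar>)\<^sup>2 = 2 * (x\<^sup>2 + y\<^sup>2)"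
      by (simp add: power2_eq_square algebra_simps)
    moreover have "(2 * R)\<^sup>2 = 4 * (x\<^sup>2 + y\<^sup>2)"
      using R2 by (simp add: R_def power_mult_distrib)
    ultimately show ?thesis
      using zero_le_power2[of "\<bar>x\<bar> - \<bar>y\<bar>"] R2 by argo
  qed
  then have "\<bar>x\<bar> + \<bar>y\<bar> \<le> 2 * R"
    using R1 by (intro power2_le_imp_le[of "\<bar>x\<bar> + \<bar>y\<bar>"]) auto
  then have R3: "l1norm k / 2 \<le> R"
    by (simp add: k l1norm_def x_def y_def)
  have "R\<^sup>2 = x\<^sup>2 + y\<^sup>2"
    by (simp add: R_def)
  then have "(x / R)\<^sup>2 + (y / R)\<^sup>2 = R\<^sup>2 / R\<^sup>2"
    unfolding power_divide add_divide_distrib[symmetric] by (rule arg_cong[OF sym])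
  then have "(x / R)\<^sup>2 + (y / R)\<^sup>2 = 1"
    using R1 by simp
  then obtain \<phi> where \<phi>: "x / R = cos \<phi>" "y / R = sin \<phi>"
    using sincos_total_2pi by metis
  then have "x = R * cos \<phi>" "y = R * sin \<phi>"
    using R1 by (auto simp: field_simps)
  then have "slope \<theta> k = R * cos (\<theta> - \<phi>)" for \<theta>
    by (simp add: slope_def k cos_diff algebra_simps flip: x_def y_def)
  with R1 R3 show thesis by (rule that)
qed

text \<open>With \<open>k = R (cos \<phi>, sin \<phi>)\<close> the slope is \<open>R cos (\<theta> - \<phi>)\<close>. Where this is at most 1/2 in modulus, the
derivative \<open>- R sin (\<theta> - \<phi>)\<close> is at least \<open>3 R / 4\<close> in modulus, and it stays above \<open>R / 2\<close> within
distance 1/4.\<close>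

lemma slope_transversal:
  assumes k: "k \<noteq> 0" and small: "\<bar>slope t k\<bar> \<le> 1/2"
    and near: "\<bar>\<theta> - t\<bar> \<le> 1/4" "\<bar>\<theta>' - t\<bar> \<le> 1/4"
  shows "max (1/2) (l1norm k / 4) * \<bar>\<theta> - \<theta>'\<bar> \<le> \<bar>slope \<theta> k - slope \<theta>' k\<bar>"
proof -
  obtain R \<phi> where R: "1 \<le> R" "l1norm k / 2 \<le> R" and s: "\<And>\<theta>. slope \<theta> k = R * cos (\<theta> - \<phi>)"
    using slope_polar[OF k] by metis
  have "R * \<bar>cos (t - \<phi>)\<bar> \<le> 1/2"
    using small R by (simp add: s abs_mult)
  moreover have "1 * \<bar>cos (t - \<phi>)\<bar> \<le> R * \<bar>cos (t - \<phi>)\<bar>"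
    using R by (intro mult_right_mono) auto
  ultimately have "\<bar>cos (t - \<phi>)\<bar> \<le> 1/2" by linarith
  then have "(cos (t - \<phi>))\<^sup>2 \<le> (1/2)\<^sup>2"
    by (subst abs_le_square_iff[symmetric]) simp
  then have "(3/4)\<^sup>2 \<le> (sin (t - \<phi>))\<^sup>2"
    using sin_cos_squared_add[of "t - \<phi>"] by (simp add: power2_eq_square)
  then have s34: "3/4 \<le> \<bar>sin (t - \<phi>)\<bar>"
    by (subst (asm) abs_le_square_iff[symmetric]) simp
  have main: "max (1/2) (l1norm k / 4) * \<bar>a - b\<bar> \<le> \<bar>slope a k - slope b k\<bar>"
    if "a < b" "\<bar>a - t\<bar> \<le> 1/4" "\<bar>b - t\<bar> \<le> 1/4" for a b
  proof -
    have "\<exists>z. a < z \<and> z < b \<and> R * cos (b - \<phi>) - R * cos (a - \<phi>) = (b - a) * (- R * sin (z - \<phi>))"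
      by (rule MVT2[OF that(1)]) (auto intro!: derivative_eq_intros)
    then obtain z where z: "a < z" "z < b"
      "R * cos (b - \<phi>) - R * cos (a - \<phi>) = (b - a) * (- R * sin (z - \<phi>))" by blast
    have "\<bar>sin (z - \<phi>) - sin (t - \<phi>)\<bar> \<le> \<bar>z - t\<bar>"
      using sin_diff_sin[of "z - \<phi>" "t - \<phi>"] abs_sin_x_le_abs_x[of "(z - t) / 2"]
        abs_cos_le_one[of "(z - \<phi> + (t - \<phi>)) / 2"]
        mult_mono[of "\<bar>sin ((z - t) / 2)\<bar>" "\<bar>(z - t) / 2\<bar>" "\<bar>cos ((z - \<phi> + (t - \<phi>)) / 2)\<bar>" 1]
      by (simp add: abs_mult)
    then have "1/2 \<le> \<bar>sin (z - \<phi>)\<bar>"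
      using s34 that z by linarith
    then have "R * (1/2) \<le> R * \<bar>sin (z - \<phi>)\<bar>"
      using R by (intro mult_left_mono) auto
    then have "max (1/2) (l1norm k / 4) \<le> R * \<bar>sin (z - \<phi>)\<bar>"
      using R by linarith
    then have "max (1/2) (l1norm k / 4) * (b - a) \<le> R * \<bar>sin (z - \<phi>)\<bar> * (b - a)"
      using that by (intro mult_right_mono) auto
    also have "\<dots> = \<bar>slope b k - slope a k\<bar>"
      unfolding s z(3) using that R by (simp add: abs_mult mult_ac)
    finally show ?thesis using that by (simp add: abs_minus_commute)
  qed
  consider "\<theta> < \<theta>'" | "\<theta> = \<theta>'" | "\<theta>' < \<theta>" by linarith
  then show ?thesis
    by cases (use main[of \<theta> \<theta>'] main[of \<theta>' \<theta>] near in \<open>auto simp: abs_minus_commute\<close>)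
qed

text \<open>Split the circle into arcs of length 1/4. On each arc that meets the sublevel set, transversality of
the slope beats the Lipschitz constant of \<open>h\<close>, so that the set lies within \<open>16 \<delta> / \<bar>k\<bar>\<close> of any one of its
points.\<close>

lemma sublevel_cover:
  fixes h :: "real \<Rightarrow> complex"
  assumes k: "k \<noteq> 0" and \<delta>: "0 < \<delta>" "\<delta> \<le> 1/4" and S: "S \<subseteq> {0..2 * pi}"
    and h: "\<And>\<theta>. \<theta> \<in> S \<Longrightarrow> cmod (h \<theta>) \<le> 1/4"
    and lip: "\<And>\<theta> \<theta>'. \<theta> \<in> S \<Longrightarrow> \<theta>' \<in> S \<Longrightarrow> cmod (h \<theta> - h \<theta>') \<le> 1/4 * \<bar>\<theta> - \<theta>'\<bar>"
  obtains B where "open B" "emeasure lebesgue B \<le> ennreal (1000 * \<delta> / l1norm k)"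
    "\<And>\<theta>. \<theta> \<in> S \<Longrightarrow> cmod (of_real (slope \<theta> k) + h \<theta>) < \<delta> \<Longrightarrow> \<theta> \<in> B"
proof -
  let ?f = "\<lambda>\<theta>. of_real (slope \<theta> k) + h \<theta>"
  have k1: "1 \<le> l1norm k"
    by (rule l1norm_ge_1[OF k])
  \<comment> \<open>On one arc \<open>\<bar>k\<bar>/8 \<cdot> \<bar>\<theta> - t\<bar> < 2 \<delta>\<close>, whence this half-width.\<close>
  define l where "l = 16 * \<delta> / l1norm k"
  have l: "0 < l"
    using k1 \<delta> by (simp add: l_def)
  define J where "J i = {\<theta>\<in>S. cmod (?f \<theta>) < \<delta> \<and> real i / 4 \<le> \<theta> \<and> \<theta> \<le> (real i + 1) / 4}" for i :: nat
  define t where "t i = (SOME \<theta>. \<theta> \<in> J i)" for i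
  define B where "B i = (if J i = {} then {} else {t i - l<..<t i + l})" for i
  have tJ: "t i \<in> J i" if "\<theta> \<in> J i" for \<theta> i
    unfolding t_def using that by (rule someI)
  have JB: "\<theta> \<in> B i" if "\<theta> \<in> J i" for \<theta> i
  proof -
    have a: "\<theta> \<in> S" "t i \<in> S" "cmod (?f \<theta>) < \<delta>" "cmod (?f (t i)) < \<delta>" "\<bar>\<theta> - t i\<bar> \<le> 1/4"
      using that tJ[OF that] unfolding J_def add_divide_distrib mem_Collect_eq by (blast | linarith)+
    have "cmod (of_real (slope (t i) k)) \<le> cmod (?f (t i)) + cmod (h (t i))"
      using norm_triangle_ineq4[of "?f (t i)" "h (t i)"] by simp
    then have "\<bar>slope (t i) k\<bar> \<le> 1/2"
      using a h[OF a(2)] \<delta> by simp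
    from slope_transversal[OF k this a(5), of "t i"]
    have "max (1/2) (l1norm k / 4) * \<bar>\<theta> - t i\<bar> \<le> \<bar>slope \<theta> k - slope (t i) k\<bar>"
      by simp
    also have "\<dots> = cmod (?f \<theta> - ?f (t i) - (h \<theta> - h (t i)))"
      by (simp flip: of_real_diff)
    also have "\<dots> \<le> cmod (?f \<theta>) + cmod (?f (t i)) + cmod (h \<theta> - h (t i))"
      by (intro order_trans[OF norm_triangle_ineq4] add_mono norm_triangle_ineq4 order_refl)
    also have "\<dots> < 2 * \<delta> + 1/4 * \<bar>\<theta> - t i\<bar>"
      using lip[OF a(1,2)] a(3,4) by simp
    finally have "(max (1/2) (l1norm k / 4) - 1/4) * \<bar>\<theta> - t i\<bar> < 2 * \<delta>"
      by (simp add: left_diff_distrib)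
    moreover have "l1norm k / 8 * \<bar>\<theta> - t i\<bar> \<le> (max (1/2) (l1norm k / 4) - 1/4) * \<bar>\<theta> - t i\<bar>"
      by (intro mult_right_mono) auto
    ultimately have "l1norm k / 8 * \<bar>\<theta> - t i\<bar> < 2 * \<delta>" by linarith
    then have "\<bar>\<theta> - t i\<bar> < l"
      using k1 by (simp add: l_def field_simps)
    then show ?thesis
      using that by (auto simp: B_def abs_less_iff)
  qed
  have "emeasure lebesgue (\<Union>i<26. B i) \<le> (\<Sum>i<26. emeasure lebesgue (B i))"
    by (rule emeasure_subadditive_finite) (auto simp: B_def)
  also have "\<dots> \<le> (\<Sum>i<26::nat. ennreal (2 * l))"
    using l by (intro sum_mono) (auto simp: B_def)
  also have "\<dots> = ennreal (52 * l)"
    using l by (simp add: ennreal_of_nat_eq_real_of_nat flip: ennreal_mult ennreal_numeral)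
  also have "\<dots> \<le> ennreal (1000 * \<delta> / l1norm k)"
    using k1 \<delta> by (intro ennreal_leI) (simp add: l_def divide_right_mono)
  finally have "emeasure lebesgue (\<Union>i<26. B i) \<le> ennreal (1000 * \<delta> / l1norm k)" .
  moreover have "open (\<Union>i<26. B i)"
    by (auto simp: B_def)
  moreover have "\<theta> \<in> (\<Union>i<26. B i)" if "\<theta> \<in> S" "cmod (?f \<theta>) < \<delta>" for \<theta>
  proof -
    define i where "i = nat \<lfloor>4 * \<theta>\<rfloor>"
    have \<theta>: "0 \<le> \<theta>" "\<theta> \<le> 2 * pi"
      using that S by auto
    then have i: "real i \<le> 4 * \<theta>" "4 * \<theta> < real i + 1"
      unfolding i_def by (auto simp: of_nat_nat)
    \<comment> \<open>Hence \<open>2 * pi < 26/4\<close>, and 26 arcs of length 1/4 cover the circle.\<close>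
    moreover have "pi < 13/4"
      using pi_less_4 pi_approx by simp
    ultimately have "real i < 26"
      using \<theta> by linarith
    moreover have "\<theta> \<in> J i"
      using that i by (auto simp: J_def)
    ultimately show ?thesis
      using JB by auto
  qed
  ultimately show thesis
    using that by metis
qed

lemma separation_cover:
  fixes g :: "real \<Rightarrow> site \<Rightarrow> complex" and \<delta> :: real
  assumes J: "finite J" "\<And>m n. (m, n) \<in> J \<Longrightarrow> m \<noteq> n"
    and \<delta>: "0 < \<delta>" "\<delta> \<le> 1/4" and S: "S \<subseteq> {0..2 * pi}"
    and g: "\<And>\<theta> m. \<theta> \<in> S \<Longrightarrow> cmod (g \<theta> m) \<le> 1/8"
    and lip: "\<And>\<theta> \<theta>' m. \<theta> \<in> S \<Longrightarrow> \<theta>' \<in> S \<Longrightarrow> cmod (g \<theta> m - g \<theta>' m) \<le> 1/8 * \<bar>\<theta> - \<theta>'\<bar>"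
  obtains B where "open B" "emeasure lebesgue B \<le> ennreal (card J * (1000 * \<delta>))"
    "\<And>\<theta> m n. \<theta> \<in> S - B \<Longrightarrow> (m, n) \<in> J \<Longrightarrow>
       \<delta> \<le> cmod ((of_real (slope \<theta> m) + g \<theta> m) - (of_real (slope \<theta> n) + g \<theta> n))"
proof -
  have "\<exists>B. open B \<and> emeasure lebesgue B \<le> ennreal (1000 * \<delta>) \<and>
     (\<forall>\<theta>\<in>S - B. \<delta> \<le> cmod ((of_real (slope \<theta> (fst p)) + g \<theta> (fst p)) - (of_real (slope \<theta> (snd p)) + g \<theta> (snd p))))"
    if "p \<in> J" for p
  proof -
    obtain m n where p: "p = (m, n)" by (cases p)
    then have mn: "m - n \<noteq> 0"
      using J(2) that by auto
    obtain B where B: "open B" "emeasure lebesgue B \<le> ennreal (1000 * \<delta> / l1norm (m - n))"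
      "\<And>\<theta>. \<theta> \<in> S \<Longrightarrow> cmod (of_real (slope \<theta> (m - n)) + (g \<theta> m - g \<theta> n)) < \<delta> \<Longrightarrow> \<theta> \<in> B"
    proof (rule sublevel_cover[OF mn \<delta> S, of "\<lambda>\<theta>. g \<theta> m - g \<theta> n"])
      show "cmod (g \<theta> m - g \<theta> n) \<le> 1/4" if "\<theta> \<in> S" for \<theta>
        using norm_triangle_ineq4[of "g \<theta> m" "g \<theta> n"] g[OF that, of m] g[OF that, of n] by linarith
      show "cmod (g \<theta> m - g \<theta> n - (g \<theta>' m - g \<theta>' n)) \<le> 1/4 * \<bar>\<theta> - \<theta>'\<bar>"
        if "\<theta> \<in> S" "\<theta>' \<in> S" for \<theta> \<theta>'
        using norm_triangle_ineq4[of "g \<theta> m - g \<theta>' m" "g \<theta> n - g \<theta>' n"]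
          lip[OF that, of m] lip[OF that, of n] by (simp add: algebra_simps)
    qed (use that in metis)
    have "ennreal (1000 * \<delta> / l1norm (m - n)) \<le> ennreal (1000 * \<delta>)"
    proof (rule ennreal_leI)
      have "1000 * \<delta> / l1norm (m - n) \<le> 1000 * \<delta> / 1"
        using l1norm_ge_1[OF mn] \<delta> by (intro divide_left_mono) auto
      then show "1000 * \<delta> / l1norm (m - n) \<le> 1000 * \<delta>" by simp
    qed
    moreover have "\<delta> \<le> cmod ((of_real (slope \<theta> m) + g \<theta> m) - (of_real (slope \<theta> n) + g \<theta> n))"
      if "\<theta> \<in> S - B" for \<theta>
      using B(3)[of \<theta>] that unfolding slope_diff not_less[symmetric]
      by (auto simp: algebra_simps)
    ultimately show ?thesis
      using B(1,2) p by (intro exI[of _ B]) auto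
  qed
  then obtain B where B: "\<And>p. p \<in> J \<Longrightarrow> open (B p)"
    "\<And>p. p \<in> J \<Longrightarrow> emeasure lebesgue (B p) \<le> ennreal (1000 * \<delta>)"
    "\<And>p \<theta>. p \<in> J \<Longrightarrow> \<theta> \<in> S - B p \<Longrightarrow>
       \<delta> \<le> cmod ((of_real (slope \<theta> (fst p)) + g \<theta> (fst p)) - (of_real (slope \<theta> (snd p)) + g \<theta> (snd p)))"
    by metis
  have "emeasure lebesgue (\<Union>p\<in>J. B p) \<le> (\<Sum>p\<in>J. emeasure lebesgue (B p))"
    by (rule emeasure_subadditive_finite[OF J(1)]) (use B(1) in auto)
  also have "\<dots> \<le> (\<Sum>p\<in>J. ennreal (1000 * \<delta>))"
    by (intro sum_mono B(2))
  also have "\<dots> = ennreal (card J * (1000 * \<delta>))"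
    using \<delta> by (simp add: ennreal_mult ennreal_of_nat_eq_real_of_nat)
  finally show thesis
  proof (intro that[of "\<Union>p\<in>J. B p"])
    fix \<theta> m n assume "\<theta> \<in> S - (\<Union>p\<in>J. B p)" "(m, n) \<in> J"
    then show "\<delta> \<le> cmod ((of_real (slope \<theta> m) + g \<theta> m) - (of_real (slope \<theta> n) + g \<theta> n))"
      using B(3)[of "(m, n)" \<theta>] by auto
  qed (use B(1) in auto)
qed

lemma l1norm_ball_card:
  assumes "0 \<le> E"
  shows "finite {m. l1norm m \<le> E}" "real (card {m. l1norm m \<le> E}) \<le> (2 * E + 1)\<^sup>2"
proof -
  let ?I = "{- \<lfloor>E\<rfloor>..\<lfloor>E\<rfloor>}"
  have sub: "{m. l1norm m \<le> E} \<subseteq> ?I \<times> ?I"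
  proof (clarsimp simp: l1norm_def)
    fix a b :: int assume "\<bar>real_of_int a\<bar> + \<bar>real_of_int b\<bar> \<le> E"
    then have "real_of_int a \<le> E" "real_of_int (- a) \<le> E" "real_of_int b \<le> E" "real_of_int (- b) \<le> E"
      by auto
    then show "- \<lfloor>E\<rfloor> \<le> a \<and> a \<le> \<lfloor>E\<rfloor> \<and> - \<lfloor>E\<rfloor> \<le> b \<and> b \<le> \<lfloor>E\<rfloor>"
      unfolding le_floor_iff[symmetric] by linarith
  qed
  show "finite {m. l1norm m \<le> E}"
    by (rule finite_subset[OF sub]) auto
  have c: "real (card ?I) \<le> 2 * E + 1"
    using assms by (simp add: of_nat_nat)
  have "real (card {m. l1norm m \<le> E}) \<le> real (card (?I \<times> ?I))"
    by (intro of_nat_mono card_mono sub) auto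
  also have "\<dots> = real (card ?I) * real (card ?I)"
    by simp
  also have "\<dots> \<le> (2 * E + 1) * (2 * E + 1)"
    using c assms by (intro mult_mono c) auto
  finally show "real (card {m. l1norm m \<le> E}) \<le> (2 * E + 1)\<^sup>2"
    by (simp add: power2_eq_square)
qed

definition log_weight :: "real \<Rightarrow> site \<Rightarrow> real" where
  "log_weight \<sigma> m = ln (bracket m) powr \<sigma>"

lemma ln_bracket_ge_1: "1 \<le> ln (bracket m)"
proof -
  have "exp 1 \<le> bracket m" by (simp add: bracket_def)
  then have "ln (exp 1) \<le> ln (bracket m)"
    by (intro ln_mono) (auto intro: less_le_trans[OF exp_gt_zero])
  then show ?thesis by simp
qed

lemma log_weight_ge_1: "0 \<le> \<sigma> \<Longrightarrow> 1 \<le> log_weight \<sigma> m"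
  unfolding log_weight_def by (rule ge_one_powr_ge_zero[OF ln_bracket_ge_1])

text \<open>For \<open>y\<close> of order \<open>N powr \<tau>\<close> with \<open>\<tau> < \<sigma>\<close> this radius is subexponential in \<open>N\<close>, which is how the
logarithmic decay of the potential pays for the small divisors.\<close>

lemma log_weight_sublevel:
  assumes "0 < \<sigma>" "log_weight \<sigma> m < y"
  shows "l1norm m \<le> exp (y powr (1 / \<sigma>))"
proof -
  have l: "1 \<le> ln (bracket m)" by (rule ln_bracket_ge_1)
  have b: "0 < bracket m"
    by (simp add: bracket_def less_max_iff_disj)
  have "ln (bracket m) = log_weight \<sigma> m powr (1 / \<sigma>)"
    using assms l by (simp add: log_weight_def powr_powr)
  also have "\<dots> \<le> y powr (1 / \<sigma>)"
    using assms log_weight_ge_1[of \<sigma> m] by (intro powr_mono2) auto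
  finally have "exp (ln (bracket m)) \<le> exp (y powr (1 / \<sigma>))"
    by simp
  then have "bracket m \<le> exp (y powr (1 / \<sigma>))"
    using b by simp
  moreover have "l1norm m \<le> bracket m"
    by (simp add: bracket_def)
  ultimately show ?thesis by linarith
qed

lemma DCD: "\<theta> \<in> DC \<gamma> \<tau> \<Longrightarrow> n \<noteq> 0 \<Longrightarrow> \<gamma> / l1norm n powr \<tau> \<le> \<bar>slope \<theta> n\<bar>"
  unfolding DC_def by blast

text \<open>Pairs of sites whose weights are both at least \<open>4 N powr \<tau> / \<gamma>\<close> are separated by the Diophantine condition,
since the corrections cannot compensate \<open>\<gamma> / N powr \<tau>\<close>. For the remaining pairs one site lies in the ball of
radius \<open>E\<close>, and the resonant angles of these finitely many pairs are removed.\<close>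

lemma kam_separation:
  fixes g :: "real \<Rightarrow> site \<Rightarrow> complex"
  assumes S: "S \<subseteq> DC \<gamma> \<tau>" and pos: "0 < \<gamma>" "0 < \<tau>" "0 < \<sigma>" and N: "1 \<le> N"
    and \<delta>: "0 < \<delta>" "\<delta> \<le> 1/4" "\<delta> \<le> \<gamma> / (2 * N powr \<tau>)"
    and g: "\<And>\<theta> m. \<theta> \<in> S \<Longrightarrow> log_weight \<sigma> m * cmod (g \<theta> m) \<le> 1/8"
    and lip: "\<And>\<theta> \<theta>' m. \<theta> \<in> S \<Longrightarrow> \<theta>' \<in> S \<Longrightarrow> cmod (g \<theta> m - g \<theta>' m) \<le> 1/8 * \<bar>\<theta> - \<theta>'\<bar>"
    and E: "E = exp ((4 * N powr \<tau> / \<gamma>) powr (1 / \<sigma>))"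
  obtains B where "open B"
    "emeasure lebesgue B \<le> ennreal ((2 * E + 1)\<^sup>2 * (2 * N + 1)\<^sup>2 * (1000 * \<delta>))"
    "\<And>\<theta> m n. \<theta> \<in> S - B \<Longrightarrow> m \<noteq> n \<Longrightarrow> l1norm (m - n) \<le> N \<Longrightarrow>
       \<delta> \<le> cmod ((of_real (slope \<theta> m) + g \<theta> m) - (of_real (slope \<theta> n) + g \<theta> n))"
proof -
  define y where "y = 4 * N powr \<tau> / \<gamma>"
  have y: "0 < y"
    using pos N by (simp add: y_def)
  define J where "J = {(m, n). m \<noteq> n \<and> l1norm (m - n) \<le> N \<and> log_weight \<sigma> m < y}"
  have E0: "0 \<le> E" by (simp add: E)
  let ?b = "\<lambda>R. {m. l1norm m \<le> R}"
  have sub: "J \<subseteq> (\<lambda>(m, k). (m, m - k)) ` (?b E \<times> ?b N)"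
  proof
    fix p assume "p \<in> J"
    then obtain m n where p: "p = (m, n)" "l1norm (m - n) \<le> N" "log_weight \<sigma> m < y"
      by (auto simp: J_def)
    have "l1norm m \<le> E"
      using log_weight_sublevel[OF pos(3) p(3)] by (simp add: E y_def)
    then show "p \<in> (\<lambda>(m, k). (m, m - k)) ` (?b E \<times> ?b N)"
      using p by (intro image_eqI[of _ _ "(m, m - n)"]) auto
  qed
  have fin: "finite (?b E \<times> ?b N)"
    using l1norm_ball_card(1) E0 N by (intro finite_cartesian_product) auto
  have J: "finite J"
    by (rule finite_subset[OF sub]) (intro finite_imageI fin)
  have "real (card J) \<le> real (card (?b E \<times> ?b N))"
    using order_trans[OF card_mono[OF finite_imageI[OF fin] sub] card_image_le[OF fin]] by simp
  also have "\<dots> = real (card (?b E)) * real (card (?b N))"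
    by (simp add: card_cartesian_product)
  also have "\<dots> \<le> (2 * E + 1)\<^sup>2 * (2 * N + 1)\<^sup>2"
    using E0 N by (intro mult_mono l1norm_ball_card(2)) auto
  finally have cardJ: "real (card J) \<le> (2 * E + 1)\<^sup>2 * (2 * N + 1)\<^sup>2" .
  have Jne: "m \<noteq> n" if "(m, n) \<in> J" for m n
    using that by (simp add: J_def)
  have S': "S \<subseteq> {0..2 * pi}"
    using S by (auto simp: DC_def)
  have g8: "cmod (g \<theta> m) \<le> 1/8" if "\<theta> \<in> S" for \<theta> m
    using mult_right_mono[OF log_weight_ge_1[of \<sigma> m], of "cmod (g \<theta> m)"] g[OF that, of m] pos by simp
  obtain B where B: "open B" "emeasure lebesgue B \<le> ennreal (card J * (1000 * \<delta>))"
    "\<And>\<theta> m n. \<theta> \<in> S - B \<Longrightarrow> (m, n) \<in> J \<Longrightarrow>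
       \<delta> \<le> cmod ((of_real (slope \<theta> m) + g \<theta> m) - (of_real (slope \<theta> n) + g \<theta> n))"
    by (rule separation_cover[where J=J and S=S and g=g and \<delta>=\<delta>],
        (assumption | rule J Jne \<delta> S' g8 lip)+, metis)
  show thesis
  proof (rule that[OF B(1)])
    have "ennreal (card J * (1000 * \<delta>)) \<le> ennreal ((2 * E + 1)\<^sup>2 * (2 * N + 1)\<^sup>2 * (1000 * \<delta>))"
      using cardJ \<delta> by (intro ennreal_leI mult_right_mono) auto
    with B(2) show "emeasure lebesgue B \<le> ennreal ((2 * E + 1)\<^sup>2 * (2 * N + 1)\<^sup>2 * (1000 * \<delta>))"
      by (rule order_trans)
    fix \<theta> m n assume \<theta>: "\<theta> \<in> S - B" and mn: "m \<noteq> n" "l1norm (m - n) \<le> N"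
    consider "(m, n) \<in> J" | "(n, m) \<in> J" | "y \<le> log_weight \<sigma> m" "y \<le> log_weight \<sigma> n"
      using mn l1norm_commute[of m n] unfolding J_def mem_Collect_eq case_prod_conv by (metis not_less)
    then show "\<delta> \<le> cmod ((of_real (slope \<theta> m) + g \<theta> m) - (of_real (slope \<theta> n) + g \<theta> n))"
    proof cases
      case 3
      have gm: "cmod (g \<theta> k) \<le> \<gamma> / (32 * N powr \<tau>)" if "y \<le> log_weight \<sigma> k" for k
      proof -
        have "y * cmod (g \<theta> k) \<le> 1/8"
          using mult_right_mono[OF that, of "cmod (g \<theta> k)"] g[of \<theta> k] \<theta> by simp
        then show ?thesis
          using pos N by (simp add: y_def field_simps)
      qed
      have "\<gamma> / N powr \<tau> \<le> \<gamma> / l1norm (m - n) powr \<tau>"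
        using mn pos l1norm_ge_1[of "m - n"]
        by (intro divide_left_mono powr_mono2 mult_pos_pos) auto
      also have "\<dots> \<le> \<bar>slope \<theta> (m - n)\<bar>"
        using DCD[of \<theta> \<gamma> \<tau> "m - n"] \<theta> S mn by auto
      also have "\<dots> = cmod (((of_real (slope \<theta> m) + g \<theta> m) - (of_real (slope \<theta> n) + g \<theta> n)) - (g \<theta> m - g \<theta> n))"
        by (simp add: slope_diff flip: of_real_diff)
      also have "\<dots> \<le> cmod ((of_real (slope \<theta> m) + g \<theta> m) - (of_real (slope \<theta> n) + g \<theta> n))
          + (cmod (g \<theta> m) + cmod (g \<theta> n))"
        by (intro order_trans[OF norm_triangle_ineq4] add_mono norm_triangle_ineq4 order_refl)
      finally have "\<gamma> / N powr \<tau> \<le> cmod ((of_real (slope \<theta> m) + g \<theta> m) - (of_real (slope \<theta> n) + g \<theta> n))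
          + (cmod (g \<theta> m) + cmod (g \<theta> n))" .
      moreover have "cmod (g \<theta> m) + cmod (g \<theta> n) \<le> \<gamma> / (2 * N powr \<tau>)"
      proof -
        have "\<gamma> / (32 * N powr \<tau>) + \<gamma> / (32 * N powr \<tau>) \<le> \<gamma> / (2 * N powr \<tau>)"
          using pos N by (simp add: field_simps)
        then show ?thesis
          using gm[OF 3(1)] gm[OF 3(2)] by linarith
      qed
      moreover have "\<gamma> / N powr \<tau> = \<gamma> / (2 * N powr \<tau>) + \<gamma> / (2 * N powr \<tau>)"
        using N by (simp add: field_simps)
      ultimately show ?thesis using \<delta> by linarith
    next
      case 1
      then show ?thesis by (rule B(3)[OF \<theta>])
    next
      case 2
      then show ?thesis using B(3)[OF \<theta> 2] by (simp add: norm_minus_commute)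
    qed
  qed
qed

section \<open>Topology and measure of the Diophantine angles\<close>

lemma compact_DC: "compact (DC \<gamma> \<tau>)"
proof -
  have eq: "DC \<gamma> \<tau> = {0..2 * pi} \<inter> (\<Inter>n\<in>-{0}. {\<theta>. \<gamma> / l1norm n powr \<tau> \<le> \<bar>slope \<theta> n\<bar>})"
    unfolding DC_def by blast
  have "continuous_on UNIV (\<lambda>\<theta>. \<bar>slope \<theta> n\<bar>)" for n
    unfolding slope_def by (intro continuous_intros)
  then have "closed (\<Inter>n\<in>-{0}. {\<theta>. \<gamma> / l1norm n powr \<tau> \<le> \<bar>slope \<theta> n\<bar>})"
    by (intro closed_INT ballI closed_Collect_le[OF continuous_on_const])
  then show ?thesis
    unfolding eq by (rule compact_Int_closed[OF compact_Icc])
qed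

lemma DC_slope_axis:
  assumes "\<theta> \<in> DC \<gamma> \<tau>" "l1norm e = 1"
  shows "\<gamma> \<le> \<bar>slope \<theta> e\<bar>"
proof -
  have "e \<noteq> 0" using assms(2) by auto
  from DCD[OF assms(1) this] show ?thesis
    by (simp add: assms(2))
qed

text \<open>On an interval the tangent takes a rational value \<open>a / b\<close>, and there the slope of \<open>(a, -b)\<close>
vanishes.\<close>

lemma interior_DC:
  assumes \<gamma>: "0 < \<gamma>"
  shows "interior (DC \<gamma> \<tau>) = {}"
proof (rule ccontr)
  assume "interior (DC \<gamma> \<tau>) \<noteq> {}"
  then obtain x where "x \<in> interior (DC \<gamma> \<tau>)" by blast
  then obtain e where e: "0 < e" "cball x e \<subseteq> DC \<gamma> \<tau>"
    by (meson mem_interior_cball)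
  define y where "y = x + min e 1"
  have y: "x < y" "y \<le> x + e" "y \<le> x + 1"
    using e by (auto simp: y_def)
  have sub: "{x..y} \<subseteq> DC \<gamma> \<tau>"
    using e(2) y by (auto simp: cball_def dist_real_def)
  have c: "cos t \<noteq> 0" if "t \<in> {x..y}" for t
    using DC_slope_axis[of t \<gamma> \<tau> "(1, 0)"] sub that \<gamma> by (force simp: slope_def l1norm_def)
  have cont: "continuous_on {x..y} tan"
    by (intro continuous_intros c)
  have "tan x \<noteq> tan y"
  proof
    assume "tan x = tan y"
    then have "sin x * cos y = sin y * cos x"
      using c[of x] c[of y] y by (simp add: tan_def field_simps)
    then have "sin (y - x) = 0"
      by (simp add: sin_diff mult.commute)
    moreover have "0 < sin (y - x)"
      using y pi_gt3 by (intro sin_gt_zero) auto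
    ultimately show False by simp
  qed
  then obtain q where q: "q \<in> \<rat>" "min (tan x) (tan y) < q" "q < max (tan x) (tan y)"
    using Rats_dense_in_real[of "min (tan x) (tan y)" "max (tan x) (tan y)"]
    by (metis max_def min_def not_le order_le_less)
  have "\<exists>t. x \<le> t \<and> t \<le> y \<and> tan t = q"
  proof (cases "tan x < tan y")
    case True
    then show ?thesis
      using q y by (intro IVT' cont) auto
  next
    case False
    then show ?thesis
      using q y by (intro IVT2' cont) auto
  qed
  then obtain t where t: "t \<in> {x..y}" "tan t = q" by auto
  obtain a b where ab: "q = real_of_int a / real_of_int b" "b \<noteq> 0"
    using q(1) by (auto elim!: Rats_cases')
  have "slope t (a, - b) = 0"
    using t(2) ab c[OF t(1)] by (simp add: slope_def tan_def field_simps)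
  moreover have "0 < \<gamma> / l1norm (a, - b) powr \<tau>"
    using \<gamma> ab(2) l1norm_ge_1[of "(a, -b)"] by (simp add: zero_prod_def)
  moreover have "(a, - b) \<noteq> (0 :: site)"
    using ab(2) by (simp add: zero_prod_def)
  ultimately show False
    using DCD[of t \<gamma> \<tau> "(a, - b)"] sub t(1) by force
qed

text \<open>Reduces a sum over the lattice to a product of two one-dimensional sums, each with exponent
\<open>(\<tau> + 1) / 2 > 1\<close>.\<close>

lemma lattice_power_bound:
  assumes "1 < \<tau>" "n \<noteq> 0"
  shows "1 / l1norm n powr (\<tau> + 1)
       \<le> (max 1 \<bar>real_of_int (fst n)\<bar>) powr (- ((\<tau> + 1) / 2)) * (max 1 \<bar>real_of_int (snd n)\<bar>) powr (- ((\<tau> + 1) / 2))"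
proof -
  let ?a = "max 1 \<bar>real_of_int (fst n)\<bar>" and ?b = "max 1 \<bar>real_of_int (snd n)\<bar>"
  have n1: "1 \<le> l1norm n" by (rule l1norm_ge_1[OF assms(2)])
  have le: "?a \<le> l1norm n" "?b \<le> l1norm n"
    using n1 by (auto simp: l1norm_def)
  have "?a powr ((\<tau> + 1) / 2) * ?b powr ((\<tau> + 1) / 2)
      \<le> l1norm n powr ((\<tau> + 1) / 2) * l1norm n powr ((\<tau> + 1) / 2)"
    using le assms by (intro mult_mono powr_mono2) auto
  also have "\<dots> = l1norm n powr (\<tau> + 1)"
    by (simp flip: powr_add)
  finally have "1 / l1norm n powr (\<tau> + 1) \<le> 1 / (?a powr ((\<tau> + 1) / 2) * ?b powr ((\<tau> + 1) / 2))"
    using n1 by (intro divide_left_mono) (auto simp: less_max_iff_disj intro!: mult_pos_pos)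
  then show ?thesis
    by (simp only: powr_minus inverse_eq_divide times_divide_times_eq mult_1)
qed

text \<open>The angles violating the condition at \<open>n\<close> have measure \<open>O(\<gamma> / \<bar>n\<bar> powr (\<tau> + 1))\<close>, which is summable over the
lattice for \<open>\<tau> > 1\<close>.\<close>

lemma DC_positive_measure:
  assumes \<tau>: "1 < \<tau>"
  obtains \<gamma>0 where "0 < \<gamma>0" "\<And>\<gamma>. 0 < \<gamma> \<Longrightarrow> \<gamma> < \<gamma>0 \<Longrightarrow> 0 < emeasure lebesgue (DC \<gamma> \<tau>)"
proof -
  define s where "s = (\<tau> + 1) / 2"
  define a where "a i = (max 1 (real i)) powr (- s)" for i
  have a0: "0 < a i" for i
    by (simp add: a_def less_max_iff_disj)
  have "summable (\<lambda>i. real i powr (- s))"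
    using \<tau> by (subst summable_real_powr_iff) (simp add: s_def)
  then have "summable (\<lambda>i. a (Suc i))"
    by (subst (asm) summable_Suc_iff[symmetric]) (simp add: a_def max_def)
  then have sa: "summable a"
    by (simp only: summable_Suc_iff)
  define A where "A = suminf a"
  have A: "0 < A"
    unfolding A_def using sa a0 by (rule suminf_pos)
  \<comment> \<open>Makes the total measure \<open>4000 \<gamma> A\<^sup>2\<close> of the excluded angles at most 1, which is less than \<open>2 * pi\<close>.\<close>
  define \<gamma>0 where "\<gamma>0 = min (1/4) (1 / (4000 * A\<^sup>2))"
  have "0 < emeasure lebesgue (DC \<gamma> \<tau>)" if \<gamma>: "0 < \<gamma>" "\<gamma> < \<gamma>0" for \<gamma>
  proof -
    have "\<exists>B. open B \<and> emeasure lebesgue B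
        \<le> ennreal (1000 * \<gamma> * (a (nat \<bar>fst n\<bar>) * a (nat \<bar>snd n\<bar>))) \<and>
        (n \<noteq> 0 \<longrightarrow> (\<forall>\<theta>\<in>{0..2 * pi}. \<bar>slope \<theta> n\<bar> < \<gamma> / l1norm n powr \<tau> \<longrightarrow> \<theta> \<in> B))" for n
    proof (cases "n = 0")
      case True
      then show ?thesis by (intro exI[of _ "{}"]) auto
    next
      case False
      have n1: "1 \<le> l1norm n" by (rule l1norm_ge_1[OF False])
      define \<delta> where "\<delta> = \<gamma> / l1norm n powr \<tau>"
      have "\<delta> \<le> \<gamma> / 1"
        unfolding \<delta>_def using n1 \<tau> \<gamma> by (intro divide_left_mono ge_one_powr_ge_zero) auto
      moreover have "\<gamma> \<le> 1/4"
        using \<gamma> by (simp add: \<gamma>0_def)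
      ultimately have "\<delta> \<le> 1/4" by linarith
      moreover have "0 < \<delta>"
        using n1 \<gamma> by (simp add: \<delta>_def)
      ultimately have \<delta>: "0 < \<delta>" "\<delta> \<le> 1/4" by auto
      obtain B where B: "open B" "emeasure lebesgue B \<le> ennreal (1000 * \<delta> / l1norm n)"
        "\<And>\<theta>. \<theta> \<in> {0..2 * pi} \<Longrightarrow> cmod (of_real (slope \<theta> n) + (\<lambda>_. 0) \<theta>) < \<delta> \<Longrightarrow> \<theta> \<in> B"
        by (rule sublevel_cover[OF False \<delta>, where S="{0..2 * pi}" and h="\<lambda>_. 0"]) auto
      have "1000 * \<delta> / l1norm n = 1000 * \<gamma> * (1 / l1norm n powr (\<tau> + 1))"
        using n1 by (simp add: \<delta>_def powr_add)
      also have "\<dots> \<le> 1000 * \<gamma> * (a (nat \<bar>fst n\<bar>) * a (nat \<bar>snd n\<bar>))"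
        using lattice_power_bound[OF \<tau> False] \<gamma> by (intro mult_left_mono) (auto simp: a_def s_def)
      finally have "emeasure lebesgue B \<le> ennreal (1000 * \<gamma> * (a (nat \<bar>fst n\<bar>) * a (nat \<bar>snd n\<bar>)))"
        using B(2) by (meson ennreal_leI order_trans)
      with B(1,3) show ?thesis
        unfolding \<delta>_def by (intro exI[of _ B]) auto
    qed
    then obtain B where B: "\<And>n. open (B n)"
      "\<And>n. emeasure lebesgue (B n) \<le> ennreal (1000 * \<gamma> * (a (nat \<bar>fst n\<bar>) * a (nat \<bar>snd n\<bar>)))"
      "\<And>n \<theta>. n \<noteq> 0 \<Longrightarrow> \<theta> \<in> {0..2 * pi} \<Longrightarrow> \<bar>slope \<theta> n\<bar> < \<gamma> / l1norm n powr \<tau> \<Longrightarrow> \<theta> \<in> B n"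
      by metis
    define Q where "Q i j = {int i, - int i} \<times> {int j, - int j}" for i j
    define U where "U i j = (\<Union>n\<in>Q i j. B n)" for i j
    have U_sets [simp]: "U i j \<in> sets lebesgue" for i j
      unfolding U_def using B(1) by (intro sets.finite_UN) (auto simp: Q_def)
    have U: "emeasure lebesgue (U i j) \<le> ennreal (4000 * \<gamma> * a i * a j)" for i j
    proof -
      have "emeasure lebesgue (U i j) \<le> (\<Sum>n\<in>Q i j. emeasure lebesgue (B n))"
        unfolding U_def by (rule emeasure_subadditive_finite) (use B(1) in \<open>auto simp: Q_def\<close>)
      also have "\<dots> \<le> (\<Sum>n\<in>Q i j. ennreal (1000 * \<gamma> * (a i * a j)))"
        by (intro sum_mono order_trans[OF B(2)]) (auto simp: Q_def)
      also have "\<dots> = ennreal (card (Q i j) * (1000 * \<gamma> * (a i * a j)))"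
        using \<gamma> a0[of i] a0[of j] by (simp add: ennreal_mult ennreal_of_nat_eq_real_of_nat less_imp_le)
      also have "\<dots> \<le> ennreal (4000 * \<gamma> * a i * a j)"
      proof (rule ennreal_leI)
        have "card {int i, - int i} \<le> 2" "card {int j, - int j} \<le> 2"
          using card_insert_le_m1[of 2 "{- int i}" "int i"] card_insert_le_m1[of 2 "{- int j}" "int j"] by auto
        then have "card (Q i j) \<le> 2 * 2"
          unfolding Q_def card_cartesian_product by (rule mult_le_mono)
        then have "real (card (Q i j)) * (1000 * \<gamma> * (a i * a j)) \<le> 4 * (1000 * \<gamma> * (a i * a j))"
          using \<gamma> a0[of i] a0[of j] by (intro mult_right_mono) auto
        then show "real (card (Q i j)) * (1000 * \<gamma> * (a i * a j)) \<le> 4000 * \<gamma> * a i * a j"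
          by simp
      qed
      finally show ?thesis .
    qed
    define V where "V = (\<Union>i. \<Union>j. U i j)"
    have "emeasure lebesgue V \<le> (\<Sum>i. emeasure lebesgue (\<Union>j. U i j))"
      unfolding V_def by (rule emeasure_subadditive_countably) auto
    also have "\<dots> \<le> (\<Sum>i. \<Sum>j. ennreal (4000 * \<gamma> * a i * a j))"
      by (intro suminf_le order_trans[OF emeasure_subadditive_countably] U) auto
    also have "\<dots> = (\<Sum>i. ennreal (4000 * \<gamma> * a i * A))"
    proof (intro suminf_cong)
      fix i
      have "(\<lambda>j. 4000 * \<gamma> * a i * a j) sums (4000 * \<gamma> * a i * A)"
        unfolding A_def by (intro sums_mult summable_sums sa)
      then show "(\<Sum>j. ennreal (4000 * \<gamma> * a i * a j)) = ennreal (4000 * \<gamma> * a i * A)"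
        using \<gamma> a0 by (intro suminf_ennreal_eq) (auto intro!: mult_nonneg_nonneg less_imp_le)
    qed
    also have "\<dots> = ennreal (4000 * \<gamma> * A * A)"
    proof -
      have "(\<lambda>i. 4000 * \<gamma> * A * a i) sums (4000 * \<gamma> * A * A)"
        unfolding A_def by (intro sums_mult summable_sums sa)
      then show ?thesis
        using \<gamma> a0 A by (intro suminf_ennreal_eq) (auto intro!: mult_nonneg_nonneg less_imp_le simp: mult_ac)
    qed
    also have "\<dots> \<le> ennreal 1"
    proof (rule ennreal_leI)
      have "\<gamma> \<le> 1 / (4000 * A\<^sup>2)"
        using \<gamma> by (simp add: \<gamma>0_def)
      then show "4000 * \<gamma> * A * A \<le> 1"
        using A by (simp add: field_simps power2_eq_square)
    qed
    finally have V: "emeasure lebesgue V \<le> 1" by simp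
    have cover: "{0..2 * pi} \<subseteq> DC \<gamma> \<tau> \<union> V"
    proof
      fix \<theta> assume \<theta>: "\<theta> \<in> {0..2 * pi}"
      show "\<theta> \<in> DC \<gamma> \<tau> \<union> V"
      proof (cases "\<theta> \<in> DC \<gamma> \<tau>")
        case False
        then obtain n where n: "n \<noteq> 0" "\<bar>slope \<theta> n\<bar> < \<gamma> / l1norm n powr \<tau>"
          using \<theta> unfolding DC_def mem_Collect_eq not_le[symmetric] by blast
        have "n \<in> Q (nat \<bar>fst n\<bar>) (nat \<bar>snd n\<bar>)"
          by (cases n) (auto simp: Q_def)
        then show ?thesis
          using B(3)[OF n(1) \<theta> n(2)] by (auto simp: V_def U_def)
      qed auto
    qed
    have DC_sets: "DC \<gamma> \<tau> \<in> sets lebesgue"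
      using compact_DC[of \<gamma> \<tau>] by (simp add: borel_compact)
    have V_sets: "V \<in> sets lebesgue"
      unfolding V_def by (intro sets.countable_UN) auto
    show ?thesis
    proof (rule ccontr)
      assume "\<not> 0 < emeasure lebesgue (DC \<gamma> \<tau>)"
      then have z: "emeasure lebesgue (DC \<gamma> \<tau>) = 0" by simp
      have "ennreal (2 * pi) = emeasure lebesgue {0..2 * pi}"
        by simp
      also have "\<dots> \<le> emeasure lebesgue (DC \<gamma> \<tau> \<union> V)"
        by (rule emeasure_mono[OF cover sets.Un[OF DC_sets V_sets]])
      also have "\<dots> \<le> emeasure lebesgue (DC \<gamma> \<tau>) + emeasure lebesgue V"
        by (rule emeasure_subadditive[OF DC_sets V_sets])
      also have "\<dots> \<le> ennreal 1"
        using z V by simp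
      finally show False
        using pi_gt3 by (simp add: ennreal_le_iff)
    qed
  qed
  moreover have "0 < \<gamma>0"
    using A by (simp add: \<gamma>0_def)
  ultimately show thesis
    using that by blast
qed

text \<open>Remove all intervals with rational endpoints that meet \<open>K\<close> in a null set. This deletes a null set,
and near each remaining point there is positive measure left, hence another remaining point.\<close>

lemma perfect_core:
  fixes K :: "real set"
  assumes K: "compact K" and pos: "0 < emeasure lebesgue K"
  obtains P where "P \<subseteq> K" "P \<noteq> {}" "compact P" "\<And>x. x \<in> P \<Longrightarrow> x islimpt P"
    "emeasure lebesgue (K - P) = 0"
proof -
  define I where "I = {(p, q). p \<in> \<rat> \<and> q \<in> \<rat> \<and> K \<inter> {p<..<q} \<in> null_sets lebesgue}"
  define U where "U = (\<Union>(p, q)\<in>I. {p<..<q})"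
  have "countable I"
    by (rule countable_subset[where B="\<rat> \<times> \<rat>"]) (auto simp: I_def countable_rat)
  then have "(\<Union>(p, q)\<in>I. K \<inter> {p<..<q}) \<in> null_sets lebesgue"
    by (intro null_sets_UN') (auto simp: I_def)
  moreover have "(\<Union>(p, q)\<in>I. K \<inter> {p<..<q}) = K \<inter> U"
    by (auto simp: U_def)
  ultimately have KU: "K \<inter> U \<in> null_sets lebesgue" by simp
  have "open U"
    by (auto simp: U_def)
  define P where "P = K - U"
  have KP: "K - P = K \<inter> U"
    by (auto simp: P_def)
  have "x islimpt P" if x: "x \<in> P" for x
    unfolding islimpt_def
  proof (intro allI impI)
    fix T assume "x \<in> T" "open T"
    then obtain e where e: "0 < e" "ball x e \<subseteq> T"
      using open_contains_ball by blast
    obtain p where p: "p \<in> \<rat>" "x - e < p" "p < x"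
      using Rats_dense_in_real[of "x - e" x] e by auto
    obtain q where q: "q \<in> \<rat>" "x < q" "q < x + e"
      using Rats_dense_in_real[of x "x + e"] e by auto
    have sub: "{p<..<q} \<subseteq> T"
      using p q e by (force simp: ball_def dist_real_def)
    show "\<exists>y\<in>P. y \<in> T \<and> y \<noteq> x"
    proof (rule ccontr)
      assume "\<not> ?thesis"
      then have "K \<inter> {p<..<q} \<subseteq> {x} \<union> (K \<inter> U)"
        using sub by (auto simp: P_def)
      moreover have "{x} \<union> (K \<inter> U) \<in> null_sets lebesgue"
        using KU by (intro null_sets.Un) (auto simp: null_sets_def)
      moreover have "K \<inter> {p<..<q} \<in> sets lebesgue"
        using K by (simp add: borel_compact sets.Int)
      ultimately have "K \<inter> {p<..<q} \<in> null_sets lebesgue"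
        by (meson null_sets_subset)
      then have "(p, q) \<in> I"
        using p q by (simp add: I_def)
      then show False
        using x p q by (auto simp: P_def U_def)
    qed
  qed
  moreover have "P \<noteq> {}"
  proof
    assume "P = {}"
    then have "emeasure lebesgue K = 0"
      using KU KP by (simp add: null_sets_def)
    with pos show False by simp
  qed
  moreover have "compact P"
    unfolding P_def by (rule compact_diff[OF K \<open>open U\<close>])
  moreover have "emeasure lebesgue (K - P) = 0"
    using KU KP by (simp add: null_sets_def)
  moreover have "P \<subseteq> K" by (auto simp: P_def)
  ultimately show thesis using that by blast
qed

lemma cantor_part_of_DC:
  assumes \<gamma>: "0 < \<gamma>" and B: "open B" "emeasure lebesgue B < emeasure lebesgue (DC \<gamma> \<tau>)"
  obtains P where "cantor_like P" "P \<subseteq> DC \<gamma> \<tau> - B"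
    "emeasure lebesgue (DC \<gamma> \<tau> - P) \<le> emeasure lebesgue B"
proof -
  let ?D = "DC \<gamma> \<tau>"
  have K: "compact (?D - B)"
    by (rule compact_diff[OF compact_DC B(1)])
  have D_sets: "?D \<in> sets lebesgue" "B \<in> sets lebesgue"
    using compact_DC[of \<gamma> \<tau>] B by (simp_all add: borel_compact)
  have "emeasure lebesgue ?D \<le> emeasure lebesgue ((?D - B) \<union> B)"
    using D_sets by (intro emeasure_mono) auto
  also have "\<dots> \<le> emeasure lebesgue (?D - B) + emeasure lebesgue B"
    using D_sets by (intro emeasure_subadditive) auto
  finally have "0 < emeasure lebesgue (?D - B)"
    using B(2) by (metis add.left_neutral gr_zeroI leD)
  from perfect_core[OF K this] obtain P where P: "P \<subseteq> ?D - B" "P \<noteq> {}" "compact P"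
    "\<And>x. x \<in> P \<Longrightarrow> x islimpt P" "emeasure lebesgue (?D - B - P) = 0"
    by metis
  have P_sets: "P \<in> sets lebesgue"
    using P(3) by (simp add: borel_compact)
  have "interior P \<subseteq> interior ?D"
    using P(1) by (intro interior_mono) auto
  then have "cantor_like P"
    unfolding cantor_like_def using P interior_DC[OF \<gamma>, of \<tau>] by auto
  moreover have "emeasure lebesgue (?D - P) \<le> emeasure lebesgue B"
  proof -
    have "emeasure lebesgue (?D - P) \<le> emeasure lebesgue ((?D - B - P) \<union> B)"
      using D_sets P_sets by (intro emeasure_mono) auto
    also have "\<dots> \<le> emeasure lebesgue (?D - B - P) + emeasure lebesgue B"
      using D_sets P_sets by (intro emeasure_subadditive) auto
    finally show ?thesis using P(5) by simp
  qed
  ultimately show thesis using P(1) that by blast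
qed

section \<open>Limits of intertwining relations\<close>

lemma halving_tendsto:
  fixes c :: "nat \<Rightarrow> real"
  assumes "\<And>s. 0 \<le> c s" "\<And>s. c (Suc s) \<le> c s / 2"
  shows "c \<longlonglongrightarrow> 0"
proof -
  have dec: "c s \<le> c 0 * (1/2)^s" for s
  proof (induction s)
    case (Suc s)
    then show ?case using assms(2)[of s] by simp
  qed simp
  have "(\<lambda>s. c 0 * (1/2)^s) \<longlonglongrightarrow> 0"
    by real_asymp
  then show ?thesis
    by (rule tendsto_sandwich[rotated 3]) (use assms dec in auto)
qed

text \<open>All convergence below is faster than geometric, but this weak form keeps the error bound \<open>2 C s\<close>
explicit at every stage, which is needed to separate the limiting eigenvalues.\<close>

lemma halving_limit:
  fixes a :: "nat \<Rightarrow> complex"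
  assumes a: "\<And>s. cmod (a (Suc s) - a s) \<le> C s" and C: "\<And>s. C (Suc s) \<le> C s / 2"
  obtains l where "a \<longlonglongrightarrow> l" "\<And>s. cmod (a s - l) \<le> 2 * C s"
proof -
  have C0: "0 \<le> C s" for s
    by (rule order_trans[OF norm_ge_zero a])
  have le: "cmod (a (s + k) - a s) \<le> 2 * C s - 2 * C (s + k)" for s k
  proof (induction k)
    case (Suc k)
    have "a (s + Suc k) - a s = (a (s + k) - a s) + (a (Suc (s + k)) - a (s + k))"
      by simp
    then have "cmod (a (s + Suc k) - a s) \<le> cmod (a (s + k) - a s) + cmod (a (Suc (s + k)) - a (s + k))"
      by (simp only: norm_triangle_ineq)
    then show ?case
      using Suc a[of "s + k"] C[of "s + k"] by simp
  qed simp
  have le': "cmod (a t - a s) \<le> 2 * C s" if "s \<le> t" for s t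
    using le[of s "t - s"] C0[of t] that by simp
  have C_lim: "C \<longlonglongrightarrow> 0"
    using halving_tendsto[where c=C] C0 C by blast
  have "Cauchy a"
  proof (rule metric_CauchyI)
    fix e :: real assume "0 < e"
    then obtain M where M: "\<And>s. s \<ge> M \<Longrightarrow> norm (C s) < e / 4"
      using LIMSEQ_D[OF C_lim, of "e / 4"] by auto
    have "dist (a s) (a t) < e" if "s \<ge> M" "t \<ge> M" for s t
    proof -
      have "dist (a s) (a t) \<le> dist (a s) (a M) + dist (a t) (a M)"
        by (rule dist_triangle2)
      also have "\<dots> \<le> 2 * C M + 2 * C M"
        using le'[OF that(1)] le'[OF that(2)] by (simp add: dist_norm)
      also have "\<dots> < e"
        using M[of M] by simp
      finally show ?thesis .
    qed
    then show "\<exists>M. \<forall>m\<ge>M. \<forall>n\<ge>M. dist (a m) (a n) < e" by blast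
  qed
  then obtain l where l: "a \<longlonglongrightarrow> l"
    by (auto simp: Cauchy_convergent_iff convergent_def)
  have "cmod (a s - l) \<le> 2 * C s" for s
  proof -
    have "(\<lambda>t. cmod (a t - a s)) \<longlonglongrightarrow> cmod (l - a s)"
      by (intro tendsto_intros l)
    then have "cmod (l - a s) \<le> 2 * C s"
      by (rule LIMSEQ_le_const2) (use le' in blast)
    then show ?thesis
      by (simp add: norm_minus_commute)
  qed
  with l show thesis by (rule that)
qed

lemma has_sum_diff:
  fixes f g :: "'a \<Rightarrow> complex"
  assumes "(f has_sum a) A" "(g has_sum b) A"
  shows "((\<lambda>x. f x - g x) has_sum (a - b)) A"
  using has_sum_add[OF assms(1) has_sum_uminusI[OF assms(2)]] by simp

lemma mat_mult_has_sum:
  assumes "row_bounded unit_weight r A a" "row_bounded unit_weight r B b" "0 \<le> r"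
  shows "((\<lambda>k. A m k * B k n) has_sum (A \<odot> B) m n) UNIV"
  unfolding mat_mult_def using mat_mult_summable[OF assms(1,2,3,3)] by (rule has_sum_infsum)

text \<open>Passing from \<open>V\<close> to \<open>V' = V (1 + X)\<close> in the relation \<open>(D\<^sub>0 + P\<^sub>0) V = V (D + P)\<close>. The matrix \<open>V D\<close> has
unbounded entries, so \<open>(V D) X\<close> is summed by expressing \<open>V D\<close> through the relation itself as a
combination of bounded matrices and of \<open>D\<^sub>0 V\<close>, where \<open>D\<^sub>0\<close> acts on a fixed row as a scalar.\<close>

lemma intertwining_compose:
  assumes V: "row_bounded unit_weight r V v" and X: "row_bounded unit_weight r X x"
    and P: "row_bounded unit_weight r P p" and P': "row_bounded unit_weight r P' p'"
    and P0: "row_bounded unit_weight r P0 p0" and r: "0 \<le> r"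
    and eq: "\<And>m n. d0 m * V m n + (P0 \<odot> V) m n = V m n * d n + (V \<odot> P) m n"
    and step: "kam_intertwined d P X P'"
    and V'_def: "V' = (\<lambda>m n. V m n + (V \<odot> X) m n)"
  shows "d0 m * V' m n + (P0 \<odot> V') m n = V' m n * (d n + P n n) + (V' \<odot> P') m n"
proof -
  have w: "1 \<le> unit_weight m" for m by simp
  have VX: "row_bounded unit_weight r (V \<odot> X) (v * x)"
    by (rule row_bounded_mult[OF V X r w])
  have VP: "row_bounded unit_weight r (V \<odot> P) (v * p)"
    by (rule row_bounded_mult[OF V P r w])
  have P0V: "row_bounded unit_weight r (P0 \<odot> V) (p0 * v)"
    by (rule row_bounded_mult[OF P0 V r w])
  have XP': "row_bounded unit_weight r (X \<odot> P') (x * p')"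
    by (rule row_bounded_mult[OF X P' r w])
  have PX: "row_bounded unit_weight r (P \<odot> X) (p * x)"
    by (rule row_bounded_mult[OF P X r w])
  have diag: "((\<lambda>k. V m k * (if k = n then P n n else 0)) has_sum (V m n * P n n)) UNIV"
    by (rule has_sum_finite_neutralI[where B="{n}"]) auto
  \<comment> \<open>The series \<open>\<Sum>k. V m k * d k * X k n\<close> is evaluated twice: by the step relation for \<open>d k * X k n\<close>,
    and by the relation \<open>eq\<close> for \<open>V m k * d k\<close>.\<close>
  have A: "((\<lambda>k. V m k * (if k = n then P n n else 0) + V m k * X k n * (d n + P n n)
        + V m k * P' k n + V m k * (X \<odot> P') k n - V m k * P k n - V m k * (P \<odot> X) k n)
      has_sum (V m n * P n n + (V \<odot> X) m n * (d n + P n n) + (V \<odot> P') m n + (V \<odot> (X \<odot> P')) m n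
        - (V \<odot> P) m n - (V \<odot> (P \<odot> X)) m n)) UNIV"
    by (intro has_sum_diff has_sum_add has_sum_cmult_left diag
        mat_mult_has_sum[OF V X r] mat_mult_has_sum[OF V P' r] mat_mult_has_sum[OF V XP' r]
        mat_mult_has_sum[OF V P r] mat_mult_has_sum[OF V PX r])
  have B: "((\<lambda>k. d0 m * (V m k * X k n) + (P0 \<odot> V) m k * X k n - (V \<odot> P) m k * X k n)
      has_sum (d0 m * (V \<odot> X) m n + ((P0 \<odot> V) \<odot> X) m n - ((V \<odot> P) \<odot> X) m n)) UNIV"
    by (intro has_sum_diff has_sum_add has_sum_cmult_right 
        mat_mult_has_sum[OF V X r] mat_mult_has_sum[OF P0V X r] mat_mult_has_sum[OF VP X r])
  have "V m k * (if k = n then P n n else 0) + V m k * X k n * (d n + P n n)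
        + V m k * P' k n + V m k * (X \<odot> P') k n - V m k * P k n - V m k * (P \<odot> X) k n
      = d0 m * (V m k * X k n) + (P0 \<odot> V) m k * X k n - (V \<odot> P) m k * X k n" for k
  proof -
    have "d k * X k n = (if k = n then P n n else 0) + X k n * (d n + P n n) + P' k n + (X \<odot> P') k n
        - P k n - (P \<odot> X) k n"
      using step[unfolded kam_intertwined_def, THEN spec, THEN spec, of k n] by (simp add: algebra_simps)
    then have "V m k * ((if k = n then P n n else 0) + X k n * (d n + P n n) + P' k n + (X \<odot> P') k n
        - P k n - (P \<odot> X) k n) = V m k * d k * X k n"
      by (simp add: mult.assoc)
    also have "V m k * d k = d0 m * V m k + (P0 \<odot> V) m k - (V \<odot> P) m k"
      using eq[of m k] by simp
    finally show ?thesis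
      by (simp add: algebra_simps)
  qed
  from has_sum_unique[OF A[unfolded this] B]
  have main: "V m n * P n n + (V \<odot> X) m n * (d n + P n n) + (V \<odot> P') m n + (V \<odot> (X \<odot> P')) m n
        - (V \<odot> P) m n - (V \<odot> (P \<odot> X)) m n
      = d0 m * (V \<odot> X) m n + ((P0 \<odot> V) \<odot> X) m n - ((V \<odot> P) \<odot> X) m n" .
  have "(P0 \<odot> V') m n = (P0 \<odot> V) m n + (P0 \<odot> (V \<odot> X)) m n"
    unfolding V'_def by (rule mat_mult_add_right[OF P0 V VX r])
  moreover have "(V' \<odot> P') m n = (V \<odot> P') m n + ((V \<odot> X) \<odot> P') m n"
    unfolding V'_def by (rule mat_mult_add_left[OF V VX P' r])
  moreover have "(P0 \<odot> V) \<odot> X = P0 \<odot> (V \<odot> X)" "(V \<odot> P) \<odot> X = V \<odot> (P \<odot> X)" "(V \<odot> X) \<odot> P' = V \<odot> (X \<odot> P')"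
    by (rule mat_mult_assoc[OF P0 V X r] mat_mult_assoc[OF V P X r] mat_mult_assoc[OF V X P' r])+
  ultimately show ?thesis
    using main eq[of m n] by (simp add: V'_def algebra_simps)
qed

text \<open>The partial products of the transformations satisfy \<open>(D\<^sub>0 + P\<^sub>0) V\<^sub>s = V\<^sub>s (D\<^sub>s + P\<^sub>s)\<close> at every stage and
form a Cauchy sequence, and \<open>V\<^sub>s P\<^sub>s\<close> tends to zero.\<close>

lemma kam_limit:
  fixes d :: "nat \<Rightarrow> site \<Rightarrow> complex" and P X :: "nat \<Rightarrow> mat"
  assumes r: "0 \<le> r"
    and X: "\<And>s. row_bounded unit_weight r (X s) (z s)"
    and P: "\<And>s. row_bounded unit_weight r (P s) (p s)"
    and z: "\<And>s. z (Suc s) \<le> z s / 2" "z 0 \<le> 1/16"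
    and p: "\<And>s. p (Suc s) \<le> p s / 2"
    and d: "\<And>s m. d (Suc s) m = d s m + P s m m"
    and step: "\<And>s. kam_intertwined (d s) (P s) (X s) (P (Suc s))"
  obtains V D where "row_bounded unit_weight r (\<lambda>m n. V m n - mat_id m n) (1/4)"
    and "\<And>s m. cmod (d s m - D m) \<le> 2 * p s"
    and "\<And>m n. d 0 m * V m n + (P 0 \<odot> V) m n = V m n * D n"
proof -
  have z0: "0 \<le> z s" for s by (rule row_bounded_nonneg[OF X])
  have w: "1 \<le> unit_weight m" for m by simp
  \<comment> \<open>The products \<open>(1 + X 0) (1 + X 1) \<dots> (1 + X (s - 1))\<close>.\<close>
  define V where "V = rec_nat mat_id (\<lambda>s W m n. W m n + (W \<odot> X s) m n)"
  have V_simps: "V 0 = mat_id" "V (Suc s) = (\<lambda>m n. V s m n + (V s \<odot> X s) m n)" for s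
    by (simp_all add: V_def)
  have V_diff: "row_bounded unit_weight r (\<lambda>m n. V s m n - mat_id m n) (4 * z 0 - 4 * z s) \<and>
      row_bounded unit_weight r (V s) 2" for s
  proof (induction s)
    case 0
    show ?case
      by (auto simp: V_simps row_bounded_def intro: row_boundedD[OF row_bounded_mono[OF row_bounded_id], simplified])
  next
    case (Suc s)
    have VX: "row_bounded unit_weight r (V s \<odot> X s) (2 * z s)"
      using row_bounded_mult[OF _ X[of s] r w] Suc by blast
    have "row_bounded unit_weight r (\<lambda>m n. V s m n - mat_id m n + (V s \<odot> X s) m n) (4 * z 0 - 4 * z s + 2 * z s)"
      using Suc VX by (intro row_bounded_add) auto
    then have 1: "row_bounded unit_weight r (\<lambda>m n. V (Suc s) m n - mat_id m n) (4 * z 0 - 4 * z (Suc s))"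
      using z(1)[of s] by (auto simp: V_simps algebra_simps elim!: row_bounded_mono)
    have "row_bounded unit_weight r (\<lambda>m n. mat_id m n + (V (Suc s) m n - mat_id m n)) (1 + (4 * z 0 - 4 * z (Suc s)))"
      by (rule row_bounded_add[OF row_bounded_id 1]) simp
    then have "row_bounded unit_weight r (V (Suc s)) 2"
      using z(2) z0[of "Suc s"] by (auto elim!: row_bounded_mono)
    with 1 show ?case by blast
  qed
  then have Vb: "row_bounded unit_weight r (V s) 2" for s by blast
  have "\<exists>l. (\<lambda>s. V s m n) \<longlonglongrightarrow> l \<and> (\<forall>s. cmod (V s m n - l) \<le> 2 * (2 * z s))" for m n
  proof (rule halving_limit[of "\<lambda>s. V s m n" "\<lambda>s. 2 * z s"])
    show "cmod (V (Suc s) m n - V s m n) \<le> 2 * z s" for s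
      using row_bounded_entry_le[OF row_bounded_mult[OF Vb X r w] r] by (simp add: V_simps)
    show "2 * z (Suc s) \<le> 2 * z s / 2" for s
      using z(1)[of s] by simp
  qed blast
  then obtain W where W: "\<And>m n. (\<lambda>s. V s m n) \<longlonglongrightarrow> W m n"
    "\<And>m n s. cmod (V s m n - W m n) \<le> 2 * (2 * z s)"
    by metis
  have "\<exists>l. (\<lambda>s. d s m) \<longlonglongrightarrow> l \<and> (\<forall>s. cmod (d s m - l) \<le> 2 * p s)" for m
  proof (rule halving_limit[of "\<lambda>s. d s m" p])
    show "cmod (d (Suc s) m - d s m) \<le> p s" for s
      using row_bounded_entry_le[OF P r] by (simp add: d)
  qed (use p in blast)+
  then obtain D where D: "\<And>m. (\<lambda>s. d s m) \<longlonglongrightarrow> D m" "\<And>m s. cmod (d s m - D m) \<le> 2 * p s"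
    by metis
  have "row_bounded unit_weight r (\<lambda>m n. V s m n - mat_id m n) (1/4)" for s
    using V_diff[of s] z(2) z0[of s] by (auto elim!: row_bounded_mono)
  then have Wb: "row_bounded unit_weight r (\<lambda>m n. W m n - mat_id m n) (1/4)"
    by (rule row_bounded_limit[where A="\<lambda>s m n. V s m n - mat_id m n"]) (intro tendsto_intros W)
  have W2: "row_bounded unit_weight r W 2"
    by (rule row_bounded_limit[OF Vb W(1)])
  have eq: "\<And>m n. d 0 m * V s m n + (P 0 \<odot> V s) m n = V s m n * d s n + (V s \<odot> P s) m n" for s
  proof (induction s)
    case 0
    have "d 0 m * mat_id m n = mat_id m n * d 0 n" for m n
      by (simp add: mat_id_def)
    then show ?case by (simp add: V_simps)
  next
    case (Suc s)
    show ?case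
      unfolding d by (rule intertwining_compose[OF Vb X P P P r Suc step V_simps(2)])
  qed
  have "d 0 m * W m n + (P 0 \<odot> W) m n = W m n * D n" for m n
  proof (rule LIMSEQ_unique)
    have "(\<lambda>s. 2 * (2 * z s)) \<longlonglongrightarrow> 0"
      by (rule halving_tendsto) (use z0 z(1) in \<open>auto simp: field_simps\<close>)
    then have "(\<lambda>s. (P 0 \<odot> V s) m n) \<longlonglongrightarrow> (P 0 \<odot> W) m n"
      by (rule mat_mult_tendsto[OF P r W(2) _ row_bounded_entry_le[OF W2 r]])
    then show "(\<lambda>s. d 0 m * V s m n + (P 0 \<odot> V s) m n) \<longlonglongrightarrow> d 0 m * W m n + (P 0 \<odot> W) m n"
      by (intro tendsto_intros W)
    have p0: "0 \<le> p s" for s by (rule row_bounded_nonneg[OF P])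
    have p_lim: "(\<lambda>s. 2 * p s) \<longlonglongrightarrow> 0"
      by (rule halving_tendsto) (use p0 p in \<open>auto simp: field_simps\<close>)
    have "(\<lambda>s. (V s \<odot> P s) m n) \<longlonglongrightarrow> 0"
      by (rule Lim_null_comparison[OF always_eventually[OF allI] p_lim])
         (rule row_bounded_entry_le[OF row_bounded_mult[OF Vb P r w] r])
    then have "(\<lambda>s. V s m n * d s n + (V s \<odot> P s) m n) \<longlonglongrightarrow> W m n * D n + 0"
      by (intro tendsto_intros W D)
    then show "(\<lambda>s. d 0 m * V s m n + (P 0 \<odot> V s) m n) \<longlonglongrightarrow> W m n * D n"
      unfolding eq by simp
  qed
  with Wb D(2) show thesis by (rule that)
qed

section \<open>One step of the iteration\<close>

text \<open>The exponent \<open>\<eta>\<close> controls the cutoff \<open>\<Lambda> powr (1 + \<eta>)\<close> and the loss \<open>\<Lambda> powr (- \<eta>)\<close> of radius; \<open>b\<close> is the rate of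
decay that survives. The assumption on \<open>\<eta>\<close> makes the number of resonant pairs subexponential in \<open>\<Lambda>\<close>.\<close>

locale kam =
  fixes \<gamma> \<tau> \<sigma> \<eta> b :: real
  assumes \<gamma>: "0 < \<gamma>" and \<tau>: "0 < \<tau>" and \<sigma>: "0 < \<sigma>" and \<eta>: "0 < \<eta>"
    and resonance: "(1 + \<eta>) * \<tau> < \<sigma>" and b: "0 \<le> b"
begin

abbreviation w :: "site \<Rightarrow> real" where
  "w \<equiv> log_weight \<sigma>"

lemma w_ge_1: "1 \<le> w m"
  using \<sigma> by (intro log_weight_ge_1) simp

lemma w_nonneg: "0 \<le> w m"
  using w_ge_1[of m] by linarith

definition cutoff :: "real \<Rightarrow> real" where
  "cutoff \<Lambda> = \<Lambda> powr (1 + \<eta>)"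

text \<open>Chosen so that the losses \<open>\<Lambda> powr (- \<eta>)\<close> along \<open>\<Lambda>, 3/2 \<Lambda>, (3/2)\<^sup>2 \<Lambda>, \<dots>\<close> telescope exactly (geometric series),
with limit \<open>b\<close>.\<close>

definition radius :: "real \<Rightarrow> real" where
  "radius \<Lambda> = b + \<Lambda> powr (- \<eta>) / (1 - (3/2) powr (- \<eta>))"

text \<open>The numerical requirements of a step, in order: the threshold \<open>exp (- \<Lambda>/8)\<close> is below the
Diophantine bound at the cutoff; the transformation has size \<open>exp (- \<Lambda>/2)\<close>; the new perturbation
has size \<open>exp (- 3/2 \<Lambda>)\<close>; the discarded angles have measure at most \<open>exp (- \<Lambda>/9)\<close>; the initial
radius is at most \<open>b + 1\<close>.\<close>

definition large :: "real \<Rightarrow> bool" where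
  "large \<Lambda> \<longleftrightarrow> 32 \<le> \<Lambda> \<and>
     exp (- \<Lambda> / 8) \<le> \<gamma> / (2 * cutoff \<Lambda> powr \<tau>) \<and>
     exp (- \<Lambda>) * (1 / exp (- \<Lambda> / 8) + (cutoff \<Lambda> + 1) / (exp (- \<Lambda> / 8))\<^sup>2) \<le> exp (- \<Lambda> / 2) \<and>
     2 * (exp (- \<Lambda>) * exp (- \<Lambda>) + 4 * exp (- \<Lambda>) *
       (exp (- \<Lambda>) * (1 / exp (- \<Lambda> / 8) + (cutoff \<Lambda> + 1) / (exp (- \<Lambda> / 8))\<^sup>2))) \<le> exp (- (3/2 * \<Lambda>)) \<and>
     (2 * exp ((4 * cutoff \<Lambda> powr \<tau> / \<gamma>) powr (1 / \<sigma>)) + 1)\<^sup>2 * (2 * cutoff \<Lambda> + 1)\<^sup>2 * (1000 * exp (- \<Lambda> / 8))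
       \<le> exp (- \<Lambda> / 9) \<and>
     radius \<Lambda> \<le> b + 1"

lemma eventually_large: "eventually large at_top"
proof -
  define p where "p = (1 + \<eta>) * \<tau> / \<sigma>"
  define K where "K = (4 / \<gamma>) powr (1 / \<sigma>)"
  have p: "0 < p" "p < 1"
    using \<tau> \<sigma> \<eta> resonance by (auto simp: p_def field_simps intro!: mult_pos_pos add_pos_pos)
  have K: "0 < K"
    using \<gamma> by (simp add: K_def)
  have q: "0 < 1 - (3/2::real) powr (- \<eta>)"
    using \<eta> by (simp add: powr_less_one)
  have 0: "eventually (\<lambda>L::real. 32 \<le> L) at_top"
    by (rule eventually_ge_at_top)
  have 1: "eventually (\<lambda>L. exp (- L / 8) \<le> \<gamma> / (2 * (L powr (1 + \<eta>)) powr \<tau>)) at_top"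
    using \<gamma> \<tau> \<eta> by real_asymp
  have 2: "eventually (\<lambda>L. exp (- L) * (1 / exp (- L / 8) + (L powr (1 + \<eta>) + 1) / (exp (- L / 8))\<^sup>2) \<le> exp (- L / 2)) at_top"
    using \<eta> by real_asymp
  have 3: "eventually (\<lambda>L. 2 * (exp (- L) * exp (- L) + 4 * exp (- L) *
       (exp (- L) * (1 / exp (- L / 8) + (L powr (1 + \<eta>) + 1) / (exp (- L / 8))\<^sup>2))) \<le> exp (- (3/2 * L))) at_top"
    using \<eta> by real_asymp
  have 4: "eventually (\<lambda>L. (2 * exp (K * L powr p) + 1)\<^sup>2 * (2 * L powr (1 + \<eta>) + 1)\<^sup>2 * (1000 * exp (- L / 8))
       \<le> exp (- L / 9)) at_top"
    using p K \<eta> by real_asymp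
  have 5: "eventually (\<lambda>L. L powr (- \<eta>) / (1 - (3/2) powr (- \<eta>)) \<le> 1) at_top"
  proof -
    have "eventually (\<lambda>L. L powr (- \<eta>) \<le> 1 - (3/2) powr (- \<eta>)) at_top"
      using q \<eta> by real_asymp
    then show ?thesis
      by eventually_elim (use q in \<open>simp add: field_simps\<close>)
  qed
  have eq: "(4 * (L powr (1 + \<eta>)) powr \<tau> / \<gamma>) powr (1 / \<sigma>) = K * L powr p" for L :: real
    using \<gamma> by (simp add: K_def p_def powr_mult powr_divide powr_powr)
  show ?thesis
    using 0 1 2 3 4 5
    by eventually_elim (simp add: large_def cutoff_def radius_def eq)
qed

lemma radius_step:
  assumes "0 < \<Lambda>"
  shows "radius \<Lambda> = radius (3/2 * \<Lambda>) + \<Lambda> powr (- \<eta>)"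
proof -
  have q: "1 - (3/2::real) powr (- \<eta>) \<noteq> 0"
    using \<eta> powr_less_one[of "3/2" "- \<eta>"] by simp
  have "(3/2 * \<Lambda>) powr (- \<eta>) = (3/2) powr (- \<eta>) * \<Lambda> powr (- \<eta>)"
    by (rule powr_mult)
  then show ?thesis
    using q by (simp add: radius_def field_simps)
qed

lemma radius_ge: "b \<le> radius \<Lambda>"
  using \<eta> powr_less_one[of "3/2" "- \<eta>"] by (simp add: radius_def)

text \<open>The bounds on the accumulated corrections \<open>g\<close> contain the slack \<open>2 exp (- \<Lambda>)\<close>, so that they absorb
the diagonal of \<open>P\<close> at each step and never exceed 1/8.\<close>

definition kam_state :: "real \<Rightarrow> real set \<Rightarrow> (real \<Rightarrow> site \<Rightarrow> complex) \<Rightarrow> (real \<Rightarrow> mat) \<Rightarrow> bool" where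
  "kam_state \<Lambda> S g P \<longleftrightarrow> S \<subseteq> DC \<gamma> \<tau> \<and>
     (\<forall>\<theta>\<in>S. \<forall>m. w m * cmod (g \<theta> m) \<le> 1/8 - 2 * exp (- \<Lambda>)) \<and>
     (\<forall>\<theta>\<in>S. \<forall>\<theta>'\<in>S. \<forall>m. cmod (g \<theta> m - g \<theta>' m) \<le> (1/8 - 2 * exp (- \<Lambda>)) * \<bar>\<theta> - \<theta>'\<bar>) \<and>
     lip_bounded w (radius \<Lambda>) S P (exp (- \<Lambda>))"

definition energies :: "real \<Rightarrow> (site \<Rightarrow> complex) \<Rightarrow> site \<Rightarrow> complex" where
  "energies \<theta> g m = of_real (slope \<theta> m) + g m"

text \<open>With divisors at least \<open>exp (- \<Lambda>/8)\<close> the transformation has Lipschitz norm of order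
\<open>N exp (- 3/4 \<Lambda>)\<close>, hence the quadratic terms are of order \<open>N exp (- 7/4 \<Lambda>)\<close>. This leaves a margin of
\<open>exp (- \<Lambda>/4)\<close> below the required size \<open>exp (- 3/2 \<Lambda>)\<close>, against which the power \<open>N\<close> of \<open>\<Lambda>\<close> is
negligible.\<close>

lemma kam_step:
  assumes st: "kam_state \<Lambda> S g P" and large: "large \<Lambda>"
  shows "\<exists>B X P'. open B \<and> emeasure lebesgue B \<le> ennreal (exp (- \<Lambda> / 9)) \<and>
    kam_state (3/2 * \<Lambda>) (S - B) (\<lambda>\<theta> m. g \<theta> m + P \<theta> m m) P' \<and>
    (\<forall>\<theta>\<in>S - B. row_bounded unit_weight b (X \<theta>) (exp (- \<Lambda> / 2)) \<and>
       kam_intertwined (energies \<theta> (g \<theta>)) (P \<theta>) (X \<theta>) (P' \<theta>)) \<and>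
    (\<forall>\<theta>\<in>S - B. \<forall>m n. m \<noteq> n \<longrightarrow> l1norm (m - n) \<le> cutoff \<Lambda> \<longrightarrow>
       exp (- \<Lambda> / 8) \<le> cmod (energies \<theta> (g \<theta>) m - energies \<theta> (g \<theta>) n))"
proof -
  define N where "N = cutoff \<Lambda>"
  define \<delta> where "\<delta> = exp (- \<Lambda> / 8)"
  define \<epsilon> where "\<epsilon> = exp (- \<Lambda>)"
  define x where "x = \<epsilon> * (1 / \<delta> + (N + 1) / \<delta>\<^sup>2)"
  define E where "E = exp ((4 * N powr \<tau> / \<gamma>) powr (1 / \<sigma>))"
  have L32: "32 \<le> \<Lambda>"
    using large by (simp add: large_def)
  have num: "\<delta> \<le> \<gamma> / (2 * N powr \<tau>)" "x \<le> exp (- \<Lambda> / 2)"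
    "2 * (\<epsilon> * \<epsilon> + 4 * \<epsilon> * x) \<le> exp (- (3/2 * \<Lambda>))"
    "(2 * E + 1)\<^sup>2 * (2 * N + 1)\<^sup>2 * (1000 * \<delta>) \<le> exp (- \<Lambda> / 9)"
    using large unfolding large_def N_def \<delta>_def \<epsilon>_def x_def E_def by blast+
  have N1: "1 \<le> N"
    using L32 \<eta> unfolding N_def cutoff_def by (intro ge_one_powr_ge_zero) auto
  have exp_small: "exp (- t) \<le> 1/4" if "3 \<le> t" for t :: real
  proof -
    have "4 \<le> exp t"
      using exp_ge_add_one_self[of t] that by linarith
    then show ?thesis
      by (simp add: exp_minus field_simps)
  qed
  have \<delta>: "0 < \<delta>" "\<delta> \<le> 1/4"
    using exp_small[of "\<Lambda> / 8"] L32 by (simp_all add: \<delta>_def)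
  have \<epsilon>0: "0 < \<epsilon>"
    by (simp add: \<epsilon>_def)
  have x: "x \<le> 1/4"
    using num(2) exp_small[of "\<Lambda> / 2"] L32 by simp
  have \<epsilon>': "exp (- (3/2 * \<Lambda>)) \<le> \<epsilon> / 2"
  proof -
    have "exp (- (3/2 * \<Lambda>)) = \<epsilon> * exp (- (\<Lambda> / 2))"
      by (simp add: \<epsilon>_def flip: exp_add)
    also have "\<dots> \<le> \<epsilon> * (1/2)"
      using exp_small[of "\<Lambda> / 2"] L32 \<epsilon>0 by (intro mult_left_mono) auto
    finally show ?thesis by simp
  qed
  have S: "S \<subseteq> DC \<gamma> \<tau>"
    and g: "\<And>\<theta> m. \<theta> \<in> S \<Longrightarrow> w m * cmod (g \<theta> m) \<le> 1/8 - 2 * \<epsilon>"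
    and lip: "\<And>\<theta> \<theta>' m. \<theta> \<in> S \<Longrightarrow> \<theta>' \<in> S \<Longrightarrow> cmod (g \<theta> m - g \<theta>' m) \<le> (1/8 - 2 * \<epsilon>) * \<bar>\<theta> - \<theta>'\<bar>"
    and P: "lip_bounded w (radius \<Lambda>) S P \<epsilon>"
    using st by (auto simp: kam_state_def \<epsilon>_def)
  have g': "w m * cmod (g \<theta> m) \<le> 1/8" if "\<theta> \<in> S" for \<theta> m
    using g[OF that, of m] \<epsilon>0 by linarith
  have lip': "cmod (g \<theta> m - g \<theta>' m) \<le> 1/8 * \<bar>\<theta> - \<theta>'\<bar>" if "\<theta> \<in> S" "\<theta>' \<in> S" for \<theta> \<theta>' m
    by (rule order_trans[OF lip[OF that] mult_right_mono]) (use \<epsilon>0 in auto)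
  obtain B where B: "open B"
    "emeasure lebesgue B \<le> ennreal ((2 * E + 1)\<^sup>2 * (2 * N + 1)\<^sup>2 * (1000 * \<delta>))"
    and sep: "\<And>\<theta> m n. \<theta> \<in> S - B \<Longrightarrow> m \<noteq> n \<Longrightarrow> l1norm (m - n) \<le> N \<Longrightarrow>
       \<delta> \<le> cmod ((of_real (slope \<theta> m) + g \<theta> m) - (of_real (slope \<theta> n) + g \<theta> n))"
    by (rule kam_separation[where S=S and \<delta>=\<delta> and g=g and \<sigma>=\<sigma> and E=E and N=N and \<gamma>=\<gamma> and \<tau>=\<tau>],
        (assumption | rule S \<gamma> \<tau> \<sigma> N1 \<delta> num(1) g' lip' E_def)+, metis)
  let ?S = "S - B"
  have radii: "0 \<le> radius (3/2 * \<Lambda>)" "radius \<Lambda> = radius (3/2 * \<Lambda>) + \<Lambda> powr (- \<eta>)"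
    using radius_step[of \<Lambda>] radius_ge[of "3/2 * \<Lambda>"] b L32 by auto
  have hN: "\<Lambda> powr (- \<eta>) * N = \<Lambda>"
    using L32 by (simp add: N_def cutoff_def flip: powr_add)
  have P_S: "lip_bounded w (radius \<Lambda>) ?S P \<epsilon>"
    by (rule lip_bounded_weaken[OF P]) (auto simp: w_nonneg)
  have sep': "\<delta> \<le> cmod (energies \<theta> (g \<theta>) m - energies \<theta> (g \<theta>) n)"
    if "\<theta> \<in> ?S" "m \<noteq> n" "l1norm (m - n) \<le> N" for \<theta> m n
    using sep[OF that] by (simp add: energies_def)
  have d_lip: "cmod ((energies \<theta> (g \<theta>) m - energies \<theta> (g \<theta>) n) - (energies \<theta>' (g \<theta>') m - energies \<theta>' (g \<theta>') n))
      \<le> (N + 1) * \<bar>\<theta> - \<theta>'\<bar>"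
    if "\<theta> \<in> ?S" "\<theta>' \<in> ?S" "l1norm (m - n) \<le> N" for \<theta> \<theta>' m n
  proof -
    have eq: "(energies \<theta> (g \<theta>) m - energies \<theta> (g \<theta>) n) - (energies \<theta>' (g \<theta>') m - energies \<theta>' (g \<theta>') n)
        = of_real (slope \<theta> (m - n) - slope \<theta>' (m - n)) + ((g \<theta> m - g \<theta>' m) - (g \<theta> n - g \<theta>' n))"
      by (simp add: energies_def slope_diff)
    have "cmod ((energies \<theta> (g \<theta>) m - energies \<theta> (g \<theta>) n) - (energies \<theta>' (g \<theta>') m - energies \<theta>' (g \<theta>') n))
        \<le> \<bar>slope \<theta> (m - n) - slope \<theta>' (m - n)\<bar> + (cmod (g \<theta> m - g \<theta>' m) + cmod (g \<theta> n - g \<theta>' n))"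
      unfolding eq by (intro order_trans[OF norm_triangle_ineq] add_mono norm_triangle_ineq4) (simp only: norm_of_real)
    also have "\<dots> \<le> N * \<bar>\<theta> - \<theta>'\<bar> + (1/8 * \<bar>\<theta> - \<theta>'\<bar> + 1/8 * \<bar>\<theta> - \<theta>'\<bar>)"
      using that lip'[of \<theta> \<theta>']
      by (intro add_mono order_trans[OF slope_lipschitz] mult_right_mono) auto
    also have "\<dots> \<le> (N + 1) * \<bar>\<theta> - \<theta>'\<bar>"
      by (simp add: algebra_simps)
    finally show ?thesis .
  qed
  have nonneg: "0 \<le> N" "0 \<le> \<Lambda> powr (- \<eta>)" "0 \<le> \<epsilon>" "0 \<le> N + 1"
    using N1 \<epsilon>0 by auto
  obtain X P' where X: "lip_bounded w (radius \<Lambda>) ?S X x"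
    and P': "lip_bounded w (radius (3/2 * \<Lambda>)) ?S P' (2 * (exp (- (\<Lambda> powr (- \<eta>)) * N) * \<epsilon> + 4 * \<epsilon> * x))"
    and inter: "\<And>\<theta>. \<theta> \<in> ?S \<Longrightarrow> kam_intertwined (energies \<theta> (g \<theta>)) (P \<theta>) (X \<theta>) (P' \<theta>)"
    by (rule homological_step[where d="\<lambda>\<theta>. energies \<theta> (g \<theta>)", OF P_S w_ge_1 nonneg(1) radii nonneg(2,3) \<delta>(1) nonneg(4)],
        (assumption | rule sep' d_lip x_def x)+, metis)
  have "exp (- (\<Lambda> powr (- \<eta>)) * N) = \<epsilon>"
    using hN by (simp add: \<epsilon>_def)
  then have P'_small: "lip_bounded w (radius (3/2 * \<Lambda>)) ?S P' (exp (- (3/2 * \<Lambda>)))"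
    using lip_bounded_mono[OF P'] num(3) by simp
  have state: "kam_state (3/2 * \<Lambda>) ?S (\<lambda>\<theta> m. g \<theta> m + P \<theta> m m) P'"
    unfolding kam_state_def
  proof (intro conjI ballI allI P'_small)
    show "?S \<subseteq> DC \<gamma> \<tau>" using S by auto
    have r0: "0 \<le> radius \<Lambda>"
      using radius_ge[of \<Lambda>] b by linarith
    fix \<theta> m assume \<theta>: "\<theta> \<in> ?S"
    have "w m * cmod (g \<theta> m + P \<theta> m m) \<le> w m * cmod (g \<theta> m) + w m * cmod (P \<theta> m m)"
      unfolding distrib_left[symmetric] by (intro mult_left_mono norm_triangle_ineq w_nonneg)
    also have "\<dots> \<le> (1/8 - 2 * \<epsilon>) + \<epsilon>"
      using \<theta> by (intro add_mono g row_bounded_entry_weight[OF lip_boundedD(1)[OF P] r0 w_nonneg]) auto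
    also have "\<dots> \<le> 1/8 - 2 * exp (- (3/2 * \<Lambda>))"
      using \<epsilon>' by linarith
    finally show "w m * cmod (g \<theta> m + P \<theta> m m) \<le> 1/8 - 2 * exp (- (3/2 * \<Lambda>))" .
    fix \<theta>' assume \<theta>': "\<theta>' \<in> ?S"
    have "cmod (P \<theta> m m - P \<theta>' m m) \<le> \<epsilon> * \<bar>\<theta> - \<theta>'\<bar>"
      using row_bounded_entry_le[OF row_bounded_unit[OF lip_boundedD(2)[OF P] w_ge_1] r0, of \<theta> \<theta>' m m] \<theta> \<theta>'
      by simp
    moreover have "cmod ((g \<theta> m + P \<theta> m m) - (g \<theta>' m + P \<theta>' m m))
        \<le> cmod (g \<theta> m - g \<theta>' m) + cmod (P \<theta> m m - P \<theta>' m m)"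
      using norm_triangle_ineq[of "g \<theta> m - g \<theta>' m" "P \<theta> m m - P \<theta>' m m"] by (simp add: algebra_simps)
    moreover have "cmod (g \<theta> m - g \<theta>' m) \<le> (1/8 - 2 * \<epsilon>) * \<bar>\<theta> - \<theta>'\<bar>"
      using \<theta> \<theta>' by (intro lip) auto
    moreover have "(1/8 - 2 * \<epsilon>) * \<bar>\<theta> - \<theta>'\<bar> + \<epsilon> * \<bar>\<theta> - \<theta>'\<bar> \<le> (1/8 - 2 * exp (- (3/2 * \<Lambda>))) * \<bar>\<theta> - \<theta>'\<bar>"
      unfolding distrib_right[symmetric] using \<epsilon>' by (intro mult_right_mono) auto
    ultimately show "cmod ((g \<theta> m + P \<theta> m m) - (g \<theta>' m + P \<theta>' m m)) \<le> (1/8 - 2 * exp (- (3/2 * \<Lambda>))) * \<bar>\<theta> - \<theta>'\<bar>"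
      by linarith
  qed
  have "row_bounded unit_weight b (X \<theta>) (exp (- \<Lambda> / 2))" if "\<theta> \<in> ?S" for \<theta>
    by (rule row_bounded_mono[OF row_bounded_weaken[OF lip_boundedD(1)[OF X that]] num(2)])
       (auto simp: radius_ge w_ge_1 w_nonneg)
  moreover have "emeasure lebesgue B \<le> ennreal (exp (- \<Lambda> / 9))"
    using B(2) num(4) by (meson ennreal_leI order_trans)
  ultimately show ?thesis
    using B(1) state inter sep' unfolding N_def \<delta>_def
    by (intro exI[of _ B] exI[of _ X] exI[of _ P'] conjI ballI allI impI)
qed

end

section \<open>Convergence of the iteration\<close>

lemma exp_three_halves:
  assumes "0 < c" "2 \<le> c * \<Lambda>"
  shows "exp (- c * (3/2 * \<Lambda>)) \<le> exp (- c * \<Lambda>) / (2::real)"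
proof -
  have "2 \<le> exp (c * \<Lambda> / 2)"
    using exp_ge_add_one_self[of "c * \<Lambda> / 2"] assms by linarith
  then have "exp (- (c * \<Lambda> / 2)) \<le> 1/2"
    by (simp add: exp_minus field_simps)
  then have "exp (- c * \<Lambda>) * exp (- (c * \<Lambda> / 2)) \<le> exp (- c * \<Lambda>) * (1/2)"
    by (intro mult_left_mono) auto
  then show ?thesis
    by (simp add: algebra_simps flip: exp_add)
qed

context kam
begin

text \<open>Iterate \<open>kam_step\<close> along \<open>(3/2) ^ s \<cdot> \<Lambda>0\<close> and pass to the limit for each angle that is never
discarded. Limits of distinct diagonal entries stay distinct: once the cutoff exceeds the distance of
their sites they differ by \<open>exp (- \<Lambda>/8)\<close>, whereas all later corrections to both together sum to at most
\<open>4 exp (- \<Lambda>)\<close>.\<close>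

theorem kam_diagonalization:
  assumes large: "\<And>\<Lambda>. \<Lambda>0 \<le> \<Lambda> \<Longrightarrow> large \<Lambda>"
    and P0: "lip_bounded w (b + 1) (DC \<gamma> \<tau>) P0 (exp (- \<Lambda>0))"
  shows "\<exists>B. open B \<and> emeasure lebesgue B \<le> ennreal (2 * exp (- \<Lambda>0 / 9)) \<and>
    (\<forall>\<theta>\<in>DC \<gamma> \<tau> - B. \<exists>V D. row_bounded unit_weight b (\<lambda>m n. V m n - mat_id m n) (1/4) \<and> inj D \<and>
       (\<forall>m n. of_real (slope \<theta> m) * V m n + (P0 \<theta> \<odot> V) m n = V m n * D n))"
proof -
  define L where "L s = (3/2)^s * \<Lambda>0" for s :: nat
  have L_Suc: "L (Suc s) = 3/2 * L s" for s
    by (simp add: L_def)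
  have \<Lambda>0: "32 \<le> \<Lambda>0"
    using large[of \<Lambda>0] by (simp add: large_def)
  have L_ge: "\<Lambda>0 \<le> L s" for s
    using \<Lambda>0 mult_right_mono[of 1 "(3/2)^s" \<Lambda>0] by (simp add: L_def)
  have L32: "32 \<le> L s" for s
    using L_ge[of s] \<Lambda>0 by linarith
  have e_small: "exp (- \<Lambda>0 / 2) \<le> 1/16" "exp (- \<Lambda>0) \<le> 1/16"
  proof -
    have "16 \<le> exp (\<Lambda>0 / 2)"
      using exp_ge_add_one_self[of "\<Lambda>0 / 2"] \<Lambda>0 by linarith
    then have "exp (- (\<Lambda>0 / 2)) \<le> 1/16"
      by (simp add: exp_minus field_simps)
    then show "exp (- \<Lambda>0 / 2) \<le> 1/16" by simp
    moreover have "exp (- \<Lambda>0) \<le> exp (- \<Lambda>0 / 2)"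
      using \<Lambda>0 by simp
    ultimately show "exp (- \<Lambda>0) \<le> 1/16" by linarith
  qed
  \<comment> \<open>A state consists of the surviving angles, the corrections to the energies and the perturbation.\<close>
  define St where "St s x = (kam_state (L s) (fst x) (fst (snd x)) (snd (snd x)) \<and>
      (s = 0 \<longrightarrow> x = (DC \<gamma> \<tau>, \<lambda>_ _. 0, P0)))" for s x
  define Step where "Step s x y B X \<longleftrightarrow> open B \<and> emeasure lebesgue B \<le> ennreal (exp (- L s / 9)) \<and>
      fst y = fst x - B \<and> fst (snd y) = (\<lambda>\<theta> m. fst (snd x) \<theta> m + snd (snd x) \<theta> m m) \<and>
      (\<forall>\<theta>\<in>fst x - B. row_bounded unit_weight b (X \<theta>) (exp (- L s / 2)) \<and>
         kam_intertwined (energies \<theta> (fst (snd x) \<theta>)) (snd (snd x) \<theta>) (X \<theta>) (snd (snd y) \<theta>)) \<and>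
      (\<forall>\<theta>\<in>fst x - B. \<forall>m n. m \<noteq> n \<longrightarrow> l1norm (m - n) \<le> cutoff (L s) \<longrightarrow>
         exp (- L s / 8) \<le> cmod (energies \<theta> (fst (snd x) \<theta>) m - energies \<theta> (fst (snd x) \<theta>) n))"
    for s and x y :: "real set \<times> (real \<Rightarrow> site \<Rightarrow> complex) \<times> (real \<Rightarrow> mat)" and B and X :: "real \<Rightarrow> mat"
  have "\<exists>f. \<forall>s. St s (f s) \<and> (\<exists>B X. Step s (f s) (f (Suc s)) B X)"
  proof (rule dependent_nat_choice)
    have "lip_bounded w (radius \<Lambda>0) (DC \<gamma> \<tau>) P0 (exp (- \<Lambda>0))"
      using large[of \<Lambda>0] by (intro lip_bounded_weaken[OF P0]) (auto simp: large_def w_nonneg)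
    then have "St 0 (DC \<gamma> \<tau>, \<lambda>_ _. 0, P0)"
      using e_small by (auto simp: St_def kam_state_def L_def)
    then show "\<exists>x. St 0 x" by blast
    fix x :: "real set \<times> (real \<Rightarrow> site \<Rightarrow> complex) \<times> (real \<Rightarrow> mat)" and s
    assume "St s x"
    moreover obtain S g P where x: "x = (S, g, P)" by (cases x) auto
    ultimately have st: "kam_state (L s) S g P" by (simp add: St_def)
    obtain B X P' where "open B \<and> emeasure lebesgue B \<le> ennreal (exp (- L s / 9)) \<and>
      kam_state (3/2 * L s) (S - B) (\<lambda>\<theta> m. g \<theta> m + P \<theta> m m) P' \<and>
      (\<forall>\<theta>\<in>S - B. row_bounded unit_weight b (X \<theta>) (exp (- L s / 2)) \<and>
         kam_intertwined (energies \<theta> (g \<theta>)) (P \<theta>) (X \<theta>) (P' \<theta>)) \<and>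
      (\<forall>\<theta>\<in>S - B. \<forall>m n. m \<noteq> n \<longrightarrow> l1norm (m - n) \<le> cutoff (L s) \<longrightarrow>
         exp (- L s / 8) \<le> cmod (energies \<theta> (g \<theta>) m - energies \<theta> (g \<theta>) n))"
      using kam_step[OF st large[OF L_ge]] by (elim exE)
    then have "St (Suc s) (S - B, \<lambda>\<theta> m. g \<theta> m + P \<theta> m m, P')"
      "Step s x (S - B, \<lambda>\<theta> m. g \<theta> m + P \<theta> m m, P') B X"
      unfolding St_def Step_def x fst_conv snd_conv L_Suc by blast+
    then show "\<exists>y. St (Suc s) y \<and> (\<exists>B X. Step s x y B X)" by blast
  qed
  then obtain f where f: "\<And>s. St s (f s)" "\<And>s. \<exists>B X. Step s (f s) (f (Suc s)) B X" by blast
  obtain B X where step: "\<And>s. Step s (f s) (f (Suc s)) (B s) (X s)"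
    using f(2) by metis
  define S g P where "S s = fst (f s)" and "g s = fst (snd (f s))" and "P s = snd (snd (f s))" for s
  have f0: "S 0 = DC \<gamma> \<tau>" "g 0 = (\<lambda>_ _. 0)" "P 0 = P0"
    using f(1)[of 0] by (simp_all add: St_def S_def g_def P_def)
  have st: "kam_state (L s) (S s) (g s) (P s)" for s
    using f(1)[of s] by (simp add: St_def S_def g_def P_def)
  note step' = step[unfolded Step_def, folded S_def g_def P_def]
  note steps = step'[THEN conjunct1] step'[THEN conjunct2, THEN conjunct1]
    step'[THEN conjunct2, THEN conjunct2, THEN conjunct1]
    step'[THEN conjunct2, THEN conjunct2, THEN conjunct2, THEN conjunct1]
    step'[THEN conjunct2, THEN conjunct2, THEN conjunct2, THEN conjunct2, THEN conjunct1]
    step'[THEN conjunct2, THEN conjunct2, THEN conjunct2, THEN conjunct2, THEN conjunct2]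
  have S_Suc: "S (Suc s) = S s - B s" and g_Suc: "g (Suc s) = (\<lambda>\<theta> m. g s \<theta> m + P s \<theta> m m)"
    and B: "open (B s)" "emeasure lebesgue (B s) \<le> ennreal (exp (- L s / 9))"
    and X_inter: "\<forall>\<theta>\<in>S s - B s. row_bounded unit_weight b (X s \<theta>) (exp (- L s / 2)) \<and>
        kam_intertwined (energies \<theta> (g s \<theta>)) (P s \<theta>) (X s \<theta>) (P (Suc s) \<theta>)"
    and sep': "\<forall>\<theta>\<in>S s - B s. \<forall>m n. m \<noteq> n \<longrightarrow> l1norm (m - n) \<le> cutoff (L s) \<longrightarrow>
         exp (- L s / 8) \<le> cmod (energies \<theta> (g s \<theta>) m - energies \<theta> (g s \<theta>) n)" for s
    by (rule steps)+
  have X: "row_bounded unit_weight b (X s \<theta>) (exp (- L s / 2))"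
    and inter: "kam_intertwined (energies \<theta> (g s \<theta>)) (P s \<theta>) (X s \<theta>) (P (Suc s) \<theta>)"
    if "\<theta> \<in> S s - B s" for \<theta> s
    using bspec[OF X_inter that] by blast+
  have sep: "exp (- L s / 8) \<le> cmod (energies \<theta> (g s \<theta>) m - energies \<theta> (g s \<theta>) n)"
    if "\<theta> \<in> S s - B s" "m \<noteq> n" "l1norm (m - n) \<le> cutoff (L s)" for \<theta> m n s
    using bspec[OF sep' that(1)] that(2,3) by blast
  have halving: "exp (- c * L (Suc s)) \<le> exp (- c * L s) / 2" if "1/16 \<le> c" for c s
    unfolding L_Suc using that L32[of s] mult_mono[of "1/16" c 32 "L s"]
    by (intro exp_three_halves) auto
  define U where "U = (\<Union>s. B s)"
  have "emeasure lebesgue U \<le> (\<Sum>s. emeasure lebesgue (B s))"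
    unfolding U_def by (rule emeasure_subadditive_countably) (use B(1) in auto)
  also have "\<dots> \<le> (\<Sum>s. ennreal (exp (- \<Lambda>0 / 9) * (1/2)^s))"
  proof (intro suminf_le order_trans[OF B(2)] ennreal_leI)
    show "exp (- L s / 9) \<le> exp (- \<Lambda>0 / 9) * (1/2)^s" for s
    proof (induction s)
      case (Suc s)
      then show ?case using halving[of "1/9" s] by simp
    qed (simp add: L_def)
  qed auto
  also have "\<dots> = ennreal (exp (- \<Lambda>0 / 9) * 2)"
  proof (rule suminf_ennreal_eq)
    have "(\<lambda>s. (1/2::real)^s) sums 2"
      using geometric_sums[of "1/2::real"] by simp
    then show "(\<lambda>s. exp (- \<Lambda>0 / 9) * (1/2)^s) sums (exp (- \<Lambda>0 / 9) * 2)"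
      by (rule sums_mult)
  qed simp
  finally have U: "emeasure lebesgue U \<le> ennreal (2 * exp (- \<Lambda>0 / 9))"
    by (simp add: mult.commute)
  have main: "\<exists>V D. row_bounded unit_weight b (\<lambda>m n. V m n - mat_id m n) (1/4) \<and> inj D \<and>
       (\<forall>m n. of_real (slope \<theta> m) * V m n + (P0 \<theta> \<odot> V) m n = V m n * D n)"
    if \<theta>: "\<theta> \<in> DC \<gamma> \<tau> - U" for \<theta>
  proof -
    have \<theta>S: "\<theta> \<in> S s" for s
      by (induction s) (use \<theta> in \<open>auto simp: f0 S_Suc U_def\<close>)
    then have \<theta>SB: "\<theta> \<in> S s - B s" for s
      using \<theta> by (auto simp: U_def)
    have Pb: "row_bounded unit_weight b (P s \<theta>) (exp (- L s))" for s
    proof -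
      have "lip_bounded w (radius (L s)) (S s) (P s) (exp (- L s))"
        using st[of s] by (simp add: kam_state_def)
      from lip_boundedD(1)[OF this \<theta>S] show ?thesis
        by (rule row_bounded_weaken) (auto simp: radius_ge w_ge_1 w_nonneg)
    qed
    define d where "d s = energies \<theta> (g s \<theta>)" for s
    obtain V D where V: "row_bounded unit_weight b (\<lambda>m n. V m n - mat_id m n) (1/4)"
      and D: "\<And>s m. cmod (d s m - D m) \<le> 2 * exp (- L s)"
      and eq: "\<And>m n. d 0 m * V m n + (P 0 \<theta> \<odot> V) m n = V m n * D n"
    proof (rule kam_limit[where d=d and P="\<lambda>s. P s \<theta>" and X="\<lambda>s. X s \<theta>" and r=b
          and z="\<lambda>s. exp (- L s / 2)" and p="\<lambda>s. exp (- L s)"])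
      show "exp (- L (Suc s) / 2) \<le> exp (- L s / 2) / 2" "exp (- L (Suc s)) \<le> exp (- L s) / 2" for s
        using halving[of "1/2" s] halving[of 1 s] by simp_all
      show "exp (- L 0 / 2) \<le> 1/16"
        using e_small by (simp add: L_def)
      show "d (Suc s) m = d s m + P s \<theta> m m" for s m
        by (simp add: d_def energies_def g_Suc)
      show "kam_intertwined (d s) (P s \<theta>) (X s \<theta>) (P (Suc s) \<theta>)" for s
        unfolding d_def by (rule inter[OF \<theta>SB])
    qed (use b X[OF \<theta>SB] Pb in \<open>blast+\<close>)
    have "D m \<noteq> D n" if mn: "m \<noteq> n" for m n
    proof
      assume eqD: "D m = D n"
      have "filterlim (\<lambda>s. (3/2::real)^s * \<Lambda>0) at_top sequentially"
        using \<Lambda>0 by real_asymp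
      then have "eventually (\<lambda>s. l1norm (m - n) \<le> L s) sequentially"
        unfolding L_def by (simp add: filterlim_at_top)
      then obtain s where s: "l1norm (m - n) \<le> L s"
        by (auto simp: eventually_sequentially)
      have "L s powr 1 \<le> L s powr (1 + \<eta>)"
        using \<eta> L32[of s] by (intro powr_mono) auto
      then have "l1norm (m - n) \<le> cutoff (L s)"
        using s L32[of s] by (simp add: cutoff_def)
      then have "exp (- L s / 8) \<le> cmod (d s m - d s n)"
        unfolding d_def by (rule sep[OF \<theta>SB mn])
      also have "\<dots> = cmod ((d s m - D m) - (d s n - D n))"
        by (simp add: eqD)
      also have "\<dots> \<le> 2 * exp (- L s) + 2 * exp (- L s)"
        by (intro order_trans[OF norm_triangle_ineq4] add_mono D)
      finally have "exp (- L s / 8) \<le> 4 * exp (- L s)" by simp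
      moreover have "exp (- L s) = exp (- L s / 8) * exp (- (7/8 * L s))"
        by (simp flip: exp_add)
      moreover have "exp (- (7/8 * L s)) \<le> 1/8"
      proof -
        have "8 \<le> exp (7/8 * L s)"
          using exp_ge_add_one_self[of "7/8 * L s"] L32[of s] by linarith
        then show ?thesis
          by (simp add: exp_minus field_simps)
      qed
      ultimately have "exp (- L s / 8) \<le> 4 * (exp (- L s / 8) * (1/8))"
        using mult_left_mono[of "exp (- (7/8 * L s))" "1/8" "exp (- L s / 8)"] by simp
      then show False by simp
    qed
    then have "inj D" by (auto simp: inj_def)
    moreover have "of_real (slope \<theta> m) * V m n + (P0 \<theta> \<odot> V) m n = V m n * D n" for m n
      using eq[of m n] by (simp add: d_def energies_def f0)
    ultimately show ?thesis using V by blast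
  qed
  have "open U"
    using B(1) by (auto simp: U_def)
  then show ?thesis
    by (intro exI[of _ U] conjI ballI U main)
qed

end

section \<open>Square-summable functions and symmetry of the operator\<close>

lemma summable_exp_int: "0 < c \<Longrightarrow> (\<lambda>i::int. exp (- c * \<bar>real_of_int i\<bar>)) summable_on UNIV"
proof -
  assume c: "0 < c"
  let ?f = "\<lambda>i::int. exp (- c * \<bar>real_of_int i\<bar>)"
  have "summable (\<lambda>n. exp (- c) ^ n)"
    using c by (intro summable_geometric) simp
  then have "(\<lambda>n::nat. exp (- c) ^ n) summable_on UNIV"
    by (subst summable_on_UNIV_nonneg_real_iff) auto
  then have nat: "(\<lambda>n::nat. exp (- c * real n)) summable_on UNIV"
    by (simp add: exp_of_nat_mult[symmetric] mult.commute)
  have 1: "?f summable_on range int"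
    by (subst summable_on_reindex) (use nat in \<open>auto simp: o_def\<close>)
  have 2: "?f summable_on range (\<lambda>n. - int n)"
    by (subst summable_on_reindex) (use nat in \<open>auto simp: o_def inj_on_def\<close>)
  have "UNIV = range int \<union> range (\<lambda>n. - int n)"
    by (metis (no_types, lifting) UNIV_eq_I Un_iff int_cases2 rangeI)
  with summable_on_union[OF 1 2] show ?thesis by simp
qed

lemma summable_exp_l1norm:
  assumes c: "0 < c"
  shows "(\<lambda>m. exp (- c * l1norm (m - n))) summable_on UNIV"
proof -
  let ?f = "\<lambda>i::int. exp (- c * \<bar>real_of_int i\<bar>)"
  have "(\<lambda>p. ?f (fst p) * ?f (snd p)) summable_on (UNIV \<times> UNIV)"
  proof (rule summable_on_SigmaI[where g="\<lambda>i. ?f i * (\<Sum>\<^sub>\<infinity>j. ?f j)"])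
    show "((\<lambda>j. ?f (fst (i, j)) * ?f (snd (i, j))) has_sum ?f i * (\<Sum>\<^sub>\<infinity>j. ?f j)) UNIV" for i
      using has_sum_cmult_right[OF has_sum_infsum[OF summable_exp_int[OF c]], of "?f i"] by simp
    show "(\<lambda>i. ?f i * (\<Sum>\<^sub>\<infinity>j. ?f j)) summable_on UNIV"
      by (intro summable_on_cmult_left summable_exp_int c)
  qed simp
  then have "(\<lambda>m. exp (- c * l1norm m)) summable_on UNIV"
    by (simp add: l1norm_def algebra_simps flip: exp_add)
  then have "(\<lambda>m. exp (- c * l1norm m)) summable_on range (\<lambda>m. m - n)"
    by (metis surj_def diff_add_cancel add_diff_cancel_right' )
  then show ?thesis
    by (subst (asm) summable_on_reindex) (auto simp: o_def inj_on_def)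
qed

lemma ell2_prod_summable:
  assumes "u \<in> ell2" "v \<in> ell2"
  shows "(\<lambda>m. cmod (u m) * cmod (v m)) summable_on UNIV"
proof (rule summable_on_comparison_test)
  show "(\<lambda>m. (cmod (u m))\<^sup>2 + (cmod (v m))\<^sup>2) summable_on UNIV"
    using assms by (intro summable_on_add) (auto simp: ell2_def)
  show "cmod (u m) * cmod (v m) \<le> (cmod (u m))\<^sup>2 + (cmod (v m))\<^sup>2" for m
    using sum_squares_bound[of "cmod (u m)" "cmod (v m)"]
      mult_nonneg_nonneg[of "cmod (u m)" "cmod (v m)", OF norm_ge_zero norm_ge_zero]
    unfolding mult.assoc by linarith
qed auto

lemma ell2_inner_summable:
  assumes "u \<in> ell2" "v \<in> ell2"
  shows "(\<lambda>m. u m * cnj (v m)) summable_on UNIV"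
  by (rule abs_summable_summable) (use ell2_prod_summable[OF assms] in \<open>simp add: norm_mult\<close>)

lemma ell2_finite_le:
  assumes "u \<in> ell2" "finite F"
  shows "L2_set (\<lambda>m. cmod (u m)) F \<le> ell2_norm u"
proof -
  have "(\<lambda>m. (cmod (u m))\<^sup>2) summable_on UNIV"
    using assms(1) by (simp only: ell2_def mem_Collect_eq)
  then have "(\<Sum>m\<in>F. (cmod (u m))\<^sup>2) \<le> (\<Sum>\<^sub>\<infinity>m. (cmod (u m))\<^sup>2)"
    by (rule finite_sum_le_infsum) (use assms(2) in simp_all)
  then show ?thesis
    unfolding L2_set_def ell2_norm_def by (rule real_sqrt_le_mono)
qed

lemma ell2_norm_leI:
  assumes "\<And>F. finite F \<Longrightarrow> L2_set (\<lambda>m. cmod (u m)) F \<le> c"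
  shows "u \<in> ell2" "ell2_norm u \<le> c"
proof -
  have c: "0 \<le> c"
    using assms[of "{}"] by simp
  have le: "(\<Sum>m\<in>F. (cmod (u m))\<^sup>2) \<le> c\<^sup>2" if "finite F" for F
  proof -
    have "(L2_set (\<lambda>m. cmod (u m)) F)\<^sup>2 \<le> c\<^sup>2"
      by (intro power_mono assms that L2_set_nonneg)
    then show ?thesis
      by (simp add: L2_set_def sum_nonneg)
  qed
  then show u: "u \<in> ell2"
    unfolding ell2_def mem_Collect_eq
    by (intro nonneg_bdd_above_summable_on bdd_aboveI[of _ "c\<^sup>2"]) auto
  have "(\<Sum>\<^sub>\<infinity>m. (cmod (u m))\<^sup>2) \<le> c\<^sup>2"
    by (rule infsum_le_finite_sums[OF u[unfolded ell2_def mem_Collect_eq] le])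
  then show "ell2_norm u \<le> c"
    unfolding ell2_norm_def using c by (simp add: real_le_lsqrt infsum_nonneg)
qed

lemma ell2_norm_nonneg: "0 \<le> ell2_norm u"
  by (simp add: ell2_norm_def infsum_nonneg)

lemma ell2_add:
  assumes "u \<in> ell2" "v \<in> ell2"
  shows "(\<lambda>m. u m + v m) \<in> ell2" "ell2_norm (\<lambda>m. u m + v m) \<le> ell2_norm u + ell2_norm v"
proof -
  have "L2_set (\<lambda>m. cmod (u m + v m)) F \<le> ell2_norm u + ell2_norm v" if F: "finite F" for F
  proof -
    have "L2_set (\<lambda>m. cmod (u m + v m)) F \<le> L2_set (\<lambda>m. cmod (u m) + cmod (v m)) F"
      by (intro L2_set_mono norm_triangle_ineq) auto
    also have "\<dots> \<le> L2_set (\<lambda>m. cmod (u m)) F + L2_set (\<lambda>m. cmod (v m)) F"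
      by (rule L2_set_triangle_ineq)
    also have "\<dots> \<le> ell2_norm u + ell2_norm v"
      by (intro add_mono ell2_finite_le assms F)
    finally show ?thesis .
  qed
  then show "(\<lambda>m. u m + v m) \<in> ell2" "ell2_norm (\<lambda>m. u m + v m) \<le> ell2_norm u + ell2_norm v"
    using ell2_norm_leI[of "\<lambda>m. u m + v m" "ell2_norm u + ell2_norm v"] by blast+
qed

lemma ell2_scale:
  assumes "u \<in> ell2"
  shows "(\<lambda>m. c * u m) \<in> ell2" "ell2_norm (\<lambda>m. c * u m) = cmod c * ell2_norm u"
  using assms
  by (auto simp: ell2_def ell2_norm_def norm_mult power_mult_distrib infsum_cmult_right' real_sqrt_mult
      intro: summable_on_cmult_right)

lemma ell2_diff:
  assumes "u \<in> ell2" "v \<in> ell2"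
  shows "(\<lambda>m. u m - v m) \<in> ell2"
  using ell2_add(1)[OF assms(1) ell2_scale(1)[OF assms(2), of "-1"]] by simp

lemma ell2_sum:
  assumes "\<And>i. i \<in> F \<Longrightarrow> u i \<in> ell2"
  shows "(\<lambda>m. \<Sum>i\<in>F. u i m) \<in> ell2"
  using assms
proof (induction F rule: infinite_finite_induct)
  case (insert i F)
  then show ?case by (simp add: ell2_add(1))
qed (auto simp: ell2_def)

lemma ell2_dominated:
  assumes "u \<in> ell2" "\<And>m. cmod (v m) \<le> c * cmod (u m)" "0 \<le> c"
  shows "v \<in> ell2" "ell2_norm v \<le> c * ell2_norm u"
proof -
  have "L2_set (\<lambda>m. cmod (v m)) F \<le> c * ell2_norm u" if F: "finite F" for F
  proof -
    have "L2_set (\<lambda>m. cmod (v m)) F \<le> L2_set (\<lambda>m. c * cmod (u m)) F"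
      by (intro L2_set_mono assms) auto
    also have "\<dots> = c * L2_set (\<lambda>m. cmod (u m)) F"
      by (rule L2_set_right_distrib[symmetric]) (rule assms)
    also have "\<dots> \<le> c * ell2_norm u"
      by (intro mult_left_mono ell2_finite_le assms F)
    finally show ?thesis .
  qed
  then show "v \<in> ell2" "ell2_norm v \<le> c * ell2_norm u"
    using ell2_norm_leI[of v "c * ell2_norm u"] by blast+
qed

lemma ell2_shift: "u \<in> ell2 \<Longrightarrow> (\<lambda>m. u (m + p)) \<in> ell2"
  unfolding ell2_def mem_Collect_eq
  using summable_on_reindex_bij_betw[of "\<lambda>m. m + p" UNIV UNIV "\<lambda>m. (cmod (u m))\<^sup>2"]
  by (simp add: bij_plus_right)

lemma ell2_inner_bound:
  assumes "u \<in> ell2" "v \<in> ell2"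
  shows "cmod (ell2_inner u v) \<le> ell2_norm u * ell2_norm v"
proof -
  have s: "(\<lambda>m. cmod (u m * cnj (v m))) summable_on UNIV"
    using ell2_prod_summable[OF assms] by (simp add: norm_mult)
  have "cmod (ell2_inner u v) \<le> (\<Sum>\<^sub>\<infinity>m. cmod (u m * cnj (v m)))"
    unfolding ell2_inner_def by (rule norm_infsum_bound[OF s])
  also have "\<dots> \<le> ell2_norm u * ell2_norm v"
  proof (rule infsum_le_finite_sums[OF s])
    fix F :: "site set" assume F: "finite F"
    have "(\<Sum>m\<in>F. cmod (u m * cnj (v m))) = (\<Sum>m\<in>F. \<bar>cmod (u m)\<bar> * \<bar>cmod (v m)\<bar>)"
      by (simp add: norm_mult)
    also have "\<dots> \<le> L2_set (\<lambda>m. cmod (u m)) F * L2_set (\<lambda>m. cmod (v m)) F"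
      by (rule L2_set_mult_ineq)
    also have "\<dots> \<le> ell2_norm u * ell2_norm v"
      by (intro mult_mono ell2_finite_le assms F ell2_norm_nonneg L2_set_nonneg)
    finally show "(\<Sum>m\<in>F. cmod (u m * cnj (v m))) \<le> ell2_norm u * ell2_norm v" .
  qed
  finally show ?thesis .
qed

lemma ell2_inner_diff_left:
  assumes "u \<in> ell2" "v \<in> ell2" "x \<in> ell2"
  shows "ell2_inner (\<lambda>m. u m - c * v m) x = ell2_inner u x - c * ell2_inner v x"
proof -
  have "((\<lambda>m. u m * cnj (x m) - c * (v m * cnj (x m))) has_sum
      (ell2_inner u x - c * ell2_inner v x)) UNIV"
    unfolding ell2_inner_def
    by (intro has_sum_diff has_sum_cmult_right has_sum_infsum ell2_inner_summable assms)
  then show ?thesis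
    unfolding ell2_inner_def by (simp add: infsumI algebra_simps)
qed

lemma ell2_inner_self:
  assumes "u \<in> ell2"
  shows "ell2_inner u u = of_real ((ell2_norm u)\<^sup>2)"
proof -
  have "ell2_inner u u = (\<Sum>\<^sub>\<infinity>m. of_real ((cmod (u m))\<^sup>2))"
    by (simp add: ell2_inner_def complex_norm_square[symmetric])
  also have "\<dots> = of_real (\<Sum>\<^sub>\<infinity>m. (cmod (u m))\<^sup>2)"
    using assms by (intro infsumI has_sum_of_real has_sum_infsum) (simp add: ell2_def)
  finally show ?thesis
    by (simp add: ell2_norm_def infsum_nonneg)
qed

lemma ell2_norm_zero_imp:
  assumes "u \<in> ell2" "ell2_norm u = 0"
  shows "u = (\<lambda>m. 0)"
proof
  fix m
  show "u m = 0"
    using ell2_finite_le[OF assms(1), of "{m}"] assms(2) by (simp add: L2_set_def)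
qed

definition directions :: "site set" where
  "directions = {(1, 0), (-1, 0), (0, 1), (0, -1)}"

lemma hamiltonian_eq:
  "hamiltonian v \<theta> \<epsilon> u m = (\<Sum>e\<in>directions. u (m + e)) + of_real (slope \<theta> m) * u m + of_real (\<epsilon> * v m) * u m"
proof -
  have "{k. l1norm (k - m) = 1} = (\<lambda>e. m + e) ` directions"
    unfolding neighbours_eq by (cases m) (auto simp: directions_def)
  then have "(\<Sum>k\<in>{k. l1norm (k - m) = 1}. u k) = (\<Sum>e\<in>directions. u (m + e))"
    by (simp add: sum.reindex)
  then show ?thesis
    by (simp add: hamiltonian_def)
qed

lemma sum_directions_uminus: "(\<Sum>e\<in>directions. f (- e)) = (\<Sum>e\<in>directions. f e)"
proof -
  have "uminus ` directions = directions"
    by (auto simp: directions_def)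
  then show ?thesis
    using sum.reindex[of uminus directions f] by (simp add: inj_on_def)
qed

lemma has_sum_finite_sum:
  fixes f :: "'i \<Rightarrow> 'a \<Rightarrow> 'b :: topological_comm_monoid_add"
  assumes "finite F" "\<And>i. i \<in> F \<Longrightarrow> (f i has_sum a i) A"
  shows "((\<lambda>x. \<Sum>i\<in>F. f i x) has_sum (\<Sum>i\<in>F. a i)) A"
  using assms by (induction F rule: finite_induct) (auto intro: has_sum_add)

text \<open>Summation by parts on the lattice: the shifts by \<open>e\<close> and \<open>- e\<close> are adjoint to each other and the diagonal
part is real. The eigenvalue equations express the unbounded diagonal terms through square-summable
ones, so that all sums converge absolutely.\<close>

lemma hamiltonian_symmetric:
  assumes u: "u \<in> ell2" "\<And>m. hamiltonian v \<theta> \<epsilon> u m = E * u m"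
    and x: "x \<in> ell2" "\<And>m. hamiltonian v \<theta> \<epsilon> x m = E' * x m"
  shows "(E - cnj E') * ell2_inner u x = 0"
proof -
  define a where "a e = (\<Sum>\<^sub>\<infinity>m. u (m + e) * cnj (x m))" for e
  have a: "((\<lambda>m. u (m + e) * cnj (x m)) has_sum a e) UNIV" for e
    unfolding a_def by (intro has_sum_infsum ell2_inner_summable ell2_shift u x)
  have a': "((\<lambda>m. u m * cnj (x (m + e))) has_sum a (- e)) UNIV" for e
    using has_sum_reindex_bij_betw[of "\<lambda>m. m + e" UNIV UNIV "\<lambda>m. u (m + - e) * cnj (x m)"] a[of "- e"]
    by (simp add: bij_plus_right)
  have "((\<lambda>m. \<Sum>e\<in>directions. u (m + e) * cnj (x m) - u m * cnj (x (m + e))) has_sum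
      (\<Sum>e\<in>directions. a e - a (- e))) UNIV"
    by (rule has_sum_finite_sum) (auto simp: directions_def intro!: has_sum_diff a a')
  moreover have "(\<Sum>e\<in>directions. a e - a (- e)) = 0"
    by (simp add: sum_subtractf sum_directions_uminus)
  moreover have "(\<Sum>e\<in>directions. u (m + e) * cnj (x m) - u m * cnj (x (m + e)))
      = (E - cnj E') * (u m * cnj (x m))" for m
  proof -
    let ?g = "of_real (slope \<theta> m) + of_real (\<epsilon> * v m) :: complex"
    have 1: "(\<Sum>e\<in>directions. u (m + e)) = (E - ?g) * u m"
      using u(2)[of m] unfolding hamiltonian_eq by (simp add: algebra_simps)
    have "(\<Sum>e\<in>directions. x (m + e)) = (E' - ?g) * x m"
      using x(2)[of m] unfolding hamiltonian_eq by (simp add: algebra_simps)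
    then have "cnj (\<Sum>e\<in>directions. x (m + e)) = cnj ((E' - ?g) * x m)" by simp
    then have 2: "(\<Sum>e\<in>directions. cnj (x (m + e))) = (cnj E' - ?g) * cnj (x m)" by simp
    show ?thesis
      unfolding sum_subtractf sum_distrib_left[symmetric] sum_distrib_right[symmetric] 1 2
      by (simp add: algebra_simps)
  qed
  ultimately have "((\<lambda>m. (E - cnj E') * (u m * cnj (x m))) has_sum 0) UNIV" by simp
  moreover have "((\<lambda>m. (E - cnj E') * (u m * cnj (x m))) has_sum (E - cnj E') * ell2_inner u x) UNIV"
    unfolding ell2_inner_def by (intro has_sum_cmult_right has_sum_infsum ell2_inner_summable u x)
  ultimately show ?thesis
    by (rule has_sum_unique[symmetric])
qed

section \<open>Eigenbases from diagonalising matrices\<close>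

lemma exp_decay_ell2:
  assumes "0 < c"
  shows "(\<lambda>m. of_real (exp (- c * l1norm (m - n))) :: complex) \<in> ell2"
proof -
  have "(exp (- c * l1norm (m - n)))\<^sup>2 = exp (- (2 * c) * l1norm (m - n))" for m
    by (simp flip: exp_double)
  then show ?thesis
    unfolding ell2_def using summable_exp_l1norm[of "2 * c" n] assms by simp
qed

lemma abs_slope_le: "\<bar>slope \<theta> m\<bar> \<le> l1norm m"
proof -
  have "\<bar>real_of_int (fst m) * cos \<theta>\<bar> \<le> \<bar>real_of_int (fst m)\<bar> * 1"
    "\<bar>real_of_int (snd m) * sin \<theta>\<bar> \<le> \<bar>real_of_int (snd m)\<bar> * 1"
    unfolding abs_mult by (intro mult_left_mono abs_cos_le_one abs_sin_le_one abs_ge_zero)+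
  then show ?thesis
    unfolding slope_def l1norm_def by linarith
qed

lemma ell2_inner_cnj: "ell2_inner u x = cnj (ell2_inner x u)"
proof -
  have "ell2_inner u x = (\<Sum>\<^sub>\<infinity>m. cnj (x m * cnj (u m)))"
    unfolding ell2_inner_def by (simp add: mult.commute)
  then show ?thesis
    unfolding ell2_inner_def by (simp only: infsum_cnj)
qed

lemma ell2_inner_sum_left:
  assumes "finite F" "\<And>i. i \<in> F \<Longrightarrow> f i \<in> ell2" "x \<in> ell2"
  shows "ell2_inner (\<lambda>m. \<Sum>i\<in>F. c i * f i m) x = (\<Sum>i\<in>F. c i * ell2_inner (f i) x)"
proof -
  have "((\<lambda>m. \<Sum>i\<in>F. c i * (f i m * cnj (x m))) has_sum (\<Sum>i\<in>F. c i * ell2_inner (f i) x)) UNIV"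
    unfolding ell2_inner_def
    by (intro has_sum_finite_sum has_sum_cmult_right has_sum_infsum ell2_inner_summable assms)
  then show ?thesis
    unfolding ell2_inner_def by (simp add: infsumI sum_distrib_right mult.assoc)
qed

lemma infsum_Compl:
  fixes f :: "'a \<Rightarrow> 'b :: banach"
  assumes "f summable_on UNIV" "finite F"
  shows "f summable_on (- F)" "infsum f UNIV = sum f F + infsum f (- F)"
proof -
  show s: "f summable_on (- F)"
    by (rule summable_on_subset_banach[OF assms(1)]) simp
  have "infsum f (F \<union> - F) = infsum f F + infsum f (- F)"
    by (rule infsum_Un_disjoint) (use assms s in auto)
  then show "infsum f UNIV = sum f F + infsum f (- F)"
    using assms(2) by simp
qed

lemma small_tail:
  fixes f :: "'a \<Rightarrow> real"
  assumes "f summable_on UNIV" "0 < e"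
  obtains F where "finite F" "infsum f (- F) < e"
proof -
  obtain F where F: "finite F" "dist (sum f F) (infsum f UNIV) \<le> e / 2"
    using infsum_finite_approximation[OF assms(1), of "e / 2"] assms(2) by auto
  have "infsum f (- F) \<le> e / 2"
    using infsum_Compl(2)[OF assms(1) F(1)] F(2) by (simp add: dist_real_def)
  then show thesis
    using assms(2) F(1) by (intro that[of F]) auto
qed

text \<open>The density condition in \<open>orthonormal_basis\<close>, for a single vector.\<close>

definition in_closed_span :: "('i \<Rightarrow> site \<Rightarrow> complex) \<Rightarrow> (site \<Rightarrow> complex) \<Rightarrow> bool" where
  "in_closed_span \<psi> u \<longleftrightarrow> u \<in> ell2 \<and>
     (\<forall>e>0. \<exists>F c. finite F \<and> ell2_norm (\<lambda>m. u m - (\<Sum>i\<in>F. c i * \<psi> i m)) < e)"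

lemma in_closed_span_add:
  fixes \<psi> :: "'i \<Rightarrow> site \<Rightarrow> complex"
  assumes \<psi>: "\<And>i. \<psi> i \<in> ell2" and u: "in_closed_span \<psi> u" and x: "in_closed_span \<psi> x"
  shows "in_closed_span \<psi> (\<lambda>m. u m + x m)"
  unfolding in_closed_span_def
proof (intro conjI allI impI)
  have ux: "u \<in> ell2" "x \<in> ell2"
    using u x by (auto simp: in_closed_span_def)
  then show "(\<lambda>m. u m + x m) \<in> ell2" by (rule ell2_add(1))
  fix e :: real assume "0 < e"
  then have e2: "0 < e / 2" by simp
  obtain F c where F: "finite F" "ell2_norm (\<lambda>m. u m - (\<Sum>i\<in>F. c i * \<psi> i m)) < e / 2"
    using u e2 unfolding in_closed_span_def by blast
  obtain G d where G: "finite G" "ell2_norm (\<lambda>m. x m - (\<Sum>i\<in>G. d i * \<psi> i m)) < e / 2"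
    using x e2 unfolding in_closed_span_def by blast
  define h where "h i = (if i \<in> F then c i else 0) + (if i \<in> G then d i else 0)" for i
  have "(\<Sum>i\<in>F \<union> G. h i * \<psi> i m) = (\<Sum>i\<in>F. c i * \<psi> i m) + (\<Sum>i\<in>G. d i * \<psi> i m)" for m
  proof -
    have "(\<Sum>i\<in>F \<union> G. h i * \<psi> i m)
        = (\<Sum>i\<in>F \<union> G. if i \<in> F then c i * \<psi> i m else 0) + (\<Sum>i\<in>F \<union> G. if i \<in> G then d i * \<psi> i m else 0)"
      unfolding sum.distrib[symmetric] by (intro sum.cong) (auto simp: h_def algebra_simps)
    also have "\<dots> = (\<Sum>i\<in>(F \<union> G) \<inter> F. c i * \<psi> i m) + (\<Sum>i\<in>(F \<union> G) \<inter> G. d i * \<psi> i m)"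
      by (simp only: sum.inter_restrict[OF finite_UnI[OF F(1) G(1)]])
    also have "(F \<union> G) \<inter> F = F" by auto
    also have "(F \<union> G) \<inter> G = G" by auto
    finally show ?thesis .
  qed
  then have eq: "(\<lambda>m. u m + x m - (\<Sum>i\<in>F \<union> G. h i * \<psi> i m))
      = (\<lambda>m. (u m - (\<Sum>i\<in>F. c i * \<psi> i m)) + (x m - (\<Sum>i\<in>G. d i * \<psi> i m)))"
    by (simp add: algebra_simps)
  have "ell2_norm (\<lambda>m. u m + x m - (\<Sum>i\<in>F \<union> G. h i * \<psi> i m)) < e"
    unfolding eq
    by (rule order_le_less_trans[OF ell2_add(2)])
       (use F G in \<open>auto intro!: ell2_diff ell2_sum ell2_scale(1) ux \<psi>\<close>)
  then show "\<exists>F c. finite F \<and> ell2_norm (\<lambda>m. u m + x m - (\<Sum>i\<in>F. c i * \<psi> i m)) < e"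
    using F(1) G(1) by (intro exI[of _ "F \<union> G"] exI[of _ h]) simp
qed

lemma in_closed_span_scale:
  assumes u: "in_closed_span \<psi> u"
  shows "in_closed_span \<psi> (\<lambda>m. a * u m)"
  unfolding in_closed_span_def
proof (intro conjI allI impI)
  show "(\<lambda>m. a * u m) \<in> ell2"
    using u unfolding in_closed_span_def by (intro ell2_scale(1)) simp
  fix e :: real assume e: "0 < e"
  have pos: "0 < cmod a + 1" by (simp add: add_nonneg_pos)
  then have "0 < e / (cmod a + 1)"
    using e by simp
  then obtain F c where F: "finite F" "ell2_norm (\<lambda>m. u m - (\<Sum>i\<in>F. c i * \<psi> i m)) < e / (cmod a + 1)"
    using u unfolding in_closed_span_def by blast
  let ?d = "\<lambda>m. u m - (\<Sum>i\<in>F. c i * \<psi> i m)"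
  have eq: "(\<lambda>m. a * u m - (\<Sum>i\<in>F. (a * c i) * \<psi> i m)) = (\<lambda>m. a * ?d m)"
    by (simp add: algebra_simps sum_distrib_left)
  have "ell2_norm (\<lambda>m. a * ?d m) = cmod a * ell2_norm ?d"
    by (simp add: ell2_norm_def norm_mult power_mult_distrib infsum_cmult_right' real_sqrt_mult)
  also have "\<dots> \<le> (cmod a + 1) * ell2_norm ?d"
    by (intro mult_right_mono ell2_norm_nonneg) simp
  also have "\<dots> < e"
    using F(2) pos by (simp add: field_simps)
  finally show "\<exists>F c. finite F \<and> ell2_norm (\<lambda>m. a * u m - (\<Sum>i\<in>F. c i * \<psi> i m)) < e"
    unfolding eq[symmetric] by (intro exI[of _ F] exI[of _ "\<lambda>i. a * c i"] conjI F(1))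
qed

lemma in_closed_span_sum:
  assumes \<psi>: "\<And>i. \<psi> i \<in> ell2" and "finite G" "\<And>k. k \<in> G \<Longrightarrow> in_closed_span \<psi> (f k)"
  shows "in_closed_span \<psi> (\<lambda>m. \<Sum>k\<in>G. a k * f k m)"
  using assms(2,3)
proof (induction G rule: finite_induct)
  case empty
  show ?case
    unfolding in_closed_span_def
    by (auto simp: ell2_def ell2_norm_def intro!: exI[of _ "{}"])
next
  case (insert k G)
  then show ?case
    using in_closed_span_add[OF \<psi> in_closed_span_scale[of \<psi> "f k" "a k"]] by simp
qed

lemma in_closed_span_of_unit_vectors:
  assumes \<psi>: "\<And>i. \<psi> i \<in> ell2" and unit: "\<And>k. in_closed_span \<psi> (\<lambda>m. mat_id m k)" and u: "u \<in> ell2"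
  shows "in_closed_span \<psi> u"
  unfolding in_closed_span_def
proof (intro conjI u allI impI)
  fix e :: real assume e: "0 < e"
  have su: "(\<lambda>m. (cmod (u m))\<^sup>2) summable_on UNIV"
    using u by (simp add: ell2_def)
  obtain G where G: "finite G" "infsum (\<lambda>m. (cmod (u m))\<^sup>2) (- G) < (e / 2)\<^sup>2"
    using small_tail[OF su, of "(e / 2)\<^sup>2"] e by auto
  define t where "t m = (\<Sum>k\<in>G. u k * mat_id m k)" for m
  have t: "t m = (if m \<in> G then u m else 0)" for m
  proof -
    have "t m = (\<Sum>k\<in>G. if m = k then u k else 0)"
      unfolding t_def by (intro sum.cong) (auto simp: mat_id_def)
    then show ?thesis
      using G(1) by (simp add: sum.delta)
  qed
  have t_span: "in_closed_span \<psi> t"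
    unfolding t_def by (rule in_closed_span_sum[OF \<psi> G(1) unit])
  then have t2: "t \<in> ell2" by (simp add: in_closed_span_def)
  have "(\<Sum>\<^sub>\<infinity>m. (cmod (u m - t m))\<^sup>2) = infsum (\<lambda>m. (cmod (u m))\<^sup>2) (- G)"
    by (rule infsum_cong_neutral) (auto simp: t)
  then have "ell2_norm (\<lambda>m. u m - t m) < sqrt ((e / 2)\<^sup>2)"
    unfolding ell2_norm_def using G(2) by (simp only: real_sqrt_less_iff)
  then have 1: "ell2_norm (\<lambda>m. u m - t m) < e / 2"
    using e by simp
  obtain F c where F: "finite F" "ell2_norm (\<lambda>m. t m - (\<Sum>i\<in>F. c i * \<psi> i m)) < e / 2"
    using t_span e unfolding in_closed_span_def by (meson half_gt_zero)
  have "ell2_norm (\<lambda>m. (u m - t m) + (t m - (\<Sum>i\<in>F. c i * \<psi> i m))) < e"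
    by (rule order_le_less_trans[OF ell2_add(2)])
       (use 1 F in \<open>auto intro!: ell2_diff ell2_sum ell2_scale(1) u t2 \<psi>\<close>)
  then show "\<exists>F c. finite F \<and> ell2_norm (\<lambda>m. u m - (\<Sum>i\<in>F. c i * \<psi> i m)) < e"
    using F(1) by (auto simp: algebra_simps)
qed

text \<open>The identity \<open>T S = 1\<close> expands a unit vector in the columns of \<open>T\<close>. Splitting the decay rate,
\<open>b (\<bar>m - n\<bar> + \<bar>n - k\<bar>) \<ge> b/2 \<bar>m - k\<bar> + b/2 \<bar>n - k\<bar>\<close>, bounds the remainder in the norm of \<open>ell2\<close> by a tail of a
convergent series.\<close>

lemma unit_vector_in_closed_span:
  assumes b: "0 < b" and T: "row_bounded unit_weight b T C" and S: "row_bounded unit_weight b S s"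
    and TS: "T \<odot> S = mat_id" and \<psi>: "\<And>m n. T m n = N n * \<psi> n m"
  shows "in_closed_span \<psi> (\<lambda>m. mat_id m k)"
  unfolding in_closed_span_def
proof (intro conjI allI impI)
  have C: "0 \<le> C" "0 \<le> s"
    by (rule row_bounded_nonneg[OF T] row_bounded_nonneg[OF S])+
  define h where "h n = exp (- (b/2) * l1norm (n - k))" for n
  have b2: "0 < b / 2" using b by simp
  have hs: "h summable_on UNIV"
    unfolding h_def by (rule summable_exp_l1norm[OF b2])
  have h2: "(\<lambda>m. of_real (h m) :: complex) \<in> ell2"
    unfolding h_def by (rule exp_decay_ell2[OF b2])
  have h1: "h k = 1" "0 \<le> h m" for m
    by (simp_all add: h_def)
  show "(\<lambda>m. mat_id m k) \<in> ell2"
    by (rule ell2_dominated(1)[OF h2, of _ 1]) (auto simp: mat_id_def h1)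
  fix e :: real assume e: "0 < e"
  define K where "K = C * s * ell2_norm (\<lambda>m. of_real (h m) :: complex) + 1"
  have K: "0 < K"
    unfolding K_def using C ell2_norm_nonneg by (simp add: add_nonneg_pos)
  obtain F where F: "finite F" "infsum h (- F) < e / K"
    using small_tail[OF hs, of "e / K"] e K by auto
  define t where "t = infsum h (- F)"
  have t0: "0 \<le> t"
    unfolding t_def by (intro infsum_nonneg h1)
  have hF: "h summable_on (- F)"
    by (rule infsum_Compl(1)[OF hs F(1)])
  have R: "cmod (mat_id m k - (\<Sum>n\<in>F. (N n * S n k) * \<psi> n m)) \<le> C * s * t * cmod (of_real (h m))" for m
  proof -
    let ?f = "\<lambda>n. T m n * S n k"
    have b0: "0 \<le> b" using b by simp
    have f: "?f summable_on UNIV"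
      by (rule mat_mult_summable[OF T S b0 b0])
    have bound: "cmod (?f n) \<le> C * s * h m * h n" for n
    proof -
      have "cmod (?f n) \<le> (C * exp (- b * l1norm (m - n))) * (s * exp (- b * l1norm (n - k)))"
        unfolding norm_mult
        by (intro mult_mono row_bounded_entry_exp[OF T] row_bounded_entry_exp[OF S])
           (auto simp: C)
      also have "\<dots> = C * s * exp (- b * l1norm (m - n) - b * l1norm (n - k))"
        by (simp add: exp_diff exp_minus field_simps)
      also have "\<dots> \<le> C * s * exp (- (b/2) * l1norm (m - k) - (b/2) * l1norm (n - k))"
      proof -
        have "(b/2) * l1norm (m - k) \<le> (b/2) * (l1norm (m - n) + l1norm (n - k))"
          using b by (intro mult_left_mono l1norm_triangle) simp
        moreover have "0 \<le> b * l1norm (m - n)" using b by simp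
        ultimately have "- b * l1norm (m - n) - b * l1norm (n - k)
            \<le> - (b/2) * l1norm (m - k) - (b/2) * l1norm (n - k)"
          unfolding distrib_left by simp
        then show ?thesis
          using C by (intro mult_left_mono) auto
      qed
      also have "\<dots> = C * s * h m * h n"
        by (simp add: h_def algebra_simps flip: exp_add)
      finally show ?thesis .
    qed
    have "(\<Sum>n\<in>F. (N n * S n k) * \<psi> n m) = sum ?f F"
      by (simp add: \<psi> mult_ac)
    moreover have "mat_id m k = infsum ?f UNIV"
      using fun_cong[OF fun_cong[OF TS, of m], of k] by (simp add: mat_mult_def)
    ultimately have "mat_id m k - (\<Sum>n\<in>F. (N n * S n k) * \<psi> n m) = infsum ?f (- F)"
      using infsum_Compl(2)[OF f F(1)] by simp
    also have "cmod \<dots> \<le> infsum (\<lambda>n. C * s * h m * h n) (- F)"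
    proof (rule order_trans[OF norm_infsum_bound])
      show fs: "(\<lambda>n. cmod (?f n)) summable_on (- F)"
        by (rule summable_on_comparison_test[OF summable_on_cmult_right[OF hF, of "C * s * h m"]])
           (use bound in auto)
      show "(\<Sum>\<^sub>\<infinity>n\<in>- F. cmod (?f n)) \<le> infsum (\<lambda>n. C * s * h m * h n) (- F)"
        by (rule infsum_mono[OF fs summable_on_cmult_right[OF hF]]) (rule bound)
    qed
    also have "\<dots> = C * s * t * cmod (of_real (h m))"
      unfolding infsum_cmult_right' t_def[symmetric] by (simp add: h1)
    finally show ?thesis .
  qed
  have "ell2_norm (\<lambda>m. mat_id m k - (\<Sum>n\<in>F. (N n * S n k) * \<psi> n m))
      \<le> C * s * t * ell2_norm (\<lambda>m. of_real (h m) :: complex)"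
    by (rule ell2_dominated(2)[OF h2 R]) (use C t0 in simp)
  also have "\<dots> \<le> t * K"
    using t0 by (simp add: K_def algebra_simps)
  also have "\<dots> < e"
    using F(2) K by (simp add: t_def field_simps)
  finally show "\<exists>F c. finite F \<and> ell2_norm (\<lambda>m. mat_id m k - (\<Sum>i\<in>F. c i * \<psi> i m)) < e"
    by (intro exI[of _ F] exI[of _ "\<lambda>n. N n * S n k"] conjI F(1))
qed

lemma orthogonal_to_span_zero:
  assumes \<psi>: "\<And>i. \<psi> i \<in> ell2" and x: "in_closed_span \<psi> x" and orth: "\<And>i. ell2_inner x (\<psi> i) = 0"
  shows "x = (\<lambda>m. 0)"
proof -
  have x2: "x \<in> ell2"
    using x by (simp add: in_closed_span_def)
  have "ell2_norm x \<le> 0 + e" if e: "0 < e" for e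
  proof (cases "ell2_norm x = 0")
    case False
    then have pos: "0 < ell2_norm x"
      using ell2_norm_nonneg[of x] by simp
    obtain F c where F: "finite F" "ell2_norm (\<lambda>m. x m - (\<Sum>i\<in>F. c i * \<psi> i m)) < e"
      using x e unfolding in_closed_span_def by blast
    let ?y = "\<lambda>m. \<Sum>i\<in>F. c i * \<psi> i m"
    have y2: "?y \<in> ell2"
      by (intro ell2_sum ell2_scale(1) \<psi>)
    have "ell2_inner ?y x = 0"
      using ell2_inner_sum_left[OF F(1) \<psi> x2, of c] orth ell2_inner_cnj[of "\<psi> _" x] by simp
    then have "ell2_inner (\<lambda>m. x m - ?y m) x = of_real ((ell2_norm x)\<^sup>2)"
      using ell2_inner_diff_left[OF x2 y2 x2, of 1] ell2_inner_self[OF x2] by simp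
    then have "(ell2_norm x)\<^sup>2 = cmod (ell2_inner (\<lambda>m. x m - ?y m) x)"
      by (simp del: of_real_power)
    also have "\<dots> \<le> ell2_norm (\<lambda>m. x m - ?y m) * ell2_norm x"
      by (intro ell2_inner_bound ell2_diff x2 y2)
    also have "\<dots> \<le> e * ell2_norm x"
      using F(2) by (intro mult_right_mono ell2_norm_nonneg) simp
    finally show ?thesis
      using pos by (simp add: power2_eq_square)
  qed (use e in simp)
  then have "ell2_norm x \<le> 0"
    by (rule field_le_epsilon)
  then show ?thesis
    using ell2_norm_zero_imp[OF x2] ell2_norm_nonneg[of x] by simp
qed

text \<open>Normalised columns of \<open>T\<close> form the basis. Symmetry and distinct eigenvalues give orthogonality, the
right inverse \<open>S\<close> gives completeness, and \<open>A\<close> bounds the norms of the columns from below, uniformly in the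
column. An eigenvector is orthogonal to all basis vectors but the one with the same eigenvalue, which
makes every eigenvalue simple.\<close>

theorem localized_eigenbasis:
  fixes T S A :: mat and D :: "site \<Rightarrow> complex"
  assumes b: "0 < b" and T: "row_bounded unit_weight b T C" and S: "row_bounded unit_weight b S s"
    and A: "row_bounded unit_weight b A a"
    and TS: "T \<odot> S = mat_id" and AT: "\<And>n. 1/2 \<le> cmod ((A \<odot> T) n n)"
    and eig: "\<And>m n. hamiltonian v \<theta> \<epsilon> (\<lambda>k. T k n) m = D n * T m n" and inj: "inj D"
  shows "pure_point_spectrum v \<theta> \<epsilon>"
    and "\<And>E. eigenvalue v \<theta> \<epsilon> E \<Longrightarrow> simple_eigenvalue v \<theta> \<epsilon> E"
    and "\<exists>\<psi> :: site \<Rightarrow> site \<Rightarrow> complex. orthonormal_basis UNIV \<psi> \<and> (\<forall>n. eigenvector v \<theta> \<epsilon> (\<psi> n)) \<and>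
      (\<forall>m n. cmod (\<psi> n m) \<le> 2 * a * C * exp (- b * l1norm (m - n)))"
proof -
  have b0: "0 \<le> b" using b by simp
  have C: "0 \<le> C" and a0: "0 \<le> a"
    by (rule row_bounded_nonneg[OF T] row_bounded_nonneg[OF A])+
  define t where "t n = (\<lambda>m. T m n)" for n
  have t_exp: "cmod (t n m) \<le> C * exp (- b * l1norm (m - n))" for n m
    unfolding t_def by (rule row_bounded_entry_exp[OF T])
  have t2: "t n \<in> ell2" for n
    by (rule ell2_dominated(1)[OF exp_decay_ell2[OF b, of n] _ C]) (use t_exp in simp)
  have slope_t: "(\<lambda>m. of_real (slope \<theta> m) * t n m) \<in> ell2" for n
  proof (rule ell2_dominated(1)[OF exp_decay_ell2[of "b/2" n], of _ "C * (l1norm n + 2 / b)"])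
    fix m
    let ?x = "l1norm (m - n)"
    have "(b/2) * ?x \<le> exp ((b/2) * ?x)"
      using exp_ge_add_one_self[of "(b/2) * ?x"] by linarith
    then have "?x \<le> 2 / b * exp ((b/2) * ?x)"
      using b by (simp add: field_simps)
    moreover have "l1norm n * 1 \<le> l1norm n * exp ((b/2) * ?x)"
      using b by (intro mult_left_mono) auto
    moreover have "l1norm m \<le> ?x + l1norm n"
      using l1norm_triangle[of m 0 n] by simp
    ultimately have m: "l1norm m \<le> (l1norm n + 2 / b) * exp ((b/2) * ?x)"
      by (simp add: algebra_simps)
    have "cmod (of_real (slope \<theta> m) * t n m) \<le> ((l1norm n + 2 / b) * exp ((b/2) * ?x)) * (C * exp (- b * ?x))"
      unfolding norm_mult using abs_slope_le[of \<theta> m] m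
      by (intro mult_mono t_exp) auto
    also have "\<dots> = C * (l1norm n + 2 / b) * (exp ((b/2) * ?x) * exp (- b * ?x))"
      by simp
    also have "exp ((b/2) * ?x) * exp (- b * ?x) = exp (- (b/2) * ?x)"
      by (simp add: algebra_simps flip: exp_add)
    finally show "cmod (of_real (slope \<theta> m) * t n m)
        \<le> C * (l1norm n + 2 / b) * cmod (of_real (exp (- (b/2) * ?x)))"
      by simp
  qed (use b C in auto)
  \<comment> \<open>A diagonal entry of \<open>A \<odot> T\<close> is at most \<open>a\<close> times the largest entry of the column.\<close>
  have lower: "1 \<le> 2 * a * ell2_norm (t n)" for n
  proof -
    have entry: "cmod (T k n) \<le> ell2_norm (t n)" for k
      using ell2_finite_le[OF t2[of n], of "{k}"] by (simp add: L2_set_def t_def)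
    have sA: "(\<lambda>k. cmod (A n k)) summable_on UNIV"
      by (rule row_abs_summable[OF A b0])
    have sAT: "(\<lambda>k. cmod (A n k * T k n)) summable_on UNIV"
      by (rule mat_mult_abs_summable[OF A T b0 b0])
    have "cmod ((A \<odot> T) n n) \<le> (\<Sum>\<^sub>\<infinity>k. cmod (A n k * T k n))"
      unfolding mat_mult_def by (rule norm_infsum_bound[OF sAT])
    also have "\<dots> \<le> (\<Sum>\<^sub>\<infinity>k. cmod (A n k) * ell2_norm (t n))"
      by (rule infsum_mono[OF sAT summable_on_cmult_left[OF sA]])
         (simp add: norm_mult mult_left_mono entry)
    also have "\<dots> = (\<Sum>\<^sub>\<infinity>k. cmod (A n k)) * ell2_norm (t n)"
      by (simp add: infsum_cmult_left')
    also have "\<dots> \<le> a * ell2_norm (t n)"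
    proof (intro mult_right_mono ell2_norm_nonneg infsum_le_finite_sums[OF sA])
      fix F :: "site set" assume F: "finite F"
      have "(\<Sum>k\<in>F. cmod (A n k)) \<le> (\<Sum>k\<in>F. cmod (A n k) * exp (b * l1norm (n - k)))"
        using b0 by (intro sum_mono) (simp add: mult_le_cancel_left1)
      also have "\<dots> \<le> a"
        using row_boundedD[OF A F, of n] by simp
      finally show "(\<Sum>k\<in>F. cmod (A n k)) \<le> a" .
    qed
    finally show ?thesis
      using AT[of n] by linarith
  qed
  have pos: "0 < ell2_norm (t n)" for n
    using lower[of n] ell2_norm_nonneg[of "t n"] by (cases "ell2_norm (t n) = 0") auto
  define \<psi> where "\<psi> n = (\<lambda>m. of_real (1 / ell2_norm (t n)) * t n m)" for n
  have \<psi>2: "\<psi> n \<in> ell2" for n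
    unfolding \<psi>_def by (rule ell2_scale(1)[OF t2])
  have \<psi>_norm: "ell2_norm (\<psi> n) = 1" for n
    unfolding \<psi>_def ell2_scale(2)[OF t2] norm_of_real using pos[of n] by simp
  have \<psi>_eig: "hamiltonian v \<theta> \<epsilon> (\<psi> n) m = D n * \<psi> n m" for n m
  proof -
    have "hamiltonian v \<theta> \<epsilon> (\<psi> n) m = of_real (1 / ell2_norm (t n)) * hamiltonian v \<theta> \<epsilon> (\<lambda>k. T k n) m"
      by (simp add: hamiltonian_def \<psi>_def t_def sum_distrib_left algebra_simps)
    then show ?thesis
      by (simp add: eig \<psi>_def t_def)
  qed
  have \<psi>_dom: "\<psi> n \<in> eigenspace v \<theta> \<epsilon> (D n)" for n
    unfolding eigenspace_def hamiltonian_domain_def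
    using \<psi>2 \<psi>_eig ell2_scale(1)[OF slope_t, of "of_real (1 / ell2_norm (t n))"]
    by (auto simp: \<psi>_def mult_ac)
  have \<psi>_nonzero: "\<psi> n \<noteq> (\<lambda>m. 0)" for n
    using \<psi>_norm[of n] by (auto simp: ell2_norm_def)
  have \<psi>_inner: "ell2_inner (\<psi> n) (\<psi> n) = 1" for n
    by (simp add: ell2_inner_self[OF \<psi>2] \<psi>_norm)
  have D_real: "cnj (D n) = D n" for n
    using hamiltonian_symmetric[OF \<psi>2 \<psi>_eig \<psi>2 \<psi>_eig, of n n] by (simp add: \<psi>_inner)
  have eig_orth: "(E - D n) * ell2_inner u (\<psi> n) = 0"
    if "u \<in> ell2" "\<And>m. hamiltonian v \<theta> \<epsilon> u m = E * u m" for u E n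
    using hamiltonian_symmetric[OF that \<psi>2 \<psi>_eig, of n] by (simp add: D_real)
  have \<psi>_orth: "ell2_inner (\<psi> i) (\<psi> j) = (if i = j then 1 else 0)" for i j
    using eig_orth[OF \<psi>2 \<psi>_eig, of i j] injD[OF inj, of i j] by (auto simp: \<psi>_inner)
  have span: "in_closed_span \<psi> u" if "u \<in> ell2" for u
  proof (rule in_closed_span_of_unit_vectors[OF \<psi>2 _ that])
    show "in_closed_span \<psi> (\<lambda>m. mat_id m k)" for k
      by (rule unit_vector_in_closed_span[OF b T S TS, of "\<lambda>n. of_real (ell2_norm (t n))"])
         (use pos in \<open>simp add: \<psi>_def t_def less_imp_neq[symmetric]\<close>)
  qed
  have eigvec: "eigenvector v \<theta> \<epsilon> (\<psi> n)" for n
    unfolding eigenvector_def using \<psi>_dom \<psi>_nonzero by blast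
  have basis: "orthonormal_basis UNIV \<psi>"
    unfolding orthonormal_basis_def using \<psi>2 \<psi>_orth span by (auto simp: in_closed_span_def)
  have inj_\<psi>: "inj \<psi>"
    using \<psi>_orth by (intro injI) (metis zero_neq_one)
  have "orthonormal_basis (range \<psi>) (\<lambda>u. u)"
    unfolding orthonormal_basis_def
  proof (intro conjI ballI allI impI)
    show "i \<in> ell2" if "i \<in> range \<psi>" for i
      using that \<psi>2 by auto
    show "ell2_inner i j = (if i = j then 1 else 0)" if "i \<in> range \<psi>" "j \<in> range \<psi>" for i j
      using that \<psi>_orth injD[OF inj_\<psi>] by auto
    fix u and e :: real assume "u \<in> ell2" "0 < e"
    then obtain F c where F: "finite F" "ell2_norm (\<lambda>m. u m - (\<Sum>i\<in>F. c i * \<psi> i m)) < e"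
      using span unfolding in_closed_span_def by blast
    have "(\<Sum>x\<in>\<psi> ` F. c (inv \<psi> x) * x m) = (\<Sum>i\<in>F. c i * \<psi> i m)" for m
      by (subst sum.reindex) (auto simp: inj_\<psi> intro: inj_on_subset[OF inj_\<psi>])
    then show "\<exists>G d. finite G \<and> G \<subseteq> range \<psi> \<and> ell2_norm (\<lambda>m. u m - (\<Sum>x\<in>G. d x * x m)) < e"
      using F by (intro exI[of _ "\<psi> ` F"] exI[of _ "\<lambda>x. c (inv \<psi> x)"]) auto
  qed
  then show "pure_point_spectrum v \<theta> \<epsilon>"
    unfolding pure_point_spectrum_def using eigvec by (intro exI[of _ "range \<psi>"]) auto
  show "simple_eigenvalue v \<theta> \<epsilon> E" if ev: "eigenvalue v \<theta> \<epsilon> E" for E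
  proof -
    obtain u where u: "u \<in> eigenspace v \<theta> \<epsilon> E" "u \<noteq> (\<lambda>m. 0)"
      using ev unfolding eigenvalue_def by blast
    have es: "x \<in> ell2" "hamiltonian v \<theta> \<epsilon> x m = E * x m" if "x \<in> eigenspace v \<theta> \<epsilon> E" for x m
      using that unfolding eigenspace_def hamiltonian_domain_def by blast+
    have "\<exists>n. ell2_inner u (\<psi> n) \<noteq> 0"
      using orthogonal_to_span_zero[OF \<psi>2 span[OF es(1)[OF u(1)]]] u(2) by blast
    then obtain n where n: "ell2_inner u (\<psi> n) \<noteq> 0" by blast
    then have E: "E = D n"
      using eig_orth[OF es[OF u(1)], of n] by simp
    have "\<exists>c. x = (\<lambda>m. c * \<psi> n m)" if x: "x \<in> eigenspace v \<theta> \<epsilon> E" for x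
    proof -
      let ?c = "ell2_inner x (\<psi> n)"
      let ?y = "\<lambda>m. x m - ?c * \<psi> n m"
      have y2: "?y \<in> ell2"
        by (intro ell2_diff ell2_scale(1) es(1)[OF x] \<psi>2)
      have "ell2_inner ?y (\<psi> i) = 0" for i
      proof (cases "i = n")
        case True
        then show ?thesis
          using ell2_inner_diff_left[OF es(1)[OF x] \<psi>2[of n] \<psi>2[of n], of ?c] by (simp add: \<psi>_inner)
      next
        case False
        then have "D n \<noteq> D i" using injD[OF inj] by blast
        then have "ell2_inner x (\<psi> i) = 0"
          using eig_orth[OF es[OF x], of i] E by simp
        then show ?thesis
          using ell2_inner_diff_left[OF es(1)[OF x] \<psi>2[of n] \<psi>2[of i], of ?c] False
          by (simp add: \<psi>_orth)
      qed
      then have "?y = (\<lambda>m. 0)"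
        by (rule orthogonal_to_span_zero[OF \<psi>2 span[OF y2]])
      then show ?thesis
        by (intro exI[of _ ?c]) (simp add: fun_eq_iff)
    qed
    then show ?thesis
      unfolding simple_eigenvalue_def using \<psi>_dom[of n] \<psi>_nonzero[of n] E by blast
  qed
  have "cmod (\<psi> n m) \<le> 2 * a * C * exp (- b * l1norm (m - n))" for m n
  proof -
    have "1 / ell2_norm (t n) \<le> 2 * a"
      using lower[of n] pos[of n] by (simp add: field_simps)
    then have "1 / ell2_norm (t n) * cmod (t n m) \<le> (2 * a) * (C * exp (- b * l1norm (m - n)))"
      using a0 by (intro mult_mono t_exp) auto
    then show ?thesis
      using pos[of n] by (simp add: \<psi>_def norm_mult norm_divide mult.assoc)
  qed
  with basis eigvec show "\<exists>\<psi> :: site \<Rightarrow> site \<Rightarrow> complex. orthonormal_basis UNIV \<psi> \<and>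
      (\<forall>n. eigenvector v \<theta> \<epsilon> (\<psi> n)) \<and> (\<forall>m n. cmod (\<psi> n m) \<le> 2 * a * C * exp (- b * l1norm (m - n)))"
    by blast
qed

section \<open>The exact diagonalisation without potential\<close>

definition ray :: "site \<Rightarrow> nat \<Rightarrow> site" where
  "ray e j = (int j * fst e, int j * snd e)"

definition steps :: "site \<Rightarrow> nat" where
  "steps p = nat (\<bar>fst p\<bar> + \<bar>snd p\<bar>)"

text \<open>The matrix of \<open>\<Sum>j. f j \<cdot> S ^ j\<close> for the shift \<open>S\<close> by \<open>e\<close>; the exponent is recovered from the distance
\<open>steps (m - n)\<close>.\<close>

definition ray_mat :: "site \<Rightarrow> (nat \<Rightarrow> real) \<Rightarrow> mat" where
  "ray_mat e f m n = (if m - n = ray e (steps (m - n)) then of_real (f (steps (m - n))) else 0)"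

definition shift_exp :: "site \<Rightarrow> real \<Rightarrow> mat" where
  "shift_exp e c = ray_mat e (\<lambda>j. c ^ j / fact j)"

lemma l1norm_directions: "e \<in> directions \<Longrightarrow> l1norm e = 1"
  by (auto simp: directions_def l1norm_def)

lemma steps_ray: "e \<in> directions \<Longrightarrow> steps (ray e j) = j"
  by (auto simp: directions_def steps_def ray_def)

lemma l1norm_ray: "e \<in> directions \<Longrightarrow> l1norm (ray e j) = real j"
  by (auto simp: directions_def l1norm_def ray_def)

lemma ray_add: "ray e (i + j) = ray e i + ray e j"
  by (simp add: ray_def algebra_simps)

lemma ray_inj: "e \<in> directions \<Longrightarrow> ray e i = ray e j \<longleftrightarrow> i = j"
  by (metis steps_ray)

lemma ray_0: "ray e 0 = 0" and ray_1: "ray e 1 = e"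
  by (simp_all add: ray_def zero_prod_def)

lemma slope_ray: "slope \<theta> (ray e j) = real j * slope \<theta> e"
  by (simp add: slope_def ray_def algebra_simps)

lemma ray_mat_on:
  assumes "e \<in> directions" "m - n = ray e j"
  shows "ray_mat e f m n = of_real (f j)"
  using assms by (simp add: ray_mat_def steps_ray)

lemma ray_mat_off: "(\<And>j. m - n \<noteq> ray e j) \<Longrightarrow> ray_mat e f m n = 0"
  by (simp add: ray_mat_def)

lemma ray_mat_row_bounded:
  assumes e: "e \<in> directions" and f: "\<And>J. finite J \<Longrightarrow> (\<Sum>j\<in>J. \<bar>f j\<bar> * exp (r * real j)) \<le> M"
  shows "row_bounded unit_weight r (ray_mat e f) M"
  unfolding row_bounded_def
proof (intro allI impI)
  fix m and F :: "site set" assume F: "finite F"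
  let ?G = "{n \<in> F. \<exists>j. m - n = ray e j}"
  let ?h = "\<lambda>j. \<bar>f j\<bar> * exp (r * real j)"
  have G: "finite ?G" using F by simp
  have inj: "inj_on (\<lambda>n. steps (m - n)) ?G"
  proof (rule inj_onI)
    fix n n' assume "n \<in> ?G" "n' \<in> ?G" and eq: "steps (m - n) = steps (m - n')"
    then obtain j j' where "m - n = ray e j" "m - n' = ray e j'" by blast
    with eq have "m - n = m - n'" by (simp add: steps_ray[OF e])
    then show "n = n'" by simp
  qed
  have "(\<Sum>n\<in>F. cmod (ray_mat e f m n) * exp (r * l1norm (m - n)))
      = (\<Sum>n\<in>?G. cmod (ray_mat e f m n) * exp (r * l1norm (m - n)))"
    using F by (intro sum.mono_neutral_right) (auto simp: ray_mat_off)
  also have "\<dots> = (\<Sum>n\<in>?G. ?h (steps (m - n)))"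
    by (intro sum.cong refl) (auto simp: ray_mat_on[OF e] l1norm_ray[OF e] steps_ray[OF e])
  also have "\<dots> = (\<Sum>j\<in>(\<lambda>n. steps (m - n)) ` ?G. ?h j)"
    by (simp add: sum.reindex[OF inj])
  also have "\<dots> \<le> M"
    by (intro f finite_imageI G)
  finally show "1 * (\<Sum>n\<in>F. cmod (ray_mat e f m n) * exp (r * l1norm (m - n))) \<le> M" by simp
qed

text \<open>Powers of one shift multiply like monomials, so coefficients convolve as for power series.\<close>

lemma ray_mat_mult:
  assumes e: "e \<in> directions"
  shows "ray_mat e f \<odot> ray_mat e g = ray_mat e (\<lambda>j. \<Sum>i\<le>j. f i * g (j - i))"
proof (intro ext)
  fix m n
  show "(ray_mat e f \<odot> ray_mat e g) m n = ray_mat e (\<lambda>j. \<Sum>i\<le>j. f i * g (j - i)) m n"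
  proof (cases "\<exists>j. m - n = ray e j")
    case False
    have "ray_mat e f m k * ray_mat e g k n = 0" for k
    proof (rule ccontr)
      assume "\<not> ?thesis"
      then obtain i l where "m - k = ray e i" "k - n = ray e l"
        using ray_mat_off by (metis mult_zero_left mult_zero_right)
      then have "m - n = ray e (i + l)"
        by (metis ray_add diff_add_cancel add_diff_eq)
      then show False using False by blast
    qed
    then have "(ray_mat e f \<odot> ray_mat e g) m n = 0"
      unfolding mat_mult_def by (simp only: infsum_0)
    moreover have "ray_mat e (\<lambda>j. \<Sum>i\<le>j. f i * g (j - i)) m n = 0"
      by (rule ray_mat_off) (use False in blast)
    ultimately show ?thesis by simp
  next
    case True
    then obtain j where j: "m - n = ray e j" by blast
    let ?K = "(\<lambda>i. m - ray e i) ` {..j}"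
    have inj: "inj_on (\<lambda>i. m - ray e i) {..j}"
      by (rule inj_onI) (simp add: ray_inj[OF e])
    have entry_eq: "ray_mat e f m (m - ray e i) * ray_mat e g (m - ray e i) n = of_real (f i * g (j - i))"
      if "i \<le> j" for i
    proof -
      have "ray e j = ray e i + ray e (j - i)"
        using that ray_add[of e i "j - i"] by simp
      then have "m - ray e i - n = ray e (j - i)"
        using j by (simp add: algebra_simps)
      then show ?thesis
        by (simp add: ray_mat_on[OF e, of m "m - ray e i" i] ray_mat_on[OF e])
    qed
    have "(\<Sum>\<^sub>\<infinity>k. ray_mat e f m k * ray_mat e g k n) = (\<Sum>k\<in>?K. ray_mat e f m k * ray_mat e g k n)"
    proof (intro infsumI has_sum_finite_neutralI refl)
      fix k assume k: "k \<in> UNIV - ?K"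
      show "ray_mat e f m k * ray_mat e g k n = 0"
      proof (rule ccontr)
        assume "\<not> ?thesis"
        then obtain i l where il: "m - k = ray e i" "k - n = ray e l"
          using ray_mat_off by (metis mult_zero_left mult_zero_right)
        then have "ray e j = ray e (i + l)"
          using j by (metis ray_add diff_add_cancel add_diff_eq)
        then have "i \<le> j" by (simp add: ray_inj[OF e])
        moreover have "k = m - ray e i" using il(1) by (simp add: algebra_simps)
        ultimately show False using k by blast
      qed
    qed auto
    also have "\<dots> = (\<Sum>i\<le>j. of_real (f i * g (j - i)))"
      by (simp add: sum.reindex[OF inj] entry_eq)
    finally show ?thesis
      by (simp add: mat_mult_def ray_mat_on[OF e j])
  qed
qed

lemma shift_exp_inverse:
  assumes e: "e \<in> directions"
  shows "shift_exp e c \<odot> shift_exp e (- c) = mat_id"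
proof -
  have "(\<Sum>i\<le>j. c ^ i / fact i * ((- c) ^ (j - i) / fact (j - i))) = (if j = 0 then 1 else 0)" for j
    using exp_series_add_commuting[of c "- c" j]
    by (cases "j = 0") (simp_all add: divide_inverse mult_ac power_0_left)
  then have "shift_exp e c \<odot> shift_exp e (- c) = ray_mat e (\<lambda>j. if j = 0 then 1 else 0)"
    by (simp add: shift_exp_def ray_mat_mult[OF e])
  also have "\<dots> = mat_id"
  proof (intro ext)
    fix m n
    show "ray_mat e (\<lambda>j. if j = 0 then 1 else 0) m n = mat_id m n"
    proof (cases "m = n")
      case True
      then show ?thesis
        by (simp add: ray_mat_on[OF e, of n n 0] ray_0 mat_id_def)
    next
      case False
      have "steps (m - n) \<noteq> 0 \<or> m - n \<noteq> ray e (steps (m - n))"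
        using False by (metis ray_0 eq_iff_diff_eq_0)
      then show ?thesis
        using False by (auto simp: ray_mat_def mat_id_def)
    qed
  qed
  finally show ?thesis .
qed

lemma exp_partial_sum_le:
  assumes "finite J" "0 \<le> x"
  shows "(\<Sum>j\<in>J. x ^ j /\<^sub>R fact j) \<le> exp (x::real)"
proof -
  have "(\<Sum>j\<in>J. x ^ j /\<^sub>R fact j) \<le> (\<Sum>j. x ^ j /\<^sub>R fact j)"
    by (rule sum_le_suminf[OF summable_exp_generic assms(1)]) (use assms(2) in auto)
  then show ?thesis by (simp only: exp_def)
qed

lemma shift_exp_row_bounded:
  assumes e: "e \<in> directions"
  shows "row_bounded unit_weight r (shift_exp e c) (exp (\<bar>c\<bar> * exp r))"
  unfolding shift_exp_def
proof (rule ray_mat_row_bounded[OF e])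
  fix J :: "nat set" assume J: "finite J"
  have "(\<Sum>j\<in>J. \<bar>c ^ j / fact j\<bar> * exp (r * real j)) = (\<Sum>j\<in>J. (\<bar>c\<bar> * exp r) ^ j /\<^sub>R fact j)"
    by (intro sum.cong refl)
       (simp add: abs_mult power_abs power_mult_distrib exp_of_nat_mult[symmetric] divide_inverse mult_ac)
  also have "\<dots> \<le> exp (\<bar>c\<bar> * exp r)"
    by (rule exp_partial_sum_le[OF J]) simp
  finally show "(\<Sum>j\<in>J. \<bar>c ^ j / fact j\<bar> * exp (r * real j)) \<le> exp (\<bar>c\<bar> * exp r)" .
qed

lemma power_diff_bound:
  fixes c d R :: real
  assumes "\<bar>c\<bar> \<le> R" "\<bar>d\<bar> \<le> R"
  shows "\<bar>c ^ Suc j - d ^ Suc j\<bar> \<le> real (Suc j) * R ^ j * \<bar>c - d\<bar>"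
proof (induction j)
  case (Suc j)
  have R: "0 \<le> R" using assms by linarith
  have "c ^ Suc (Suc j) - d ^ Suc (Suc j) = c * (c ^ Suc j - d ^ Suc j) + (c - d) * d ^ Suc j"
    by (simp add: algebra_simps)
  then have "\<bar>c ^ Suc (Suc j) - d ^ Suc (Suc j)\<bar> \<le> \<bar>c\<bar> * \<bar>c ^ Suc j - d ^ Suc j\<bar> + \<bar>c - d\<bar> * \<bar>d\<bar> ^ Suc j"
    by (metis abs_mult abs_triangle_ineq power_abs)
  also have "\<dots> \<le> R * (real (Suc j) * R ^ j * \<bar>c - d\<bar>) + \<bar>c - d\<bar> * R ^ Suc j"
    using assms R by (intro add_mono mult_mono Suc power_mono mult_nonneg_nonneg) auto
  also have "\<dots> = real (Suc (Suc j)) * R ^ Suc j * \<bar>c - d\<bar>"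
    by (simp add: algebra_simps)
  finally show ?case .
qed simp

lemma shift_exp_diff_row_bounded:
  assumes e: "e \<in> directions" and c: "\<bar>c\<bar> \<le> R" "\<bar>d\<bar> \<le> R"
  shows "row_bounded unit_weight r (\<lambda>m n. shift_exp e c m n - shift_exp e d m n)
           (exp r * exp (R * exp r) * \<bar>c - d\<bar>)"
proof -
  define f where "f j = c ^ j / fact j - d ^ j / fact j" for j
  have R: "0 \<le> R" using c by linarith
  have f_Suc: "\<bar>f (Suc j)\<bar> * exp (r * real (Suc j)) \<le> exp r * \<bar>c - d\<bar> * ((R * exp r) ^ j /\<^sub>R fact j)" for j
  proof -
    have "\<bar>f (Suc j)\<bar> = \<bar>c ^ Suc j - d ^ Suc j\<bar> / fact (Suc j)"
      by (simp add: f_def diff_divide_distrib[symmetric] del: power_Suc fact_Suc)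
    also have "\<dots> \<le> real (Suc j) * R ^ j * \<bar>c - d\<bar> / fact (Suc j)"
      by (intro divide_right_mono power_diff_bound c) simp
    also have "\<dots> = R ^ j * \<bar>c - d\<bar> / fact j"
      by (simp add: field_simps del: of_nat_Suc)
    finally have "\<bar>f (Suc j)\<bar> * (exp r * exp r ^ j) \<le> R ^ j * \<bar>c - d\<bar> / fact j * (exp r * exp r ^ j)"
      by (rule mult_right_mono) simp
    moreover have "exp (r * real (Suc j)) = exp r * exp r ^ j"
      by (simp add: distrib_left exp_add exp_of_nat_mult[symmetric] mult.commute)
    ultimately show ?thesis
      by (simp add: power_mult_distrib divide_inverse mult_ac)
  qed
  have "row_bounded unit_weight r (ray_mat e f) (exp r * exp (R * exp r) * \<bar>c - d\<bar>)"
  proof (rule ray_mat_row_bounded[OF e])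
    fix J :: "nat set" assume J: "finite J"
    obtain n where n: "J \<subseteq> {..n}"
      using finite_nat_iff_bounded_le J by blast
    have "(\<Sum>j\<in>J. \<bar>f j\<bar> * exp (r * real j)) \<le> (\<Sum>j\<le>Suc n. \<bar>f j\<bar> * exp (r * real j))"
      using n by (intro sum_mono2) auto
    also have "\<dots> = (\<Sum>j\<le>n. \<bar>f (Suc j)\<bar> * exp (r * real (Suc j)))"
      unfolding sum.atMost_Suc_shift by (simp add: f_def)
    also have "\<dots> \<le> (\<Sum>j\<le>n. exp r * \<bar>c - d\<bar> * ((R * exp r) ^ j /\<^sub>R fact j))"
      by (intro sum_mono f_Suc)
    also have "\<dots> = exp r * \<bar>c - d\<bar> * (\<Sum>j\<le>n. (R * exp r) ^ j /\<^sub>R fact j)"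
      by (rule sum_distrib_left[symmetric])
    also have "\<dots> \<le> exp r * \<bar>c - d\<bar> * exp (R * exp r)"
      using R by (intro mult_left_mono exp_partial_sum_le) auto
    finally show "(\<Sum>j\<in>J. \<bar>f j\<bar> * exp (r * real j)) \<le> exp r * exp (R * exp r) * \<bar>c - d\<bar>"
      by (simp add: mult_ac)
  qed
  moreover have "ray_mat e f = (\<lambda>m n. shift_exp e c m n - shift_exp e d m n)"
    by (auto simp: fun_eq_iff shift_exp_def ray_mat_def f_def)
  ultimately show ?thesis by simp
qed

text \<open>The commutator \<open>[D, exp (c S)] = (e \<cdot> \<omega>) c S exp (c S)\<close>, entry by entry.\<close>

lemma shift_exp_slope:
  assumes e: "e \<in> directions"
  shows "of_real (slope \<theta> m - slope \<theta> n) * shift_exp e c m n = of_real (slope \<theta> e * c) * shift_exp e c (m - e) n"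
proof (cases "\<exists>j. m - n = ray e j")
  case False
  have "m - e - n \<noteq> ray e j" for j
  proof
    assume "m - e - n = ray e j"
    then have "m - n = ray e (Suc j)"
      using ray_add[of e j 1] by (simp add: ray_1[unfolded One_nat_def] algebra_simps)
    then show False using False by blast
  qed
  then show ?thesis
    using False by (simp add: shift_exp_def ray_mat_off)
next
  case True
  then obtain j where j: "m - n = ray e j" by blast
  then have sl: "slope \<theta> m - slope \<theta> n = real j * slope \<theta> e"
    by (metis slope_diff slope_ray)
  show ?thesis
  proof (cases j)
    case 0
    have "m - e - n \<noteq> ray e i" for i
    proof
      assume i: "m - e - n = ray e i"
      have "m - n = 0" using j 0 by (simp add: ray_0)
      then have "- e = ray e i" using i by (simp add: algebra_simps)
      moreover have "l1norm (ray e i) = real i" by (rule l1norm_ray[OF e])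
      ultimately have "i = 1" using l1norm_directions[OF e] by (metis l1norm_minus of_nat_eq_1_iff)
      then have "- e = e" using \<open>- e = ray e i\<close> by (simp add: ray_1[unfolded One_nat_def])
      then show False using e by (auto simp: directions_def)
    qed
    then have "shift_exp e c (m - e) n = 0"
      unfolding shift_exp_def by (rule ray_mat_off)
    then show ?thesis using sl 0 by simp
  next
    case (Suc i)
    then have "m - e - n = ray e i"
      using j ray_add[of e i 1] by (simp add: ray_1[unfolded One_nat_def] algebra_simps)
    then have "shift_exp e c (m - e) n = of_real (c ^ i / fact i)"
      unfolding shift_exp_def by (rule ray_mat_on[OF e])
    moreover have "shift_exp e c m n = of_real (c ^ Suc i / fact (Suc i))"
      unfolding shift_exp_def by (rule ray_mat_on[OF e]) (use j Suc in simp)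
    moreover have "real (Suc i) * slope \<theta> e * (c ^ Suc i / fact (Suc i)) = slope \<theta> e * c * (c ^ i / fact i)"
      by (simp add: field_simps del: of_nat_Suc)
    ultimately show ?thesis
      unfolding sl Suc by (simp only: of_real_mult[symmetric])
  qed
qed

lemma shift_exp_translation: "shift_exp e c (m + p) (n + p) = shift_exp e c m n"
  by (simp add: shift_exp_def ray_mat_def)

text \<open>\<open>U\<close> conjugates \<open>D + \<Sum>S\<close>, the sum of the shifts by the vectors of \<open>Q\<close>, to \<open>D\<close>, and \<open>U'\<close> is its two-sided
inverse. Translation invariance expresses that \<open>U\<close> commutes with all shifts, which permits
adding one direction after the other.\<close>

definition stark_conjugation :: "real \<Rightarrow> real set \<Rightarrow> site set \<Rightarrow> (real \<Rightarrow> mat) \<Rightarrow> (real \<Rightarrow> mat) \<Rightarrow> real \<Rightarrow> bool" where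
  "stark_conjugation r \<Theta> Q U U' M \<longleftrightarrow> lip_bounded unit_weight r \<Theta> U M \<and> lip_bounded unit_weight r \<Theta> U' M \<and>
     (\<forall>\<theta>\<in>\<Theta>. U \<theta> \<odot> U' \<theta> = mat_id \<and> U' \<theta> \<odot> U \<theta> = mat_id \<and>
        (\<forall>m n p. U \<theta> (m + p) (n + p) = U \<theta> m n) \<and>
        (\<forall>m n. of_real (slope \<theta> m - slope \<theta> n) * U \<theta> m n = - (\<Sum>e\<in>Q. U \<theta> (m - e) n)))"

lemma stark_conjugationD:
  assumes "stark_conjugation r \<Theta> Q U U' M"
  shows "lip_bounded unit_weight r \<Theta> U M" "lip_bounded unit_weight r \<Theta> U' M"
    and "\<theta> \<in> \<Theta> \<Longrightarrow> U \<theta> \<odot> U' \<theta> = mat_id" "\<theta> \<in> \<Theta> \<Longrightarrow> U' \<theta> \<odot> U \<theta> = mat_id"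
    and "\<theta> \<in> \<Theta> \<Longrightarrow> U \<theta> (m + p) (n + p) = U \<theta> m n"
    and "\<theta> \<in> \<Theta> \<Longrightarrow> of_real (slope \<theta> m - slope \<theta> n) * U \<theta> m n = - (\<Sum>e\<in>Q. U \<theta> (m - e) n)"
  using assms unfolding stark_conjugation_def by blast+

text \<open>On \<open>DC\<close> the slopes of unit vectors are bounded below by \<open>\<gamma>\<close>, so that the coefficient
\<open>- 1 / (e \<cdot> \<omega>)\<close> is bounded and Lipschitz in the angle.\<close>

lemma stark_conjugation_single:
  assumes e: "e \<in> directions" and \<gamma>: "0 < \<gamma>" and \<Theta>: "\<Theta> \<subseteq> DC \<gamma> \<tau>"
  shows "\<exists>U U' M. stark_conjugation r \<Theta> {e} U U' M"
proof -
  define c where "c \<theta> = - 1 / slope \<theta> e" for \<theta>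
  define M where "M = exp (exp r / \<gamma>) + exp r * exp (exp r / \<gamma>) / \<gamma>\<^sup>2"
  have s: "\<gamma> \<le> \<bar>slope \<theta> e\<bar>" if "\<theta> \<in> \<Theta>" for \<theta>
    using DC_slope_axis[OF _ l1norm_directions[OF e]] \<Theta> that by blast
  have c: "\<bar>c \<theta>\<bar> \<le> 1 / \<gamma>" if "\<theta> \<in> \<Theta>" for \<theta>
    using s[OF that] \<gamma> by (simp add: c_def abs_divide frac_le)
  have c_lip: "\<bar>c \<theta> - c \<theta>'\<bar> \<le> \<bar>\<theta> - \<theta>'\<bar> / \<gamma>\<^sup>2" if "\<theta> \<in> \<Theta>" "\<theta>' \<in> \<Theta>" for \<theta> \<theta>'
  proof -
    have nz: "slope \<theta> e \<noteq> 0" "slope \<theta>' e \<noteq> 0"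
      using s[OF that(1)] s[OF that(2)] \<gamma> by auto
    have "c \<theta> - c \<theta>' = (slope \<theta> e - slope \<theta>' e) / (slope \<theta> e * slope \<theta>' e)"
      using nz by (simp add: c_def field_simps)
    then have "\<bar>c \<theta> - c \<theta>'\<bar> = \<bar>slope \<theta> e - slope \<theta>' e\<bar> / (\<bar>slope \<theta> e\<bar> * \<bar>slope \<theta>' e\<bar>)"
      by (simp add: abs_mult)
    also have "\<dots> \<le> (l1norm e * \<bar>\<theta> - \<theta>'\<bar>) / (\<gamma> * \<gamma>)"
      using s[OF that(1)] s[OF that(2)] \<gamma> by (intro frac_le slope_lipschitz mult_mono) auto
    finally show ?thesis
      by (simp add: l1norm_directions[OF e] power2_eq_square)
  qed
  have lip: "lip_bounded unit_weight r \<Theta> (\<lambda>\<theta>. shift_exp e (s * c \<theta>)) M" if s: "s \<in> {1, -1}" for s :: real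
  proof (rule lip_boundedI)
    fix \<theta> \<theta>' assume th: "\<theta> \<in> \<Theta>" "\<theta>' \<in> \<Theta>"
    have sc: "\<bar>s * x\<bar> = \<bar>x\<bar>" "\<bar>s * x - s * y\<bar> = \<bar>x - y\<bar>" for x y
      using s by (auto simp: abs_minus_commute)
    show "row_bounded unit_weight r (shift_exp e (s * c \<theta>)) M"
    proof (rule row_bounded_mono[OF shift_exp_row_bounded[OF e]])
      have "\<bar>s * c \<theta>\<bar> * exp r \<le> 1 / \<gamma> * exp r"
        unfolding sc by (intro mult_right_mono c th) simp
      then have "exp (\<bar>s * c \<theta>\<bar> * exp r) \<le> exp (exp r / \<gamma>)" by simp
      moreover have "0 \<le> exp r * exp (exp r / \<gamma>) / \<gamma>\<^sup>2" by simp
      ultimately show "exp (\<bar>s * c \<theta>\<bar> * exp r) \<le> M"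
        unfolding M_def by linarith
    qed
    have "row_bounded unit_weight r (\<lambda>m n. shift_exp e (s * c \<theta>) m n - shift_exp e (s * c \<theta>') m n)
        (exp r * exp (1 / \<gamma> * exp r) * \<bar>s * c \<theta> - s * c \<theta>'\<bar>)"
      by (rule shift_exp_diff_row_bounded[OF e]) (simp_all add: sc c th)
    then show "row_bounded unit_weight r (\<lambda>m n. shift_exp e (s * c \<theta>) m n - shift_exp e (s * c \<theta>') m n)
        (M * \<bar>\<theta> - \<theta>'\<bar>)"
    proof (rule row_bounded_mono)
      have "exp r * exp (1 / \<gamma> * exp r) * \<bar>s * c \<theta> - s * c \<theta>'\<bar>
          \<le> exp r * exp (1 / \<gamma> * exp r) * (\<bar>\<theta> - \<theta>'\<bar> / \<gamma>\<^sup>2)"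
        unfolding sc by (intro mult_left_mono c_lip th) simp
      also have "\<dots> = (exp r * exp (exp r / \<gamma>) / \<gamma>\<^sup>2) * \<bar>\<theta> - \<theta>'\<bar>" by simp
      also have "\<dots> \<le> M * \<bar>\<theta> - \<theta>'\<bar>"
        unfolding M_def by (intro mult_right_mono) auto
      finally show "exp r * exp (1 / \<gamma> * exp r) * \<bar>s * c \<theta> - s * c \<theta>'\<bar> \<le> M * \<bar>\<theta> - \<theta>'\<bar>" .
    qed
  qed
  have "stark_conjugation r \<Theta> {e} (\<lambda>\<theta>. shift_exp e (c \<theta>)) (\<lambda>\<theta>. shift_exp e (- c \<theta>)) M"
    unfolding stark_conjugation_def
  proof (intro conjI ballI allI)
    show "lip_bounded unit_weight r \<Theta> (\<lambda>\<theta>. shift_exp e (c \<theta>)) M"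
      "lip_bounded unit_weight r \<Theta> (\<lambda>\<theta>. shift_exp e (- c \<theta>)) M"
      using lip[of 1] lip[of "-1"] by simp_all
    fix \<theta> assume \<theta>: "\<theta> \<in> \<Theta>"
    show "shift_exp e (c \<theta>) \<odot> shift_exp e (- c \<theta>) = mat_id" "shift_exp e (- c \<theta>) \<odot> shift_exp e (c \<theta>) = mat_id"
      using shift_exp_inverse[OF e, of "c \<theta>"] shift_exp_inverse[OF e, of "- c \<theta>"] by simp_all
    show "shift_exp e (c \<theta>) (m + p) (n + p) = shift_exp e (c \<theta>) m n" for m n p
      by (rule shift_exp_translation)
    have "slope \<theta> e * c \<theta> = - 1"
      using s[OF \<theta>] \<gamma> by (auto simp: c_def)
    then show "of_real (slope \<theta> m - slope \<theta> n) * shift_exp e (c \<theta>) m n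
        = - (\<Sum>q\<in>{e}. shift_exp e (c \<theta>) (m - q) n)" for m n
      unfolding shift_exp_slope[OF e] by simp
  qed
  then show ?thesis by blast
qed

text \<open>The commutator with \<open>D\<close> obeys the Leibniz rule. In the term where it falls on \<open>B\<close>, translation invariance
moves the resulting shift through \<open>A\<close>.\<close>

lemma stark_conjugation_mult:
  assumes A: "stark_conjugation r \<Theta> Q A A' a" and B: "stark_conjugation r \<Theta> {e} B B' b"
    and Q: "finite Q" "e \<notin> Q" and r: "0 \<le> r"
  shows "stark_conjugation r \<Theta> (insert e Q) (\<lambda>\<theta>. A \<theta> \<odot> B \<theta>) (\<lambda>\<theta>. B' \<theta> \<odot> A' \<theta>) (2 * a * b)"
proof -
  have la: "lip_bounded unit_weight r \<Theta> A a" "lip_bounded unit_weight r \<Theta> A' a"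
    and lb: "lip_bounded unit_weight r \<Theta> B b" "lip_bounded unit_weight r \<Theta> B' b"
    by (rule stark_conjugationD[OF A] stark_conjugationD[OF B])+
  have w: "1 \<le> unit_weight m" for m by simp
  show ?thesis
    unfolding stark_conjugation_def
  proof (intro conjI ballI allI)
    show "lip_bounded unit_weight r \<Theta> (\<lambda>\<theta>. A \<theta> \<odot> B \<theta>) (2 * a * b)"
      by (rule lip_bounded_mult[OF la(1) lb(1) r w])
    show "lip_bounded unit_weight r \<Theta> (\<lambda>\<theta>. B' \<theta> \<odot> A' \<theta>) (2 * a * b)"
      using lip_bounded_mult[OF lb(2) la(2) r w] by (simp add: mult_ac)
    fix \<theta> assume \<theta>: "\<theta> \<in> \<Theta>"
    note ba = lip_boundedD(1)[OF la(1) \<theta>] lip_boundedD(1)[OF la(2) \<theta>]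
    note bb = lip_boundedD(1)[OF lb(1) \<theta>] lip_boundedD(1)[OF lb(2) \<theta>]
    note inv = stark_conjugationD(3,4)[OF A \<theta>] stark_conjugationD(3,4)[OF B \<theta>]
    note transA = stark_conjugationD(5)[OF A \<theta>] and transB = stark_conjugationD(5)[OF B \<theta>]
    note slopeA = stark_conjugationD(6)[OF A \<theta>]
    have slopeB: "of_real (slope \<theta> m - slope \<theta> n) * B \<theta> m n = - B \<theta> (m - e) n" for m n
      using stark_conjugationD(6)[OF B \<theta>, of m n] by simp
    show "(A \<theta> \<odot> B \<theta>) \<odot> (B' \<theta> \<odot> A' \<theta>) = mat_id"
      by (metis mat_mult_assoc[OF ba(1) bb(1) row_bounded_mult[OF bb(2) ba(2) r w] r]
          mat_mult_assoc[OF bb(1) bb(2) ba(2) r] inv mat_mult_id_left)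
    show "(B' \<theta> \<odot> A' \<theta>) \<odot> (A \<theta> \<odot> B \<theta>) = mat_id"
      by (metis mat_mult_assoc[OF bb(2) ba(2) row_bounded_mult[OF ba(1) bb(1) r w] r]
          mat_mult_assoc[OF ba(2) ba(1) bb(1) r] inv mat_mult_id_left)
    show "(A \<theta> \<odot> B \<theta>) (m + p) (n + p) = (A \<theta> \<odot> B \<theta>) m n" for m n p
    proof -
      have "(A \<theta> \<odot> B \<theta>) (m + p) (n + p) = (\<Sum>\<^sub>\<infinity>k. A \<theta> (m + p) (k + p) * B \<theta> (k + p) (n + p))"
        unfolding mat_mult_def
        by (rule infsum_reindex_bij_betw[symmetric]) (rule bij_plus_right)
      then show ?thesis
        by (simp add: transA transB mat_mult_def)
    qed
    fix m n
    have h: "((\<lambda>k. A \<theta> m' k * B \<theta> k n) has_sum (A \<theta> \<odot> B \<theta>) m' n) UNIV" for m'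
      by (rule mat_mult_has_sum[OF ba(1) bb(1) r])
    \<comment> \<open>\<open>A\<close> commutes with the shift by \<open>e\<close>.\<close>
    have shift: "((\<lambda>k. A \<theta> m k * B \<theta> (k - e) n) has_sum (A \<theta> \<odot> B \<theta>) (m - e) n) UNIV"
    proof -
      have "((\<lambda>k. A \<theta> (m - e) (k - e) * B \<theta> (k - e) n) has_sum (A \<theta> \<odot> B \<theta>) (m - e) n) UNIV"
        using has_sum_reindex_bij_betw[of "\<lambda>k. k + - e" UNIV UNIV "\<lambda>k. A \<theta> (m - e) k * B \<theta> k n"]
          h[of "m - e"] by (simp add: bij_plus_right[of "- e", simplified])
      moreover have "A \<theta> (m - e) (k - e) = A \<theta> m k" for k
        using transA[of m "- e" k] by simp
      ultimately show ?thesis by simp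
    qed
    have 1: "((\<lambda>k. - (\<Sum>q\<in>Q. A \<theta> (m - q) k * B \<theta> k n) - A \<theta> m k * B \<theta> (k - e) n) has_sum
        (- (\<Sum>q\<in>Q. (A \<theta> \<odot> B \<theta>) (m - q) n) - (A \<theta> \<odot> B \<theta>) (m - e) n)) UNIV"
      by (intro has_sum_diff has_sum_uminusI has_sum_finite_sum Q h shift)
    have 2: "((\<lambda>k. of_real (slope \<theta> m - slope \<theta> n) * (A \<theta> m k * B \<theta> k n)) has_sum
        of_real (slope \<theta> m - slope \<theta> n) * (A \<theta> \<odot> B \<theta>) m n) UNIV"
      by (intro has_sum_cmult_right h)
    have "- (\<Sum>q\<in>Q. A \<theta> (m - q) k * B \<theta> k n) - A \<theta> m k * B \<theta> (k - e) n
        = of_real (slope \<theta> m - slope \<theta> n) * (A \<theta> m k * B \<theta> k n)" for k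
    proof -
      have "- (\<Sum>q\<in>Q. A \<theta> (m - q) k * B \<theta> k n) = (of_real (slope \<theta> m - slope \<theta> k) * A \<theta> m k) * B \<theta> k n"
        unfolding slopeA by (simp add: sum_distrib_right)
      moreover have "- (A \<theta> m k * B \<theta> (k - e) n) = A \<theta> m k * (of_real (slope \<theta> k - slope \<theta> n) * B \<theta> k n)"
        unfolding slopeB by simp
      ultimately show ?thesis
        by (simp add: algebra_simps)
    qed
    from has_sum_unique[OF 2 1[unfolded this]]
    show "of_real (slope \<theta> m - slope \<theta> n) * (A \<theta> \<odot> B \<theta>) m n = - (\<Sum>q\<in>insert e Q. (A \<theta> \<odot> B \<theta>) (m - q) n)"
      using Q by simp
  qed
qed

lemma stark_conjugation_exists:
  assumes \<gamma>: "0 < \<gamma>" and \<Theta>: "\<Theta> \<subseteq> DC \<gamma> \<tau>" and r: "0 \<le> r"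
  shows "\<exists>U U' M. stark_conjugation r \<Theta> directions U U' M"
proof -
  have "\<exists>U U' M. stark_conjugation r \<Theta> Q U U' M" if "finite Q" "Q \<noteq> {}" "Q \<subseteq> directions" for Q
    using that
  proof (induction Q rule: finite_ne_induct)
    case (singleton e)
    then show ?case using stark_conjugation_single[OF _ \<gamma> \<Theta>] by simp
  next
    case (insert e Q)
    then have e: "e \<in> directions" and Q: "Q \<subseteq> directions" by auto
    obtain A A' a where A: "stark_conjugation r \<Theta> Q A A' a"
      using insert.IH[OF Q] by (elim exE)
    obtain B B' b where B: "stark_conjugation r \<Theta> {e} B B' b"
      using stark_conjugation_single[OF e \<gamma> \<Theta>, of r] by (elim exE)
    show ?case
      by (intro exI) (rule stark_conjugation_mult[OF A B insert.hyps(1,3) r])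
  qed
  then show ?thesis
    by (simp add: directions_def)
qed

section \<open>Localisation for the perturbed operator\<close>

text \<open>The weight changes by at most a polynomial factor in the distance, because \<open>\<langle>m\<rangle> \<le> \<langle>k\<rangle> (1 + \<bar>m - k\<bar>)\<close>.\<close>

lemma log_weight_ratio:
  assumes \<sigma>: "0 \<le> \<sigma>"
  obtains K where "0 < K" "\<And>m k. log_weight \<sigma> m \<le> K * exp (l1norm (m - k)) * log_weight \<sigma> k"
proof -
  \<comment> \<open>The bound \<open>s * ln (1 + x) \<le> s * ln s + x\<close> holds for \<open>s \<ge> 1\<close>.\<close>
  define s where "s = max 1 \<sigma>"
  have s: "1 \<le> s" "\<sigma> \<le> s" by (auto simp: s_def)
  have "log_weight \<sigma> m \<le> exp (s * ln s) * exp (l1norm (m - k)) * log_weight \<sigma> k" for m k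
  proof -
    define x where "x = l1norm (m - k)"
    have x: "0 \<le> x" by (simp add: x_def)
    have br: "1 \<le> bracket k" "exp 1 \<le> bracket k" "l1norm k \<le> bracket k" "0 < bracket m"
      using exp_ge_add_one_self[of 1] by (auto simp: bracket_def less_max_iff_disj)
    have "x * 1 \<le> x * bracket k"
      using x br(1) by (intro mult_left_mono) auto
    moreover have "l1norm m \<le> x + l1norm k"
      using l1norm_triangle[of m 0 k] by (simp add: x_def)
    moreover have "0 \<le> x * bracket k"
      using x br(1) by simp
    ultimately have "bracket m \<le> bracket k * (1 + x)"
      using br unfolding bracket_def[of m] by (simp add: algebra_simps)
    then have "ln (bracket m) \<le> ln (bracket k * (1 + x))"
      using br x by (intro ln_mono) auto
    also have "\<dots> = ln (bracket k) + ln (1 + x)"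
      using br(1) x by (simp add: ln_mult)
    also have "\<dots> \<le> ln (bracket k) * (1 + x)"
      using ln_add_one_self_le_self[OF x] mult_right_mono[OF ln_bracket_ge_1[of k] x] by (simp add: algebra_simps)
    finally have "log_weight \<sigma> m \<le> (ln (bracket k) * (1 + x)) powr \<sigma>"
      unfolding log_weight_def using \<sigma> ln_bracket_ge_1[of m] by (intro powr_mono2) auto
    also have "\<dots> = log_weight \<sigma> k * (1 + x) powr \<sigma>"
      unfolding log_weight_def by (rule powr_mult)
    also have "\<dots> \<le> log_weight \<sigma> k * (exp (s * ln s) * exp x)"
    proof (rule mult_left_mono)
      have "ln ((1 + x) / s) \<le> (1 + x) / s - 1"
        using x s by (intro ln_le_minus_one) auto
      then have "s * ln ((1 + x) / s) \<le> s * ((1 + x) / s - 1)"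
        using s by (intro mult_left_mono) auto
      then have "s * ln (1 + x) - s * ln s \<le> 1 + x - s"
        using s x by (simp add: ln_div right_diff_distrib)
      moreover have "\<sigma> * ln (1 + x) \<le> s * ln (1 + x)"
        using s x by (intro mult_right_mono) auto
      ultimately have "\<sigma> * ln (1 + x) \<le> s * ln s + x"
        using s by linarith
      then show "(1 + x) powr \<sigma> \<le> exp (s * ln s) * exp x"
        using x by (simp add: powr_def flip: exp_add)
      show "0 \<le> log_weight \<sigma> k" by (simp add: log_weight_def)
    qed
    finally show ?thesis
      by (simp add: x_def mult_ac)
  qed
  then show thesis
    by (intro that[of "exp (s * ln s)"]) auto
qed

definition conjugated_potential :: "(real \<Rightarrow> mat) \<Rightarrow> (real \<Rightarrow> mat) \<Rightarrow> (site \<Rightarrow> real) \<Rightarrow> real \<Rightarrow> mat" where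
  "conjugated_potential U U' v \<theta> = (\<lambda>m k. U' \<theta> m k * of_real (v k)) \<odot> U \<theta>"

text \<open>The conjugated potential keeps the logarithmic decay of \<open>v\<close> along its rows: the change of weight
between \<open>m\<close> and \<open>k\<close> is paid for by one unit of the decay rate of \<open>U'\<close>.\<close>

lemma conjugated_potential_bounded:
  assumes conj: "stark_conjugation (r + 1) \<Theta> Q U U' M" and r: "0 \<le> r"
    and \<sigma>: "0 \<le> \<sigma>" and K: "0 < K" "\<And>m k. log_weight \<sigma> m \<le> K * exp (l1norm (m - k)) * log_weight \<sigma> k"
    and v: "\<And>m. log_weight \<sigma> m * \<bar>v m\<bar> \<le> 1"
  shows "lip_bounded (log_weight \<sigma>) r \<Theta> (conjugated_potential U U' v) (2 * (K * M) * M)"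
  unfolding conjugated_potential_def
proof (rule lip_bounded_mult[OF _ _ r log_weight_ge_1[OF \<sigma>]])
  show "lip_bounded unit_weight r \<Theta> U M"
    by (rule lip_bounded_weaken[OF stark_conjugationD(1)[OF conj]]) auto
  have cmp: "row_bounded (log_weight \<sigma>) r (\<lambda>m k. A m k * of_real (v k)) (K * a)"
    if A: "row_bounded unit_weight (r + 1) A a" for A a
  proof (rule row_bounded_comparison[OF A])
    fix m k
    have "log_weight \<sigma> m * \<bar>v k\<bar> \<le> K * exp (l1norm (m - k)) * log_weight \<sigma> k * \<bar>v k\<bar>"
      by (intro mult_right_mono K) simp
    also have "\<dots> = K * exp (l1norm (m - k)) * (log_weight \<sigma> k * \<bar>v k\<bar>)" by simp
    also have "\<dots> \<le> K * exp (l1norm (m - k)) * 1"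
      using K(1) by (intro mult_left_mono v) auto
    finally have "log_weight \<sigma> m * \<bar>v k\<bar> * (cmod (A m k) * exp (r * l1norm (m - k)))
        \<le> K * exp (l1norm (m - k)) * (cmod (A m k) * exp (r * l1norm (m - k)))"
      by (intro mult_right_mono) auto
    also have "\<dots> = K * (cmod (A m k) * exp ((r + 1) * l1norm (m - k)))"
      by (simp add: distrib_right exp_add)
    finally show "log_weight \<sigma> m * (cmod (A m k * of_real (v k)) * exp (r * l1norm (m - k)))
        \<le> K * (unit_weight m * (cmod (A m k) * exp ((r + 1) * l1norm (m - k))))"
      by (simp add: norm_mult mult_ac)
  qed (use K in simp)
  show "lip_bounded (log_weight \<sigma>) r \<Theta> (\<lambda>\<theta> m k. U' \<theta> m k * of_real (v k)) (K * M)"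
  proof (rule lip_boundedI)
    fix \<theta> \<theta>' assume th: "\<theta> \<in> \<Theta>" "\<theta>' \<in> \<Theta>"
    note U' = stark_conjugationD(2)[OF conj]
    show "row_bounded (log_weight \<sigma>) r (\<lambda>m k. U' \<theta> m k * of_real (v k)) (K * M)"
      by (rule cmp[OF lip_boundedD(1)[OF U' th(1)]])
    show "row_bounded (log_weight \<sigma>) r (\<lambda>m k. U' \<theta> m k * of_real (v k) - U' \<theta>' m k * of_real (v k)) (K * M * \<bar>\<theta> - \<theta>'\<bar>)"
      using cmp[OF lip_boundedD(2)[OF U' th]] by (simp add: left_diff_distrib mult.assoc)
  qed
qed

lemma lip_bounded_scale:
  assumes A: "lip_bounded w r S A M" and w: "\<And>m. 0 \<le> w m"
  shows "lip_bounded w r S (\<lambda>\<theta> m n. c * A \<theta> m n) (cmod c * M)"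
proof (rule lip_boundedI)
  fix \<theta> \<theta>' assume th: "\<theta> \<in> S" "\<theta>' \<in> S"
  show "row_bounded w r (\<lambda>m n. c * A \<theta> m n) (cmod c * M)"
    by (rule row_bounded_smaller[OF lip_boundedD(1)[OF A th(1)]]) (simp_all add: norm_mult w)
  show "row_bounded w r (\<lambda>m n. c * A \<theta> m n - c * A \<theta>' m n) (cmod c * M * \<bar>\<theta> - \<theta>'\<bar>)"
    using row_bounded_smaller[OF lip_boundedD(2)[OF A th], of "\<lambda>m n. c * A \<theta> m n - c * A \<theta>' m n" "cmod c"]
    by (simp add: norm_mult w mult.assoc flip: right_diff_distrib)
qed

text \<open>The relation \<open>(\<Delta> + D + \<epsilon> v) U = U (D + P)\<close> for \<open>P = \<epsilon> U' v U\<close>, applied to the columns of \<open>V\<close>. The two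
unbounded terms are combined in each summand before summation.\<close>

lemma conjugated_hamiltonian:
  assumes conj: "stark_conjugation r \<Theta> directions U U' M" and \<theta>: "\<theta> \<in> \<Theta>" and r: "0 \<le> r"
    and v: "\<And>m. \<bar>v m\<bar> \<le> 1" and V: "row_bounded unit_weight r V c"
    and eq: "\<And>m n. of_real (slope \<theta> m) * V m n
        + ((\<lambda>m n. of_real \<epsilon> * conjugated_potential U U' v \<theta> m n) \<odot> V) m n = V m n * D n"
  shows "hamiltonian v \<theta> \<epsilon> (\<lambda>k. (U \<theta> \<odot> V) k n) m = D n * (U \<theta> \<odot> V) m n"
proof -
  define Y where "Y m k = U' \<theta> m k * of_real (v k)" for m k
  define P where "P m n = of_real \<epsilon> * (Y \<odot> U \<theta>) m n" for m n
  have w: "1 \<le> unit_weight m" for m by simp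
  have U: "row_bounded unit_weight r (U \<theta>) M"
    by (rule lip_boundedD(1)[OF stark_conjugationD(1)[OF conj] \<theta>])
  have U': "row_bounded unit_weight r (U' \<theta>) M"
    by (rule lip_boundedD(1)[OF stark_conjugationD(2)[OF conj] \<theta>])
  have Y: "row_bounded unit_weight r Y (1 * M)"
    by (rule row_bounded_smaller[OF U']) (auto simp: Y_def norm_mult mult_left_le v)
  have YU: "row_bounded unit_weight r (Y \<odot> U \<theta>) (1 * M * M)"
    by (rule row_bounded_mult[OF Y U r w])
  have P: "row_bounded unit_weight r P (cmod (of_real \<epsilon>) * (1 * M * M))"
    by (rule row_bounded_smaller[OF YU]) (auto simp: P_def norm_mult)
  have PV: "row_bounded unit_weight r (P \<odot> V) (cmod (of_real \<epsilon>) * (1 * M * M) * c)"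
    by (rule row_bounded_mult[OF P V r w])
  have eq': "of_real (slope \<theta> m) * V m n + (P \<odot> V) m n = V m n * D n" for m n
    using eq[of m n] unfolding conjugated_potential_def Y_def[abs_def, symmetric] P_def[abs_def, symmetric] .
  have UY: "U \<theta> \<odot> Y = (\<lambda>m k. mat_id m k * of_real (v k))"
  proof (intro ext)
    fix m k
    have "(U \<theta> \<odot> Y) m k = (U \<theta> \<odot> U' \<theta>) m k * of_real (v k)"
      unfolding mat_mult_def Y_def mult.assoc[symmetric] by (rule infsum_cmult_left')
    then show "(U \<theta> \<odot> Y) m k = mat_id m k * of_real (v k)"
      by (simp add: stark_conjugationD(3)[OF conj \<theta>])
  qed
  have UYU: "(U \<theta> \<odot> (Y \<odot> U \<theta>)) m k = of_real (v m) * U \<theta> m k" for m k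
  proof -
    have "(U \<theta> \<odot> (Y \<odot> U \<theta>)) m k = ((\<lambda>m k. mat_id m k * of_real (v k)) \<odot> U \<theta>) m k"
      by (simp only: mat_mult_assoc[OF U Y U r, symmetric] UY)
    also have "\<dots> = (\<Sum>\<^sub>\<infinity>l\<in>{m}. mat_id m l * of_real (v l) * U \<theta> l k)"
      unfolding mat_mult_def by (rule infsum_cong_neutral) (auto simp: mat_id_def)
    finally show ?thesis by (simp add: mat_id_def)
  qed
  have UP: "(U \<theta> \<odot> P) m k = of_real \<epsilon> * of_real (v m) * U \<theta> m k" for m k
  proof -
    have "(U \<theta> \<odot> P) m k = (\<Sum>\<^sub>\<infinity>l. of_real \<epsilon> * (U \<theta> m l * (Y \<odot> U \<theta>) l k))"
      unfolding mat_mult_def[of "U \<theta>" P] P_def by (simp add: mult_ac)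
    also have "\<dots> = of_real \<epsilon> * (U \<theta> \<odot> (Y \<odot> U \<theta>)) m k"
      unfolding mat_mult_def[of "U \<theta>" "Y \<odot> U \<theta>"] by (rule infsum_cmult_right')
    finally show ?thesis by (simp add: UYU)
  qed
  have "(U \<theta> \<odot> (P \<odot> V)) m n = (\<Sum>\<^sub>\<infinity>k. of_real \<epsilon> * of_real (v m) * (U \<theta> m k * V k n))"
    unfolding mat_mult_assoc[OF U P V r, symmetric] mat_mult_def[of "U \<theta> \<odot> P"] UP by (simp add: mult.assoc)
  also have "\<dots> = of_real \<epsilon> * of_real (v m) * (U \<theta> \<odot> V) m n"
    unfolding mat_mult_def[of "U \<theta>" V] by (rule infsum_cmult_right')
  finally have UPV: "(U \<theta> \<odot> (P \<odot> V)) m n = of_real \<epsilon> * of_real (v m) * (U \<theta> \<odot> V) m n" .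
  have h: "((\<lambda>k. U \<theta> m' k * V k n) has_sum (U \<theta> \<odot> V) m' n) UNIV" for m'
    by (rule mat_mult_has_sum[OF U V r])
  have fin: "finite directions" by (simp add: directions_def)
  have 1: "((\<lambda>k. (\<Sum>q\<in>directions. U \<theta> (m - q) k * V k n) + of_real (slope \<theta> m) * (U \<theta> m k * V k n)) has_sum
      ((\<Sum>q\<in>directions. (U \<theta> \<odot> V) (m - q) n) + of_real (slope \<theta> m) * (U \<theta> \<odot> V) m n)) UNIV"
    by (intro has_sum_add has_sum_finite_sum fin has_sum_cmult_right h)
  have 2: "((\<lambda>k. D n * (U \<theta> m k * V k n) - U \<theta> m k * (P \<odot> V) k n) has_sum
      (D n * (U \<theta> \<odot> V) m n - (U \<theta> \<odot> (P \<odot> V)) m n)) UNIV"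
    by (intro has_sum_diff has_sum_cmult_right h mat_mult_has_sum[OF U PV r])
  have "(\<Sum>q\<in>directions. U \<theta> (m - q) k * V k n) + of_real (slope \<theta> m) * (U \<theta> m k * V k n)
      = D n * (U \<theta> m k * V k n) - U \<theta> m k * (P \<odot> V) k n" for k
  proof -
    have "(\<Sum>q\<in>directions. U \<theta> (m - q) k * V k n) = - (of_real (slope \<theta> m - slope \<theta> k) * U \<theta> m k) * V k n"
      unfolding stark_conjugationD(6)[OF conj \<theta>] by (simp add: sum_distrib_right)
    moreover have "D n * (U \<theta> m k * V k n) - U \<theta> m k * (P \<odot> V) k n = U \<theta> m k * (of_real (slope \<theta> k) * V k n)"
    proof -
      have "V k n * D n - (P \<odot> V) k n = of_real (slope \<theta> k) * V k n"
        unfolding eq'[of k n, symmetric] by simp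
      moreover have "D n * (U \<theta> m k * V k n) - U \<theta> m k * (P \<odot> V) k n = U \<theta> m k * (V k n * D n - (P \<odot> V) k n)"
        by (simp add: algebra_simps)
      ultimately show ?thesis by simp
    qed
    ultimately show ?thesis
      by (simp add: algebra_simps)
  qed
  from has_sum_unique[OF 1[unfolded this] 2]
  have "(\<Sum>q\<in>directions. (U \<theta> \<odot> V) (m - q) n) + of_real (slope \<theta> m) * (U \<theta> \<odot> V) m n
      = D n * (U \<theta> \<odot> V) m n - of_real \<epsilon> * of_real (v m) * (U \<theta> \<odot> V) m n"
    unfolding UPV .
  moreover have "(\<Sum>q\<in>directions. (U \<theta> \<odot> V) (m - q) n) = (\<Sum>q\<in>directions. (U \<theta> \<odot> V) (m + q) n)"
    using sum_directions_uminus[of "\<lambda>q. (U \<theta> \<odot> V) (m + q) n"] by simp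
  ultimately show ?thesis
    unfolding hamiltonian_eq by (simp add: algebra_simps)
qed

definition exponentially_localized ::
  "(site \<Rightarrow> real) \<Rightarrow> real \<Rightarrow> real \<Rightarrow> real \<Rightarrow> real \<Rightarrow> bool" where
  "exponentially_localized v \<theta> \<epsilon> r C \<longleftrightarrow> pure_point_spectrum v \<theta> \<epsilon> \<and>
     (\<forall>E. eigenvalue v \<theta> \<epsilon> E \<longrightarrow> simple_eigenvalue v \<theta> \<epsilon> E) \<and>
     (\<exists>\<psi> :: site \<Rightarrow> site \<Rightarrow> complex. orthonormal_basis UNIV \<psi> \<and> (\<forall>n. eigenvector v \<theta> \<epsilon> (\<psi> n)) \<and>
       (\<forall>m n. cmod (\<psi> n m) \<le> C * exp (- r * l1norm (m - n))))"

lemma exponentially_localized_mono: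
  assumes loc: "exponentially_localized v \<theta> \<epsilon> r C" and C: "C \<le> C'"
  shows "exponentially_localized v \<theta> \<epsilon> r C'"
proof -
  have "C * exp (- r * l1norm k) \<le> C' * exp (- r * l1norm k)" for k
    using C by (intro mult_right_mono) auto
  then show ?thesis
    using loc unfolding exponentially_localized_def by (meson order_trans)
qed

lemma localization_of_conjugated:
  assumes conj: "stark_conjugation r \<Theta> directions U U' M" and \<theta>: "\<theta> \<in> \<Theta>" and r: "0 < r"
    and v: "\<And>m. \<bar>v m\<bar> \<le> 1" and V: "row_bounded unit_weight r (\<lambda>m n. V m n - mat_id m n) (1/4)"
    and D: "inj D"
    and eq: "\<And>m n. of_real (slope \<theta> m) * V m n
        + ((\<lambda>m n. of_real \<epsilon> * conjugated_potential U U' v \<theta> m n) \<odot> V) m n = V m n * D n"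
  shows "exponentially_localized v \<theta> \<epsilon> r (2 * M * (M * (5/4)))"
proof -
  have r0: "0 \<le> r" using r by simp
  have w: "1 \<le> unit_weight m" for m by simp
  have U: "row_bounded unit_weight r (U \<theta>) M"
    by (rule lip_boundedD(1)[OF stark_conjugationD(1)[OF conj] \<theta>])
  have U': "row_bounded unit_weight r (U' \<theta>) M"
    by (rule lip_boundedD(1)[OF stark_conjugationD(2)[OF conj] \<theta>])
  have Vb: "row_bounded unit_weight r V (5/4)"
    using row_bounded_add[OF row_bounded_id V] by simp
  obtain S where S: "row_bounded unit_weight r S 2" "V \<odot> S = mat_id"
    using right_inverse_near_id[OF V _ r0] by auto
  have T: "row_bounded unit_weight r (U \<theta> \<odot> V) (M * (5/4))"
    by (rule row_bounded_mult[OF U Vb r0 w])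
  have SU': "row_bounded unit_weight r (S \<odot> U' \<theta>) (2 * M)"
    by (rule row_bounded_mult[OF S(1) U' r0 w])
  have TS: "(U \<theta> \<odot> V) \<odot> (S \<odot> U' \<theta>) = mat_id"
    unfolding mat_mult_assoc[OF U Vb SU' r0] mat_mult_assoc[OF Vb S(1) U' r0, symmetric] S(2)
    by (simp add: stark_conjugationD(3)[OF conj \<theta>])
  have AT: "U' \<theta> \<odot> (U \<theta> \<odot> V) = V"
    unfolding mat_mult_assoc[OF U' U Vb r0, symmetric] by (simp add: stark_conjugationD(4)[OF conj \<theta>])
  have diag: "1/2 \<le> cmod ((U' \<theta> \<odot> (U \<theta> \<odot> V)) n n)" for n
  proof -
    have "cmod (V n n - 1) \<le> 1/4"
      using row_bounded_entry_le[OF V r0, of n n] by (simp add: mat_id_def)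
    then show ?thesis
      unfolding AT using norm_triangle_ineq2[of 1 "1 - V n n"] by (simp add: norm_minus_commute)
  qed
  have eig: "hamiltonian v \<theta> \<epsilon> (\<lambda>k. (U \<theta> \<odot> V) k n) m = D n * (U \<theta> \<odot> V) m n" for m n
    by (rule conjugated_hamiltonian[OF conj \<theta> r0 v Vb eq])
  show ?thesis
    unfolding exponentially_localized_def
    using localized_eigenbasis[OF r T SU' U' TS diag eig D] by blast
qed

context kam
begin

text \<open>The iteration starts at \<open>exp (- \<Lambda>0) = CW \<epsilon>\<close>, where \<open>CW \<epsilon>\<close> bounds the conjugated potential, and
discards measure \<open>2 (CW \<epsilon>) powr (1/9)\<close>. Small \<open>\<epsilon>\<close> makes \<open>\<Lambda>0\<close> large and keeps this below the measure of
\<open>DC\<close>.\<close>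

theorem localization_on_Cantor_set:
  assumes b_pos: "0 < b" and DC_pos: "0 < emeasure lebesgue (DC \<gamma> \<tau>)" and \<tau>\<sigma>: "\<tau> < \<sigma>"
  shows "\<exists>\<epsilon>0>0. \<exists>C0>0. \<exists>C1>0. \<forall>\<epsilon> v. 0 < \<epsilon> \<and> \<epsilon> < \<epsilon>0 \<and> (\<forall>n. \<bar>v n\<bar> \<le> ln (bracket n) powr (- \<sigma>)) \<longrightarrow>
    (\<exists>\<O>. cantor_like \<O> \<and> \<O> \<subseteq> DC \<gamma> \<tau> \<and>
      emeasure lebesgue (DC \<gamma> \<tau> - \<O>) \<le> ennreal (C0 * \<epsilon> powr (1 / 10)) \<and>
      (\<forall>\<theta>\<in>\<O>. exponentially_localized v \<theta> \<epsilon> b C1))"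
proof -
  \<comment> \<open>One unit of decay is spent on the conjugated potential and one on the iteration.\<close>
  obtain U U' M where conj: "stark_conjugation (b + 1 + 1) (DC \<gamma> \<tau>) directions U U' M"
  proof -
    have "0 \<le> b + 1 + 1" using b_pos by simp
    then have "\<exists>U U' M. stark_conjugation (b + 1 + 1) (DC \<gamma> \<tau>) directions U U' M"
      by (rule stark_conjugation_exists[OF \<gamma> order_refl])
    then show thesis
      by (elim exE) (rule that)
  qed
  have conj_b: "stark_conjugation b (DC \<gamma> \<tau>) directions U U' M"
    using conj unfolding stark_conjugation_def
    by (elim conjE, intro conjI) (rule lip_bounded_weaken; assumption?; simp)+
  obtain K where K: "0 < K" "\<And>m k. log_weight \<sigma> m \<le> K * exp (l1norm (m - k)) * log_weight \<sigma> k"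
    using log_weight_ratio[of \<sigma>] \<sigma> by auto
  define m0 where "m0 = measure lebesgue (DC \<gamma> \<tau>)"
  have DC_fin: "emeasure lebesgue (DC \<gamma> \<tau>) = ennreal m0"
  proof -
    have "DC \<gamma> \<tau> \<in> lmeasurable"
      using compact_DC by (rule lmeasurable_compact)
    then show ?thesis
      unfolding m0_def by (rule emeasure_eq_measure2)
  qed
  have m0: "0 < m0"
    using DC_pos unfolding DC_fin by simp
  define CW where "CW = max 1 (2 * (K * M) * M)"
  have CW: "1 \<le> CW" "2 * (K * M) * M \<le> CW" by (simp_all add: CW_def)
  obtain \<Lambda>1 where \<Lambda>1: "\<And>\<Lambda>. \<Lambda>1 \<le> \<Lambda> \<Longrightarrow> large \<Lambda>"
    using eventually_large by (auto simp: eventually_at_top_linorder)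
  \<comment> \<open>The second bound gives \<open>2 exp (- \<Lambda>/9) \<le> m0 / 2\<close>, so that angles remain.\<close>
  define \<Lambda>2 where "\<Lambda>2 = max \<Lambda>1 (9 * ln (4 / m0))"
  define \<epsilon>0 where "\<epsilon>0 = min 1 (exp (- \<Lambda>2) / CW)"
  define C0 where "C0 = 2 * CW powr (1/9)"
  define C1 where "C1 = 2 * M * (M * (5/4)) + 1"
  have pos: "0 < \<epsilon>0" "0 < C0" "0 < C1"
  proof -
    show "0 < \<epsilon>0" "0 < C0" using CW by (simp_all add: \<epsilon>0_def C0_def)
    have "0 \<le> M * M" by simp
    then show "0 < C1" unfolding C1_def by linarith
  qed
  show ?thesis
  proof (rule exI[of _ \<epsilon>0], intro conjI pos, rule exI[of _ C0], intro conjI pos, rule exI[of _ C1],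
      intro conjI pos allI impI, elim conjE)
    fix \<epsilon> :: real and v :: "site \<Rightarrow> real"
    assume \<epsilon>: "0 < \<epsilon>" "\<epsilon> < \<epsilon>0" and v: "\<forall>n. \<bar>v n\<bar> \<le> ln (bracket n) powr (- \<sigma>)"
    define \<Lambda>0 where "\<Lambda>0 = - ln (CW * \<epsilon>)"
    have CW\<epsilon>: "0 < CW * \<epsilon>" "exp (- \<Lambda>0) = CW * \<epsilon>"
      using CW \<epsilon> by (simp_all add: \<Lambda>0_def)
    have "CW * \<epsilon> < exp (- \<Lambda>2)"
      using \<epsilon> CW by (simp add: \<epsilon>0_def field_simps)
    then have "\<Lambda>2 \<le> \<Lambda>0"
      unfolding CW\<epsilon>(2)[symmetric] by simp
    then have \<Lambda>0: "\<Lambda>1 \<le> \<Lambda>0" "9 * ln (4 / m0) \<le> \<Lambda>0"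
      by (simp_all add: \<Lambda>2_def)
    have wv: "log_weight \<sigma> m * \<bar>v m\<bar> \<le> 1" for m
    proof -
      have "log_weight \<sigma> m * \<bar>v m\<bar> \<le> log_weight \<sigma> m * ln (bracket m) powr (- \<sigma>)"
        by (intro mult_left_mono spec[OF v] w_nonneg)
      also have "\<dots> = 1"
        using ln_bracket_ge_1[of m] by (simp add: log_weight_def powr_minus field_simps)
      finally show ?thesis .
    qed
    have v1: "\<bar>v m\<bar> \<le> 1" for m
      using mult_right_mono[OF w_ge_1[of m] abs_ge_zero[of "v m"]] wv[of m] by linarith
    define P0 where "P0 \<theta> m n = of_real \<epsilon> * conjugated_potential U U' v \<theta> m n" for \<theta> m n
    have P0: "lip_bounded w (b + 1) (DC \<gamma> \<tau>) P0 (exp (- \<Lambda>0))"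
      unfolding P0_def
    proof (rule lip_bounded_mono[OF lip_bounded_scale[OF conjugated_potential_bounded[OF conj _ _ K wv] w_nonneg]])
      show "cmod (of_real \<epsilon>) * (2 * (K * M) * M) \<le> exp (- \<Lambda>0)"
        using mult_left_mono[OF CW(2), of \<epsilon>] \<epsilon> by (simp add: CW\<epsilon> mult.commute)
    qed (use b_pos \<sigma> in auto)
    have "\<exists>B. open B \<and> emeasure lebesgue B \<le> ennreal (2 * exp (- \<Lambda>0 / 9)) \<and>
      (\<forall>\<theta>\<in>DC \<gamma> \<tau> - B. \<exists>V D. row_bounded unit_weight b (\<lambda>m n. V m n - mat_id m n) (1/4) \<and> inj D \<and>
         (\<forall>m n. of_real (slope \<theta> m) * V m n + (P0 \<theta> \<odot> V) m n = V m n * D n))"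
      by (rule kam_diagonalization[OF \<Lambda>1[OF order_trans[OF \<Lambda>0(1)]] P0])
    then obtain B where B: "open B" "emeasure lebesgue B \<le> ennreal (2 * exp (- \<Lambda>0 / 9))"
      and diag: "\<forall>\<theta>\<in>DC \<gamma> \<tau> - B. \<exists>V D. row_bounded unit_weight b (\<lambda>m n. V m n - mat_id m n) (1/4) \<and> inj D \<and>
         (\<forall>m n. of_real (slope \<theta> m) * V m n + (P0 \<theta> \<odot> V) m n = V m n * D n)"
      by (elim exE conjE)
    have "2 * exp (- \<Lambda>0 / 9) < m0"
    proof -
      have "exp (- \<Lambda>0 / 9) \<le> exp (- ln (4 / m0))"
        using \<Lambda>0(2) by simp
      also have "\<dots> = m0 / 4"
        using m0 by (simp add: exp_minus)
      finally show ?thesis using m0 by linarith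
    qed
    then have "ennreal (2 * exp (- \<Lambda>0 / 9)) < ennreal m0"
      using m0 by (intro ennreal_lessI) auto
    then have B_small: "emeasure lebesgue B < emeasure lebesgue (DC \<gamma> \<tau>)"
      using B(2) DC_fin by simp
    have rate: "2 * exp (- \<Lambda>0 / 9) \<le> C0 * \<epsilon> powr (1 / 10)"
    proof -
      have "exp (- \<Lambda>0 / 9) = (CW * \<epsilon>) powr (1/9)"
        using CW(1) \<epsilon>(1) by (simp add: \<Lambda>0_def powr_def)
      also have "\<dots> = CW powr (1/9) * \<epsilon> powr (1/9)"
        by (rule powr_mult)
      also have "\<dots> \<le> CW powr (1/9) * \<epsilon> powr (1/10)"
        using \<epsilon> by (intro mult_left_mono powr_mono') (auto simp: \<epsilon>0_def)
      finally show ?thesis by (simp add: C0_def)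
    qed
    obtain \<O> where \<O>: "cantor_like \<O>" "\<O> \<subseteq> DC \<gamma> \<tau> - B"
      "emeasure lebesgue (DC \<gamma> \<tau> - \<O>) \<le> emeasure lebesgue B"
      using cantor_part_of_DC[OF \<gamma> B(1) B_small] by metis
    show "\<exists>\<O>. cantor_like \<O> \<and> \<O> \<subseteq> DC \<gamma> \<tau> \<and>
      emeasure lebesgue (DC \<gamma> \<tau> - \<O>) \<le> ennreal (C0 * \<epsilon> powr (1 / 10)) \<and>
      (\<forall>\<theta>\<in>\<O>. exponentially_localized v \<theta> \<epsilon> b C1)"
    proof (rule exI[of _ \<O>], intro conjI[OF \<O>(1)] conjI[OF _ conjI[OF _ ballI]])
      show "\<O> \<subseteq> DC \<gamma> \<tau>" using \<O>(2) by blast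
      show "emeasure lebesgue (DC \<gamma> \<tau> - \<O>) \<le> ennreal (C0 * \<epsilon> powr (1 / 10))"
        by (rule order_trans[OF \<O>(3) order_trans[OF B(2) ennreal_leI[OF rate]]])
      fix \<theta> assume "\<theta> \<in> \<O>"
      then have \<theta>: "\<theta> \<in> DC \<gamma> \<tau> - B" "\<theta> \<in> DC \<gamma> \<tau>"
        using \<O>(2) by auto
      obtain V D where V: "row_bounded unit_weight b (\<lambda>m n. V m n - mat_id m n) (1/4)" "inj D"
        and eq: "\<And>m n. of_real (slope \<theta> m) * V m n + (P0 \<theta> \<odot> V) m n = V m n * D n"
        using bspec[OF diag \<theta>(1)] by blast
      have "exponentially_localized v \<theta> \<epsilon> b (2 * M * (M * (5/4)))"
        by (rule localization_of_conjugated[OF conj_b \<theta>(2) b_pos v1 V eq[unfolded P0_def[abs_def]]])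
      then show "exponentially_localized v \<theta> \<epsilon> b C1"
        by (rule exponentially_localized_mono) (simp add: C1_def)
    qed
  qed
qed

end

theorem theorem2p3:
  fixes \<tau> :: real
  assumes "\<tau> > 1"
  shows "\<exists>\<gamma>0>0::real. \<forall>\<gamma>. 0 < \<gamma> \<and> \<gamma> < \<gamma>0 \<longrightarrow>
    (\<forall>(\<mu>::real) (\<rho>::real) (a::real) (\<sigma>::real). 0 < \<mu> \<and> \<mu> < 1 \<and> 0 < \<rho> \<and> 0 < a \<and> \<sigma> > \<tau> / \<mu> \<longrightarrow>
      (\<exists>\<epsilon>0>0::real. \<exists>C0>0::real. \<forall>\<epsilon>. 0 < \<epsilon> \<and> \<epsilon> < \<epsilon>0 \<longrightarrow>
        (\<exists>C1>0::real. \<forall>v :: site \<Rightarrow> real. (\<forall>n. \<bar>v n\<bar> \<le> ln (bracket n) powr (- \<sigma>)) \<longrightarrow>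
          (\<exists>\<O>. cantor_like \<O> \<and> \<O> \<subseteq> DC \<gamma> \<tau> \<and>
            emeasure lebesgue (DC \<gamma> \<tau> - \<O>) \<le> ennreal (C0 * \<epsilon> powr (1 / 10)) \<and>
            (\<forall>\<theta>\<in>\<O>.
              pure_point_spectrum v \<theta> \<epsilon> \<and>
              (\<forall>E. eigenvalue v \<theta> \<epsilon> E \<longrightarrow> simple_eigenvalue v \<theta> \<epsilon> E) \<and>
              (\<exists>\<psi> :: site \<Rightarrow> site \<Rightarrow> complex.
                orthonormal_basis UNIV \<psi> \<and>
                (\<forall>n. eigenvector v \<theta> \<epsilon> (\<psi> n)) \<and>
                (\<forall>m n. cmod (\<psi> n m) \<le> C1 * exp (- (a / 4) * l1norm (m - n)))))))))"
proof -
  obtain \<gamma>0 where \<gamma>0: "0 < \<gamma>0" "\<And>\<gamma>. 0 < \<gamma> \<Longrightarrow> \<gamma> < \<gamma>0 \<Longrightarrow> 0 < emeasure lebesgue (DC \<gamma> \<tau>)"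
    using DC_positive_measure[OF assms] by metis
  show ?thesis
  proof (rule exI[of _ \<gamma>0], intro conjI \<gamma>0(1) allI impI; (elim conjE)?)
    fix \<gamma> \<mu> \<rho> a \<sigma> :: real
    assume \<gamma>: "0 < \<gamma>" "\<gamma> < \<gamma>0" and \<mu>: "0 < \<mu>" "\<mu> < 1" and a: "0 < a" and \<sigma>: "\<tau> / \<mu> < \<sigma>"
    have \<tau>0: "0 < \<tau>" using assms by simp
    have "\<tau> \<le> \<tau> / \<mu>"
      using \<mu> \<tau>0 by (simp add: field_simps)
    then have \<tau>\<sigma>: "\<tau> < \<sigma>" using \<sigma> by simp
    \<comment> \<open>With this choice \<open>(1 + \<eta>) \<tau> = (\<sigma> + \<tau>) / 2\<close>.\<close>
    interpret kam: kam \<gamma> \<tau> \<sigma> "(\<sigma> / \<tau> - 1) / 2" "a / 4"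
      by unfold_locales (use \<gamma> \<tau>0 \<tau>\<sigma> a in \<open>auto simp: field_simps\<close>)
    have "0 < a / 4" using a by simp
    from kam.localization_on_Cantor_set[OF this \<gamma>0(2)[OF \<gamma>] \<tau>\<sigma>]
    obtain \<epsilon>0 C0 C1 :: real where pos: "0 < \<epsilon>0" "0 < C0" "0 < C1"
      and main: "\<forall>\<epsilon> v. 0 < \<epsilon> \<and> \<epsilon> < \<epsilon>0 \<and> (\<forall>n. \<bar>v n\<bar> \<le> ln (bracket n) powr (- \<sigma>)) \<longrightarrow>
        (\<exists>\<O>. cantor_like \<O> \<and> \<O> \<subseteq> DC \<gamma> \<tau> \<and>
          emeasure lebesgue (DC \<gamma> \<tau> - \<O>) \<le> ennreal (C0 * \<epsilon> powr (1 / 10)) \<and>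
          (\<forall>\<theta>\<in>\<O>. exponentially_localized v \<theta> \<epsilon> (a / 4) C1))"
      by (elim exE conjE)
    show "\<exists>\<epsilon>0>0::real. \<exists>C0>0::real. \<forall>\<epsilon>. 0 < \<epsilon> \<and> \<epsilon> < \<epsilon>0 \<longrightarrow>
      (\<exists>C1>0::real. \<forall>v :: site \<Rightarrow> real. (\<forall>n. \<bar>v n\<bar> \<le> ln (bracket n) powr (- \<sigma>)) \<longrightarrow>
        (\<exists>\<O>. cantor_like \<O> \<and> \<O> \<subseteq> DC \<gamma> \<tau> \<and>
          emeasure lebesgue (DC \<gamma> \<tau> - \<O>) \<le> ennreal (C0 * \<epsilon> powr (1 / 10)) \<and>
          (\<forall>\<theta>\<in>\<O>.
            pure_point_spectrum v \<theta> \<epsilon> \<and>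
            (\<forall>E. eigenvalue v \<theta> \<epsilon> E \<longrightarrow> simple_eigenvalue v \<theta> \<epsilon> E) \<and>
            (\<exists>\<psi> :: site \<Rightarrow> site \<Rightarrow> complex.
              orthonormal_basis UNIV \<psi> \<and>
              (\<forall>n. eigenvector v \<theta> \<epsilon> (\<psi> n)) \<and>
              (\<forall>m n. cmod (\<psi> n m) \<le> C1 * exp (- (a / 4) * l1norm (m - n)))))))"
      unfolding exponentially_localized_def[symmetric]
    proof (rule exI[of _ \<epsilon>0], intro conjI pos, rule exI[of _ C0], intro conjI pos allI impI, elim conjE,
        rule exI[of _ C1], intro conjI pos allI impI)
      fix \<epsilon> and v :: "site \<Rightarrow> real"
      assume "0 < \<epsilon>" "\<epsilon> < \<epsilon>0" "\<forall>n. \<bar>v n\<bar> \<le> ln (bracket n) powr (- \<sigma>)"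
      then show "\<exists>\<O>. cantor_like \<O> \<and> \<O> \<subseteq> DC \<gamma> \<tau> \<and>
          emeasure lebesgue (DC \<gamma> \<tau> - \<O>) \<le> ennreal (C0 * \<epsilon> powr (1 / 10)) \<and>
          (\<forall>\<theta>\<in>\<O>. exponentially_localized v \<theta> \<epsilon> (a / 4) C1)"
        by (intro main[THEN spec, THEN spec, THEN mp] conjI)
    qed
  qed
qed

end
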